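(* (a) Let $\Pi$ be a profinite group and let $\Pi_1$ be a closed subgroup of $\Pi$ that contains the commutator subgroup $\Pi'$ of $\Pi$. If $\Pi$ is a free profinite group of countably infinite rank, then so is $\Pi_1$. (b) Let $K_1$ be an abelian (algebraic Galois, possibly infinite) extension of a field $K$. If the absolute Galois group of $K$ is a free profinite group of countably infinite rank, then the same holds for the absolute Galois group of $K_1$.
   Context: The absolute Galois group of a field $K$ is $\mathrm{Gal}(K^{\mathrm{s}}/K)$, where $K^{\mathrm{s}}$ is a separable closure of $K$. A subset $S$ of a profinite group $\Pi$ converges to $1$ if $S\cap(\Pi\setminus N)$ is finite for every open normal subgroup $N$ of $\Pi$. A map $\phi:S\to G$ from a set $S$ to a profinite group $G$ converges to $1$ if $\phi^{-1}(G\setminus N)$ is finite for every open normal subgroup $N$ of $G$. A profinite group $\Pi$ is free of rank $m$ if it has a (topological) generating set $S$ of cardinality $m$, converging to $1$, such that every map from $S$ to a profinite group $G$ that converges to $1$ extends uniquely to a continuous homomorphism $\Pi\to G$. *)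

theory Defs
  imports
    "HOL-Analysis.Analysis"
    "HOL-Algebra.Generated_Groups"
    "HOL-Computational_Algebra.Polynomial"
begin

no_notation eq_closure_of (\<open>closure'_of\<index>\<close>)


section \<open>Profinite groups\<close>

record 'a topgroup = "'a monoid" +
  topo :: "'a topology"

definition topological_group :: "'a topgroup \<Rightarrow> bool" where
  "topological_group G \<longleftrightarrow>
     group G \<and> topspace (topo G) = carrier G \<and>
     continuous_map (prod_topology (topo G) (topo G)) (topo G) (\<lambda>(x, y). x \<otimes>\<^bsub>G\<^esub> y) \<and>
     continuous_map (topo G) (topo G) (\<lambda>x. inv\<^bsub>G\<^esub> x)"

definition totally_disconnected_space :: "'a topology \<Rightarrow> bool" where
  "totally_disconnected_space X \<longleftrightarrow> (\<forall>x\<in>topspace X. connected_component_of_set X x = {x})"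

definition profinite :: "'a topgroup \<Rightarrow> bool" where
  "profinite G \<longleftrightarrow>
     topological_group G \<and> compact_space (topo G) \<and> Hausdorff_space (topo G) \<and>
     totally_disconnected_space (topo G)"

definition subgroup_of :: "'a topgroup \<Rightarrow> 'a set \<Rightarrow> 'a topgroup" where
  "subgroup_of G H = G\<lparr>carrier := H, topo := subtopology (topo G) H\<rparr>"

definition open_normal :: "'a topgroup \<Rightarrow> 'a set \<Rightarrow> bool" where
  "open_normal G N \<longleftrightarrow> N \<lhd> G \<and> openin (topo G) N"


section \<open>Free profinite groups\<close>

definition set_converges_to_1 :: "'a topgroup \<Rightarrow> 'a set \<Rightarrow> bool" where
  "set_converges_to_1 P S \<longleftrightarrow> (\<forall>N. open_normal P N \<longrightarrow> finite (S \<inter> (carrier P - N)))"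

definition map_converges_to_1 :: "'s set \<Rightarrow> 'a topgroup \<Rightarrow> ('s \<Rightarrow> 'a) \<Rightarrow> bool" where
  "map_converges_to_1 S G \<phi> \<longleftrightarrow>
     (\<forall>N. open_normal G N \<longrightarrow> finite {s\<in>S. \<phi> s \<in> carrier G - N})"

definition top_generates :: "'a topgroup \<Rightarrow> 'a set \<Rightarrow> bool" where
  "top_generates P S \<longleftrightarrow> S \<subseteq> carrier P \<and> topo P closure_of generate P S = carrier P"

definition continuous_hom :: "'a topgroup \<Rightarrow> 'b topgroup \<Rightarrow> ('a \<Rightarrow> 'b) \<Rightarrow> bool" where
  "continuous_hom P G \<psi> \<longleftrightarrow> \<psi> \<in> hom P G \<and> continuous_map (topo P) (topo G) \<psi>"

text \<open>
  The universal property, for target groups whose carrier lives in the type \<open>'g\<close>.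
  Functions are compared on the carrier of \<open>P\<close> only, hence \<^const>\<open>extensional\<close>.
\<close>

definition universal_for :: "'g itself \<Rightarrow> 'a topgroup \<Rightarrow> 'a set \<Rightarrow> bool" where
  "universal_for _ P S \<longleftrightarrow>
     (\<forall>(G :: 'g topgroup) \<phi>.
        profinite G \<and> \<phi> \<in> S \<rightarrow> carrier G \<and> map_converges_to_1 S G \<phi> \<longrightarrow>
        (\<exists>!\<psi>. \<psi> \<in> extensional (carrier P) \<and> continuous_hom P G \<psi> \<and> (\<forall>s\<in>S. \<psi> s = \<phi> s)))"

text \<open>
  A definition in HOL cannot quantify over all profinite groups in all types.  The universal
  property is therefore required for all profinite groups carried by subsets of one type
  that is large enough to contain a copy of every profinite group topologically generated by
  an image of \<open>S\<close>: a point of such a group is determined by the traces of its neighbourhoods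
  on the dense set of words in the generators and their inverses.  The lemma
  \<open>universal_for_any_type\<close> at the end of this theory shows that this is the
  same as requiring the universal property for profinite groups in every type.
\<close>

type_synonym 'a test_carrier = "(bool \<times> 'a) list set set"

definition free_profinite_on :: "'a topgroup \<Rightarrow> 'a set \<Rightarrow> bool" where
  "free_profinite_on P S \<longleftrightarrow>
     profinite P \<and> top_generates P S \<and> set_converges_to_1 P S \<and>
     universal_for TYPE('a test_carrier) P S"

definition free_profinite_countably_infinite_rank :: "'a topgroup \<Rightarrow> bool" where
  "free_profinite_countably_infinite_rank P \<longleftrightarrow>
     (\<exists>S. free_profinite_on P S \<and> countable S \<and> infinite S)"


section \<open>Absolute Galois groups\<close>

text \<open>
  A field extension \<open>L/K\<close> is given by a homomorphism of fields \<open>i :: K \<Rightarrow> L\<close>.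
\<close>

definition field_hom :: "('k::field \<Rightarrow> 'l::field) \<Rightarrow> bool" where
  "field_hom i \<longleftrightarrow> i 1 = 1 \<and> (\<forall>x y. i (x + y) = i x + i y) \<and> (\<forall>x y. i (x * y) = i x * i y)"

definition separable_poly :: "'k::field poly \<Rightarrow> bool" where
  "separable_poly p \<longleftrightarrow> coprime p (pderiv p)"

text \<open>
  The minimal polynomial of \<open>x\<close> over \<open>K\<close> is, up to a unit, the only irreducible polynomial
  over \<open>K\<close> that vanishes at \<open>x\<close>.
\<close>

definition separable_over :: "('k::field \<Rightarrow> 'l::field) \<Rightarrow> 'l \<Rightarrow> bool" where
  "separable_over i x \<longleftrightarrow>
     (\<exists>p. irreducible p \<and> poly (map_poly i p) x = 0 \<and> separable_poly p)"

definition separable_extension :: "('k::field \<Rightarrow> 'l::field) \<Rightarrow> bool" where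
  "separable_extension i \<longleftrightarrow> field_hom i \<and> (\<forall>x. separable_over i x)"

definition splits :: "'l::field poly \<Rightarrow> bool" where
  "splits p \<longleftrightarrow> (\<exists>c as. p = smult c (\<Prod>a\<leftarrow>as. [:- a, 1:]))"

definition galois_extension :: "('k::field \<Rightarrow> 'l::field) \<Rightarrow> bool" where
  "galois_extension i \<longleftrightarrow>
     separable_extension i \<and>
     (\<forall>p. irreducible p \<and> (\<exists>x. poly (map_poly i p) x = 0) \<longrightarrow> splits (map_poly i p))"

definition separably_closed :: "'l::field itself \<Rightarrow> bool" where
  "separably_closed _ \<longleftrightarrow>
     (\<forall>p :: 'l poly. separable_poly p \<and> degree p > 0 \<longrightarrow> (\<exists>x. poly p x = 0))"

definition separable_closure :: "('k::field \<Rightarrow> 'l::field) \<Rightarrow> bool" where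
  "separable_closure i \<longleftrightarrow> separable_extension i \<and> separably_closed TYPE('l)"

text \<open>
  \<open>Gal(L/K)\<close> with the Krull topology, i.e. the topology of pointwise convergence for the discrete
  topology on \<open>L\<close>: for \<open>L/K\<close> algebraic, agreeing with an automorphism on a finite set \<open>A\<close> is the
  same as agreeing with it on the finite subextension \<open>K(A)\<close>.
\<close>

definition Gal_carrier :: "('k::field \<Rightarrow> 'l::field) \<Rightarrow> ('l \<Rightarrow> 'l) set" where
  "Gal_carrier i = {\<sigma>. field_hom \<sigma> \<and> bij \<sigma> \<and> \<sigma> \<circ> i = i}"

definition Gal :: "('k::field \<Rightarrow> 'l::field) \<Rightarrow> ('l \<Rightarrow> 'l) topgroup" where
  "Gal i = \<lparr>carrier = Gal_carrier i, monoid.mult = (\<circ>), one = id,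
     topo = subtopology (product_topology (\<lambda>_. discrete_topology UNIV) UNIV) (Gal_carrier i)\<rparr>"

definition abelian_extension :: "('k::field \<Rightarrow> 'l::field) \<Rightarrow> bool" where
  "abelian_extension i \<longleftrightarrow> galois_extension i \<and> comm_group (Gal i)"


section \<open>Independence of the universal property from the test type\<close>

lemma topological_groupD:
  assumes "topological_group G"
  shows "group G" "topspace (topo G) = carrier G"
    "continuous_map (prod_topology (topo G) (topo G)) (topo G) (\<lambda>(x, y). x \<otimes>\<^bsub>G\<^esub> y)"
    "continuous_map (topo G) (topo G) (\<lambda>x. inv\<^bsub>G\<^esub> x)"
  using assms by (auto simp: topological_group_def)

lemma profiniteD:
  assumes "profinite G"
  shows "topological_group G" "compact_space (topo G)" "Hausdorff_space (topo G)"
    "totally_disconnected_space (topo G)"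
  using assms by (auto simp: profinite_def)

lemma continuous_map_tg_mult:
  assumes G: "topological_group G" and f: "continuous_map X (topo G) f" and g: "continuous_map X (topo G) g"
  shows "continuous_map X (topo G) (\<lambda>x. f x \<otimes>\<^bsub>G\<^esub> g x)"
proof -
  have "continuous_map X (prod_topology (topo G) (topo G)) (\<lambda>x. (f x, g x))"
    using f g by (simp add: continuous_map_pairedI)
  from continuous_map_compose[OF this topological_groupD(3)[OF G]]
  show ?thesis by (simp add: o_def)
qed

lemma clopen_base:
  assumes comp: "compact_space X" and haus: "Hausdorff_space X" and td: "totally_disconnected_space X"
    and U: "openin X U" "a \<in> U"
  shows "\<exists>C. openin X C \<and> closedin X C \<and> a \<in> C \<and> C \<subseteq> U"
proof -
  have aX: "a \<in> topspace X" using U openin_subset by blast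
  have lc: "locally_compact_space X" using comp haus compact_imp_locally_compact_space by blast
  have q: "quasi_component_of X a = connected_component_of X a"
    using quasi_eq_connected_component_of comp haus by metis
  have sep: "\<exists>T. openin X T \<and> closedin X T \<and> a \<in> T \<and> y \<notin> T" if y: "y \<in> topspace X - U" for y
  proof -
    have "connected_component_of_set X a = {a}" 
      using td aX by (simp add: totally_disconnected_space_def)
    then have "\<not> quasi_component_of X a y" using q y U by auto
    then show ?thesis using aX y by (auto simp: quasi_component_of)
  qed
  have "compactin X (topspace X - U)"
    using comp U closedin_compact_space by blast
  moreover define \<V> where "\<V> = {topspace X - T | T. openin X T \<and> closedin X T \<and> a \<in> T}"
  have "\<forall>V\<in>\<V>. openin X V" by (auto simp: \<V>_def)
  moreover have "topspace X - U \<subseteq> \<Union>\<V>"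
  proof
    fix y assume y: "y \<in> topspace X - U"
    from sep[OF this] obtain T where "openin X T" "closedin X T" "a \<in> T" "y \<notin> T" by blast
    then show "y \<in> \<Union>\<V>" using y unfolding \<V>_def by blast
  qed
  ultimately obtain \<F> where F: "finite \<F>" "\<F> \<subseteq> \<V>" "topspace X - U \<subseteq> \<Union>\<F>"
    unfolding compactin_def by meson
  have Fc: "openin X V \<and> closedin X V \<and> a \<notin> V" if "V \<in> \<F>" for V
    using that F(2) by (auto simp: \<V>_def)
  define C where "C = topspace X - \<Union>\<F>"
  have "closedin X (\<Union>\<F>)" using F(1) Fc by (auto intro: closedin_Union)
  moreover have "openin X (\<Union>\<F>)" using Fc by blast
  ultimately have "openin X C" "closedin X C" by (auto simp: C_def)
  moreover have "a \<in> C" using aX Fc by (auto simp: C_def)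
  moreover have "C \<subseteq> U" using F(3) by (auto simp: C_def)
  ultimately show ?thesis by blast
qed

lemma profinite_open_normal_base:
  fixes G :: "'a topgroup" (structure)
  assumes G: "profinite G" and U: "openin (topo G) U" "\<one>\<^bsub>G\<^esub> \<in> U"
  shows "\<exists>N. open_normal G N \<and> N \<subseteq> U"
proof -
  note tg = profiniteD(1)[OF G]
  interpret group G using topological_groupD(1)[OF tg] .
  let ?T = "topo G"
  note ts = topological_groupD(2)[OF tg]
  obtain C where C: "openin ?T C" "closedin ?T C" "\<one>\<^bsub>G\<^esub> \<in> C" "C \<subseteq> U"
    using clopen_base[OF profiniteD(2-4)[OF G] U] by blast
  define N where "N = {x \<in> carrier G. \<forall>g\<in>carrier G. \<forall>h\<in>carrier G. g \<otimes> x \<otimes> h \<in> C \<longleftrightarrow> g \<otimes> h \<in> C}"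
  have NC: "N \<subseteq> C"
  proof
    fix x assume "x \<in> N"
    then have "x \<in> carrier G" "\<one> \<otimes> x \<otimes> \<one> \<in> C \<longleftrightarrow> \<one> \<otimes> \<one> \<in> C" unfolding N_def by blast+
    then show "x \<in> C" using C(3) by simp
  qed
  have inv_cancel: "x \<otimes> (inv x \<otimes> h) = h" if "x \<in> carrier G" "h \<in> carrier G" for x h
    using that by (metis inv_closed l_one m_assoc r_inv)
  have sub: "subgroup N G"
  proof
    show "N \<subseteq> carrier G" by (auto simp: N_def)
    show "\<one> \<in> N" by (auto simp: N_def)
    fix x y assume xy: "x \<in> N" "y \<in> N"
    show "x \<otimes> y \<in> N" unfolding N_def
    proof (safe)
      show "x \<otimes> y \<in> carrier G" using xy by (auto simp: N_def)
      fix g h assume gh: "g \<in> carrier G" "h \<in> carrier G"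
      have c: "x \<in> carrier G" "y \<in> carrier G" using xy by (auto simp: N_def)
      have "g \<otimes> (x \<otimes> y) \<otimes> h = (g \<otimes> x) \<otimes> y \<otimes> h" using gh c by (simp add: m_assoc)
      moreover have "(g \<otimes> x) \<otimes> y \<otimes> h \<in> C \<longleftrightarrow> g \<otimes> x \<otimes> h \<in> C"
        using xy(2) gh c unfolding N_def by blast
      moreover have "g \<otimes> x \<otimes> h \<in> C \<longleftrightarrow> g \<otimes> h \<in> C" using xy(1) gh unfolding N_def by blast
      ultimately have eq: "g \<otimes> (x \<otimes> y) \<otimes> h \<in> C \<longleftrightarrow> g \<otimes> h \<in> C" by simp
      show "g \<otimes> (x \<otimes> y) \<otimes> h \<in> C \<Longrightarrow> g \<otimes> h \<in> C" using eq by simp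
      show "g \<otimes> h \<in> C \<Longrightarrow> g \<otimes> (x \<otimes> y) \<otimes> h \<in> C" using eq by simp
    qed
  next
    fix x assume x: "x \<in> N"
    then have c: "x \<in> carrier G" by (auto simp: N_def)
    have "g \<otimes> inv x \<otimes> h \<in> C \<longleftrightarrow> g \<otimes> h \<in> C" if gh: "g \<in> carrier G" "h \<in> carrier G" for g h
    proof -
      have "g \<otimes> x \<otimes> (inv x \<otimes> h) \<in> C \<longleftrightarrow> g \<otimes> (inv x \<otimes> h) \<in> C"
        using x c gh unfolding N_def by blast
      moreover have "g \<otimes> x \<otimes> (inv x \<otimes> h) = g \<otimes> h" 
        using gh c inv_cancel by (simp add: m_assoc)
      moreover have "g \<otimes> (inv x \<otimes> h) = g \<otimes> inv x \<otimes> h" using gh c by (simp add: m_assoc)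
      ultimately show ?thesis by simp
    qed
    then show "inv x \<in> N" using c by (auto simp: N_def)
  qed
  have normal: "N \<lhd> G"
  proof (rule normal_invI[OF sub])
    fix a x assume a: "a \<in> carrier G" and x: "x \<in> N"
    then have c: "x \<in> carrier G" by (auto simp: N_def)
    have "g \<otimes> (a \<otimes> x \<otimes> inv a) \<otimes> h \<in> C \<longleftrightarrow> g \<otimes> h \<in> C" if gh: "g \<in> carrier G" "h \<in> carrier G" for g h
    proof -
      have "(g \<otimes> a) \<otimes> x \<otimes> (inv a \<otimes> h) \<in> C \<longleftrightarrow> (g \<otimes> a) \<otimes> (inv a \<otimes> h) \<in> C"
        using x a gh unfolding N_def by blast
      moreover have "(g \<otimes> a) \<otimes> (inv a \<otimes> h) = g \<otimes> h" 
        using gh a inv_cancel by (simp add: m_assoc)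
      moreover have "(g \<otimes> a) \<otimes> x \<otimes> (inv a \<otimes> h) = g \<otimes> (a \<otimes> x \<otimes> inv a) \<otimes> h"
        using gh a c by (simp add: m_assoc)
      ultimately show ?thesis by simp
    qed
    then show "a \<otimes> x \<otimes> inv a \<in> N" using a c by (auto simp: N_def)
  qed
  let ?TT = "prod_topology ?T (prod_topology ?T ?T)"
  define B where "B = {p \<in> topspace ?TT. fst (snd p) \<otimes> fst p \<otimes> snd (snd p) \<in> C}"
  define D where "D = {p \<in> topspace ?TT. fst (snd p) \<otimes> snd (snd p) \<in> C}"
  have cf: "continuous_map ?TT ?T fst" "continuous_map ?TT ?T (\<lambda>p. fst (snd p))" 
    "continuous_map ?TT ?T (\<lambda>p. snd (snd p))"
    using continuous_map_fst continuous_map_snd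
    by (auto intro: continuous_map_fst continuous_map_fst_of continuous_map_snd_of continuous_map_snd
        continuous_map_compose[where f=snd and g=fst, unfolded o_def]
        continuous_map_compose[where f=snd and g=snd, unfolded o_def])
  have c1: "continuous_map ?TT ?T (\<lambda>p. fst (snd p) \<otimes> fst p \<otimes> snd (snd p))"
    by (intro continuous_map_tg_mult[OF tg] cf)
  have c2: "continuous_map ?TT ?T (\<lambda>p. fst (snd p) \<otimes> snd (snd p))"
    by (intro continuous_map_tg_mult[OF tg] cf)
  have "openin ?TT B" "openin ?TT D" 
    unfolding B_def D_def using c1 c2 C(1) openin_continuous_map_preimage by blast+
  moreover have "closedin ?TT B" "closedin ?TT D" 
    unfolding B_def D_def using c1 c2 C(2) closedin_continuous_map_preimage by blast+
  ultimately have "closedin ?TT ((B - D) \<union> (D - B))" by blast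
  moreover have "closed_map ?TT ?T fst"
    using closed_map_fst profiniteD(2)[OF G] by (simp add: compact_space_prod_topology closed_map_fst)
  ultimately have cl: "closedin ?T (fst ` ((B - D) \<union> (D - B)))" unfolding closed_map_def by blast
  have "N = topspace ?T - fst ` ((B - D) \<union> (D - B))"
  proof (intro equalityI subsetI)
    fix x assume x: "x \<in> N"
    then have "x \<notin> fst ` ((B - D) \<union> (D - B))" 
      unfolding N_def B_def D_def by (auto simp: ts)
    then show "x \<in> topspace ?T - fst ` ((B - D) \<union> (D - B))" using x by (auto simp: N_def ts)
  next
    fix x assume x: "x \<in> topspace ?T - fst ` ((B - D) \<union> (D - B))"
    have "g \<otimes> x \<otimes> h \<in> C \<longleftrightarrow> g \<otimes> h \<in> C" if gh: "g \<in> carrier G" "h \<in> carrier G" for g h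
    proof -
      have "(x, (g, h)) \<notin> (B - D) \<union> (D - B)" using x by force
      then show ?thesis using x gh unfolding B_def D_def by (auto simp: ts)
    qed
    then show "x \<in> N" using x by (auto simp: N_def ts)
  qed
  then have "openin ?T N" using cl by auto
  then show ?thesis using normal NC C(4) unfolding open_normal_def by blast
qed

lemma subgroup_of_simps [simp]:
  "carrier (subgroup_of G H) = H" "\<one>\<^bsub>subgroup_of G H\<^esub> = \<one>\<^bsub>G\<^esub>"
  "monoid.mult (subgroup_of G H) = monoid.mult G" "topo (subgroup_of G H) = subtopology (topo G) H"
  by (auto simp: subgroup_of_def)

lemma subgroup_of_inv:
  assumes "group G" "subgroup H G" "x \<in> H"
  shows "inv\<^bsub>subgroup_of G H\<^esub> x = inv\<^bsub>G\<^esub> x"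
  using group.m_inv_consistent[OF assms] by (simp add: m_inv_def subgroup_of_def)

lemma totally_disconnected_subtopology:
  assumes "totally_disconnected_space X"
  shows "totally_disconnected_space (subtopology X S)"
proof -
  have "y = x" if c: "connected_component_of (subtopology X S) x y" for x y
  proof -
    have "connected_component_of X x y" using c connected_component_of_mono
      by (metis connected_component_of_def connectedin_subtopology)
    moreover from this have "x \<in> topspace X" by (simp add: connected_component_in_topspace)
    ultimately show ?thesis using assms unfolding totally_disconnected_space_def by blast
  qed
  then show ?thesis unfolding totally_disconnected_space_def
    by (auto simp: connected_component_of_refl)
qed

lemma profinite_closed_subgroup:
  assumes G: "profinite G" and H: "subgroup H G" "closedin (topo G) H"
  shows "profinite (subgroup_of G H)"
proof -
  note tg = profiniteD(1)[OF G]
  note grp = topological_groupD(1)[OF tg] and ts = topological_groupD(2)[OF tg]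
  let ?S = "subtopology (topo G) H"
  have HG: "H \<subseteq> carrier G" using H(1) by (rule subgroup.subset)
  have "group (subgroup_of G H)"
  proof -
    have "group (G\<lparr>carrier := H\<rparr>)" using subgroup.subgroup_is_group[OF H(1) grp] .
    then show ?thesis
      unfolding group_def group_axioms_def monoid_def Units_def by simp
  qed
  moreover have "continuous_map (prod_topology ?S ?S) ?S (\<lambda>(x, y). x \<otimes>\<^bsub>G\<^esub> y)"
    using continuous_map_from_subtopology[OF topological_groupD(3)[OF tg], of "H \<times> H"]
    by (auto simp: continuous_map_in_subtopology subtopology_Times intro: subgroup.m_closed[OF H(1)])
  moreover have "continuous_map ?S ?S (\<lambda>x. inv\<^bsub>subgroup_of G H\<^esub> x)"
  proof -
    have "continuous_map ?S (topo G) (\<lambda>x. inv\<^bsub>G\<^esub> x)"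
      using continuous_map_from_subtopology[OF topological_groupD(4)[OF tg]] .
    then have "continuous_map ?S ?S (\<lambda>x. inv\<^bsub>G\<^esub> x)"
      by (auto simp: continuous_map_in_subtopology intro: subgroup.m_inv_closed[OF H(1)])
    then show ?thesis
      by (rule continuous_map_eq) (simp add: subgroup_of_inv[OF grp H(1)])
  qed
  ultimately have "topological_group (subgroup_of G H)"
    unfolding topological_group_def using HG ts by auto
  moreover have "compact_space ?S" 
    using profiniteD(2)[OF G] H(2) closedin_compact_space compact_space_subtopology by blast
  moreover have "Hausdorff_space ?S" using profiniteD(3)[OF G] Hausdorff_space_subtopology by blast
  ultimately show ?thesis
    unfolding profinite_def using totally_disconnected_subtopology[OF profiniteD(4)[OF G]] by simp
qed

lemma closure_subgroup:
  fixes G :: "'a topgroup" (structure)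
  assumes G: "topological_group G" and D: "subgroup D G"
  shows "subgroup (topo G closure_of D) G"
proof -
  interpret group G using topological_groupD(1)[OF G] .
  note ts = topological_groupD(2)[OF G]
  let ?C = "topo G closure_of D"
  have DG: "D \<subseteq> carrier G" using D by (rule subgroup.subset)
  have DC: "D \<subseteq> ?C" using DG ts by (simp add: closure_of_subset)
  show ?thesis
  proof
    show CG: "?C \<subseteq> carrier G" using ts closure_of_subset_topspace by metis
    show "\<one> \<in> ?C" using DC subgroup.one_closed[OF D] by blast
    fix x assume x: "x \<in> ?C"
    have "(\<lambda>x. inv x) ` ?C \<subseteq> topo G closure_of ((\<lambda>x. inv x) ` D)"
      using topological_groupD(4)[OF G] by (simp add: continuous_map_image_closure_subset)
    also have "\<dots> \<subseteq> ?C" using subgroup.m_inv_closed[OF D] by (intro closure_of_mono) auto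
    finally show "inv x \<in> ?C" using x by blast
    fix y assume y: "y \<in> ?C"
    have "(\<lambda>(x, y). x \<otimes> y) ` (prod_topology (topo G) (topo G) closure_of (D \<times> D)) 
        \<subseteq> topo G closure_of ((\<lambda>(x, y). x \<otimes> y) ` (D \<times> D))"
      using topological_groupD(3)[OF G] by (rule continuous_map_image_closure_subset)
    also have "\<dots> \<subseteq> ?C" using subgroup.m_closed[OF D] by (intro closure_of_mono) auto
    finally show "x \<otimes> y \<in> ?C" using x y by (auto simp: closure_of_Times)
  qed
qed

lemma extension_unique:
  assumes P: "topological_group P" and S: "top_generates P S"
    and G: "profinite G" and f: "continuous_hom P G f" and g: "continuous_hom P G g"
    and fg: "\<And>s. s \<in> S \<Longrightarrow> f s = g s" and x: "x \<in> carrier P"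
  shows "f x = g x"
proof -
  note tg = profiniteD(1)[OF G]
  interpret P: group P using topological_groupD(1)[OF P] .
  interpret G: group G using topological_groupD(1)[OF tg] .
  interpret f: group_hom P G f using f by unfold_locales (simp add: continuous_hom_def)
  interpret g: group_hom P G g using g by unfold_locales (simp add: continuous_hom_def)
  have SP: "S \<subseteq> carrier P" using S by (simp add: top_generates_def)
  have "f y = g y" if "y \<in> generate P S" for y
    using that
  proof (induction rule: generate.induct)
    case (eng h1 h2)
    then have "h1 \<in> carrier P" "h2 \<in> carrier P" using P.generate_in_carrier[OF SP] by auto
    then show ?case using eng by simp
  qed (use fg SP in auto)
  moreover have "x \<in> topo P closure_of generate P S" using S x by (simp add: top_generates_def)
  ultimately show ?thesis
    using forall_in_closure_of_eq[of x "topo P" "generate P S" "topo G" f g] profiniteD(3)[OF G] f g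
    by (auto simp: continuous_hom_def)
qed

definition transport :: "('a \<Rightarrow> 'b) \<Rightarrow> 'a topgroup \<Rightarrow> 'b topgroup" where
  "transport e G = (let g = inv_into (carrier G) e in
     \<lparr>carrier = e ` carrier G, monoid.mult = (\<lambda>x y. e (g x \<otimes>\<^bsub>G\<^esub> g y)), one = e \<one>\<^bsub>G\<^esub>,
      topo = pullback_topology (e ` carrier G) g (topo G)\<rparr>)"

lemma transport:
  fixes G :: "'a topgroup" (structure)
  assumes G: "profinite G" and e: "inj_on e (carrier G)"
  shows "profinite (transport e G)" "continuous_hom G (transport e G) e"
    "continuous_hom (transport e G) G (inv_into (carrier G) e)"
    "open_normal (transport e G) N \<Longrightarrow> open_normal G {x \<in> carrier G. e x \<in> N}"
proof -
  note tg = profiniteD(1)[OF G]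
  interpret group G using topological_groupD(1)[OF tg] .
  note ts = topological_groupD(2)[OF tg]
  define g where "g = inv_into (carrier G) e"
  have ge: "g (e x) = x" if "x \<in> carrier G" for x using that e by (simp add: g_def)
  let ?H = "transport e G"
  have car: "carrier ?H = e ` carrier G" 
    and mul: "x \<otimes>\<^bsub>?H\<^esub> y = e (g x \<otimes> g y)" and one: "\<one>\<^bsub>?H\<^esub> = e \<one>"
    and top: "topo ?H = pullback_topology (e ` carrier G) g (topo G)" for x y
    by (auto simp: transport_def g_def Let_def)
  have tsH: "topspace (topo ?H) = e ` carrier G"
    unfolding top topspace_pullback_topology using ge ts by auto
  have ce: "continuous_map (topo G) (topo ?H) e"
    unfolding top 
    by (rule continuous_map_pullback') (use ts ge in \<open>auto intro: continuous_map_eq[OF continuous_map_id]\<close>)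
  have cg: "continuous_map (topo ?H) (topo G) g"
    unfolding top using continuous_map_pullback[OF continuous_map_id] by (simp add: o_def)
  have hm: "homeomorphic_maps (topo G) (topo ?H) e g"
    unfolding homeomorphic_maps_def using ce cg ge ts tsH by auto
  then have hs: "topo G homeomorphic_space topo ?H" by (rule homeomorphic_maps_imp_homeomorphic_space)
  have iH: "group ?H"
  proof (rule groupI)
    fix x assume "x \<in> carrier ?H"
    then obtain a where "a \<in> carrier G" "x = e a" by (auto simp: car)
    then show "\<exists>y\<in>carrier ?H. y \<otimes>\<^bsub>?H\<^esub> x = \<one>\<^bsub>?H\<^esub>"
      by (intro bexI[of _ "e (inv a)"]) (auto simp: car mul one ge)
  qed (auto simp: car mul one ge m_assoc)
  then interpret H: group ?H .
  have homG: "e \<in> hom G ?H" by (auto simp: hom_def car mul ge)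
  have homH: "g \<in> hom ?H G" by (auto simp: hom_def car mul ge)
  have invH: "inv\<^bsub>?H\<^esub> x = e (inv (g x))" if "x \<in> carrier ?H" for x
    using that by (intro H.inv_equality) (auto simp: car mul one ge)
  show "continuous_hom G ?H e" using homG ce by (simp add: continuous_hom_def)
  show "continuous_hom ?H G (inv_into (carrier G) e)" 
    using homH cg by (simp add: continuous_hom_def g_def)
  have "continuous_map (prod_topology (topo ?H) (topo ?H)) (topo ?H) (\<lambda>p. e (g (fst p) \<otimes> g (snd p)))"
  proof -
    have "continuous_map (prod_topology (topo ?H) (topo ?H)) (topo G) (\<lambda>p. g (fst p) \<otimes> g (snd p))"
      using cg by (intro continuous_map_tg_mult[OF tg])
        (auto intro: continuous_map_compose[OF continuous_map_fst cg, unfolded o_def]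
          continuous_map_compose[OF continuous_map_snd cg, unfolded o_def])
    from continuous_map_compose[OF this ce] show ?thesis by (simp add: o_def)
  qed
  moreover have "continuous_map (topo ?H) (topo ?H) (\<lambda>x. inv\<^bsub>?H\<^esub> x)"
  proof -
    have "continuous_map (topo ?H) (topo ?H) (\<lambda>x. e (inv (g x)))"
      using continuous_map_compose[OF continuous_map_compose[OF cg topological_groupD(4)[OF tg]] ce]
      by (simp add: o_def)
    then show ?thesis by (rule continuous_map_eq) (use tsH car invH in auto)
  qed
  ultimately have "topological_group ?H"
    unfolding topological_group_def using iH tsH car by (simp add: mul case_prod_unfold)
  moreover have "totally_disconnected_space (topo ?H)"
  proof -
    have "y = x" if c: "connected_component_of (topo ?H) x y" for x y
    proof -
      from c obtain T where T: "connectedin (topo ?H) T" "x \<in> T" "y \<in> T"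
        by (auto simp: connected_component_of_def)
      have "connectedin (topo G) (g ` T)" using connectedin_continuous_map_image[OF cg T(1)] .
      then have "connected_component_of (topo G) (g x) (g y)"
        using T by (auto simp: connected_component_of_def)
      moreover from this have "g x \<in> topspace (topo G)" by (rule connected_component_in_topspace[THEN conjunct1])
      then have "connected_component_of_set (topo G) (g x) = {g x}"
        using profiniteD(4)[OF G] by (simp add: totally_disconnected_space_def)
      ultimately have "g x = g y" by (metis mem_Collect_eq singletonD)
      moreover have "x \<in> e ` carrier G" "y \<in> e ` carrier G"
        using connectedin_subset_topspace[OF T(1)] T tsH by auto
      ultimately show ?thesis using ge by auto
    qed
    then show ?thesis unfolding totally_disconnected_space_def
      by (auto simp: connected_component_of_refl)
  qed
  ultimately show "profinite ?H"
    unfolding profinite_def using profiniteD[OF G] homeomorphic_compact_space[OF hs] 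
      homeomorphic_Hausdorff_space[OF hs] by auto
  assume N: "open_normal ?H N"
  interpret e: group_hom G ?H e using homG by unfold_locales
  have "{x \<in> carrier G. e x \<in> N} \<lhd> G"
  proof (rule normal_invI)
    have sN: "subgroup N ?H" using N by (simp add: open_normal_def normal_def)
    show "subgroup {x \<in> carrier G. e x \<in> N} G"
      by standard (auto simp: subgroup.one_closed[OF sN] subgroup.m_closed[OF sN] subgroup.m_inv_closed[OF sN])
    fix a x assume "a \<in> carrier G" "x \<in> {x \<in> carrier G. e x \<in> N}"
    then show "a \<otimes> x \<otimes> inv a \<in> {x \<in> carrier G. e x \<in> N}"
      using normal.inv_op_closed2[of N ?H] N by (auto simp: open_normal_def)
  qed
  moreover have "openin (topo G) {x \<in> carrier G. e x \<in> N}"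
    using openin_continuous_map_preimage[OF ce] N ts by (auto simp: open_normal_def)
  ultimately show "open_normal G {x \<in> carrier G. e x \<in> N}" by (simp add: open_normal_def)
qed

definition word_value :: "'g topgroup \<Rightarrow> ('s \<Rightarrow> 'g) \<Rightarrow> (bool \<times> 's) list \<Rightarrow> 'g" where
  "word_value G \<phi> w =
     foldr (\<lambda>(b, s) y. (if b then \<phi> s else inv\<^bsub>G\<^esub> (\<phi> s)) \<otimes>\<^bsub>G\<^esub> y) w \<one>\<^bsub>G\<^esub>"

lemma generate_words:
  fixes G :: "'g topgroup" (structure)
  assumes "group G" "\<phi> ` S \<subseteq> carrier G" "x \<in> generate G (\<phi> ` S)"
  shows "\<exists>w. set w \<subseteq> UNIV \<times> S \<and> word_value G \<phi> w = x"
proof -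
  interpret group G by fact
  have closed: "word_value G \<phi> w \<in> carrier G" if "set w \<subseteq> UNIV \<times> S" for w
    using that assms(2) by (induction w) (auto simp: word_value_def)
  have app: "word_value G \<phi> (u @ v) = word_value G \<phi> u \<otimes> word_value G \<phi> v"
    if "set u \<subseteq> UNIV \<times> S" "set v \<subseteq> UNIV \<times> S" for u v
    using that(1)
  proof (induction u)
    case Nil
    then show ?case using closed[OF that(2)] by (simp add: word_value_def)
  next
    case (Cons a u)
    obtain b s where a: "a = (b, s)" "s \<in> S" using Cons.prems by auto
    have s: "\<phi> s \<in> carrier G" using a assms(2) by auto
    have c: "word_value G \<phi> u \<in> carrier G" "word_value G \<phi> v \<in> carrier G"
      using closed that Cons.prems by auto
    have step: "word_value G \<phi> ((b, s) # w) = (if b then \<phi> s else inv (\<phi> s)) \<otimes> word_value G \<phi> w" for w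
      by (simp add: word_value_def)
    show ?case using Cons s c by (simp add: a step m_assoc)
  qed
  show ?thesis using assms(3)
  proof (induction rule: generate.induct)
    case one
    show ?case by (rule exI[of _ "[]"]) (simp add: word_value_def)
  next
    case (incl h)
    then obtain s where "s \<in> S" "h = \<phi> s" by blast
    then show ?case using assms(2) by (intro exI[of _ "[(True, s)]"]) (auto simp: word_value_def)
  next
    case (inv h)
    then obtain s where "s \<in> S" "h = \<phi> s" by blast
    then show ?case using assms(2) by (intro exI[of _ "[(False, s)]"]) (auto simp: word_value_def)
  next
    case (eng h1 h2)
    then obtain u v where "set u \<subseteq> UNIV \<times> S" "word_value G \<phi> u = h1" 
      "set v \<subseteq> UNIV \<times> S" "word_value G \<phi> v = h2" by blast
    then show ?case using app by (intro exI[of _ "u @ v"]) auto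
  qed
qed

lemma closure_embeds_in_test_carrier:
  fixes \<phi> :: "'a \<Rightarrow> 'g"
  assumes G: "topological_group G" "Hausdorff_space (topo G)" and \<phi>: "\<phi> ` S \<subseteq> carrier G"
  shows "\<exists>e :: 'g \<Rightarrow> 'a test_carrier. inj_on e (topo G closure_of generate G (\<phi> ` S))"
proof -
  define e :: "'g \<Rightarrow> 'a test_carrier" where
    "e x = {{w. word_value G \<phi> w \<in> U} | U. openin (topo G) U \<and> x \<in> U}" for x
  have "x = y" if x: "x \<in> topo G closure_of generate G (\<phi> ` S)"
    and y: "y \<in> topo G closure_of generate G (\<phi> ` S)" and eq: "e x = e y" for x y
  proof (rule ccontr)
    assume "x \<noteq> y"
    moreover have "x \<in> topspace (topo G)" "y \<in> topspace (topo G)" using x y by (simp_all add: in_closure_of)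
    ultimately obtain U V where UV: "openin (topo G) U" "openin (topo G) V" "x \<in> U" "y \<in> V" "disjnt U V"
      using G(2) unfolding Hausdorff_space_def by metis
    have "{w. word_value G \<phi> w \<in> U} \<in> e y" using eq UV by (auto simp: e_def)
    then obtain W where W: "openin (topo G) W" "y \<in> W" 
      "{w. word_value G \<phi> w \<in> U} = {w. word_value G \<phi> w \<in> W}" by (auto simp: e_def)
    have "openin (topo G) (V \<inter> W)" "y \<in> V \<inter> W" using UV W by auto
    then obtain z where z: "z \<in> generate G (\<phi> ` S)" "z \<in> V" "z \<in> W"
      using y unfolding in_closure_of by blast
    then obtain w where "word_value G \<phi> w = z" 
      using generate_words[OF topological_groupD(1)[OF G(1)] \<phi>] by blast
    then have "z \<in> U" using z W(3) by blast
    then show False using z UV(5) by (auto simp: disjnt_def)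
  qed
  then show ?thesis by (auto simp: inj_on_def)
qed

theorem universal_for_any_type:
  fixes P :: "'a topgroup"
  assumes P: "topological_group P" and S: "top_generates P S"
    and univ: "universal_for TYPE('a test_carrier) P S"
  shows "universal_for TYPE('g) P S"
  unfolding universal_for_def
proof (intro allI impI, elim conjE)
  fix G :: "'g topgroup" and \<phi> :: "'a \<Rightarrow> 'g"
  assume G: "profinite G" and \<phi>: "\<phi> \<in> S \<rightarrow> carrier G" and conv: "map_converges_to_1 S G \<phi>"
  note tg = profiniteD(1)[OF G]
  interpret G: group G using topological_groupD(1)[OF tg] .
  note ts = topological_groupD(2)[OF tg]
  have \<phi>S: "\<phi> ` S \<subseteq> carrier G" using \<phi> by auto
  define H where "H = topo G closure_of generate G (\<phi> ` S)"
  have sH: "subgroup H G"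
    unfolding H_def by (intro closure_subgroup[OF tg] G.generate_is_subgroup \<phi>S)
  have HG: "H \<subseteq> carrier G" using sH by (rule subgroup.subset)
  have \<phi>H: "\<phi> s \<in> H" if "s \<in> S" for s
  proof -
    have "generate G (\<phi> ` S) \<subseteq> H" 
      unfolding H_def by (intro closure_of_subset) (simp add: ts G.generate_incl \<phi>S)
    then show ?thesis using that generate.incl[of "\<phi> s" "\<phi> ` S" G] by blast
  qed
  let ?H = "subgroup_of G H"
  have pH: "profinite ?H" by (rule profinite_closed_subgroup[OF G sH]) (simp add: H_def)
  obtain e :: "'g \<Rightarrow> 'a test_carrier" where e: "inj_on e (carrier ?H)"
    using closure_embeds_in_test_carrier[OF tg profiniteD(3)[OF G] \<phi>S] by (auto simp: H_def)
  let ?E = "transport e ?H"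
  note tr = transport[OF pH e]
  have "map_converges_to_1 S ?E (e \<circ> \<phi>)"
    unfolding map_converges_to_1_def
  proof (intro allI impI)
    fix N assume N: "open_normal ?E N"
    define M where "M = {x \<in> H. e x \<in> N}"
    have M: "open_normal ?H M" using tr(4)[OF N] by (simp add: M_def)
    then obtain U where U: "openin (topo G) U" "M = U \<inter> H"
      by (auto simp: open_normal_def openin_subtopology)
    have "\<one>\<^bsub>G\<^esub> \<in> M" 
      using M subgroup.one_closed[of M ?H] by (auto simp: open_normal_def normal_def)
    then obtain N' where N': "open_normal G N'" "N' \<subseteq> U"
      using profinite_open_normal_base[OF G U(1)] U(2) by blast
    have "{s \<in> S. (e \<circ> \<phi>) s \<in> carrier ?E - N} \<subseteq> {s \<in> S. \<phi> s \<in> carrier G - N'}"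
      using N' U \<phi>H HG by (auto simp: M_def)
    then show "finite {s \<in> S. (e \<circ> \<phi>) s \<in> carrier ?E - N}"
      using conv N' finite_subset unfolding map_converges_to_1_def by blast
  qed
  moreover have "e \<circ> \<phi> \<in> S \<rightarrow> carrier ?E" using \<phi>H by (auto simp: transport_def Let_def)
  ultimately obtain \<psi> where \<psi>: "continuous_hom P ?E \<psi>" "\<forall>s\<in>S. \<psi> s = (e \<circ> \<phi>) s"
    using univ tr(1) unfolding universal_for_def by blast
  define \<xi> where "\<xi> = restrict (inv_into H e \<circ> \<psi>) (carrier P)"
  have SP: "S \<subseteq> carrier P" using S by (simp add: top_generates_def)
  have \<xi>S: "\<xi> s = \<phi> s" if "s \<in> S" for s
    using that \<psi>(2) e \<phi>H SP by (auto simp: \<xi>_def)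
  have "inv_into H e \<circ> \<psi> \<in> hom P ?H" "continuous_map (topo P) (topo ?H) (inv_into H e \<circ> \<psi>)"
    using tr(3) \<psi>(1) by (auto simp: continuous_hom_def intro: hom_compose continuous_map_compose)
  then have "\<xi> \<in> hom P G" "continuous_map (topo P) (topo G) \<xi>"
    using HG monoid.m_closed[OF group.is_monoid[OF topological_groupD(1)[OF P]]]
    by (auto simp: \<xi>_def hom_def Pi_iff continuous_map_in_subtopology topological_groupD(2)[OF P]
        intro: continuous_map_eq)
  then have \<xi>: "continuous_hom P G \<xi>" by (simp add: continuous_hom_def)
  show "\<exists>!\<psi>. \<psi> \<in> extensional (carrier P) \<and> continuous_hom P G \<psi> \<and> (\<forall>s\<in>S. \<psi> s = \<phi> s)"
  proof (rule ex1I[of _ \<xi>])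
    show "\<xi> \<in> extensional (carrier P) \<and> continuous_hom P G \<xi> \<and> (\<forall>s\<in>S. \<xi> s = \<phi> s)"
      using \<xi> \<xi>S by (simp add: \<xi>_def)
    fix f assume f: "f \<in> extensional (carrier P) \<and> continuous_hom P G f \<and> (\<forall>s\<in>S. f s = \<phi> s)"
    show "f = \<xi>"
    proof (rule extensionalityI[of _ "carrier P"])
      show "\<xi> \<in> extensional (carrier P)" by (simp add: \<xi>_def)
      fix x assume "x \<in> carrier P"
      then show "f x = \<xi> x"
        using extension_unique[OF P S G _ \<xi>, of f x] f \<xi>S by auto
    qed (use f in auto)
  qed
qed

corollary free_profinite_on_universal_for_any_type:
  fixes P :: "'a topgroup"
  assumes "free_profinite_on P S"
  shows "universal_for TYPE('g) P S"
  using assms universal_for_any_type[of P S] profiniteD(1)[of P]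
  by (simp add: free_profinite_on_def)

end

theory Submission
  imports Defs "HOL-Algebra.Zassenhaus"
begin

text \<open>
  A profinite group with a countable base of neighbourhoods of \<open>1\<close> is determined up to isomorphism
  by the property that all its finite embedding problems are solvable (Iwasawa).  Free profinite
  groups of countably infinite rank have this property and a countable base, so for (a) it is enough
  to solve finite embedding problems for a closed subgroup \<open>N\<close> of such a group \<open>P\<close> that contains the
  commutator subgroup; the resulting isomorphism of \<open>P\<close> and \<open>N\<close> then carries a basis of \<open>P\<close> to a
  basis of \<open>N\<close>.

  Solving an embedding problem \<open>\<phi> : N \<rightarrow> A\<close>, \<open>\<alpha> : B \<rightarrow> A\<close> for \<open>N \<noteq> P\<close>
  (\<open>closed_subgroup_solves_finite_embedding_problems\<close>).  Extend \<open>\<phi>\<close> to an open subgroup \<open>F \<noteq> P\<close> that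
  contains \<open>N\<close>.  As \<open>F\<close> contains the commutator subgroup, it is normal; put \<open>Q = P/F\<close>.  The
  Kaloujnine--Krasner construction turns \<open>F \<rightarrow> A\<close> into a homomorphism from \<open>P\<close> to the wreath product
  \<open>A \<wr> Q\<close>, and since \<open>P\<close> is free this lifts to \<open>\<Psi> : P \<rightarrow> B \<wr> Q\<close> whose image contains the kernel of
  \<open>B \<wr> Q \<rightarrow> A \<wr> Q\<close>.  On \<open>N\<close> the coordinate of \<open>\<Psi>\<close> at \<open>1 \<in> Q\<close> is a homomorphism \<open>\<psi> : N \<rightarrow> B\<close> above \<open>\<phi>\<close>.
  It is surjective: for \<open>c\<close> in the kernel of \<open>\<alpha>\<close> let \<open>s \<in> P\<close> be mapped to the element of the wreath
  product that is \<open>c\<^sup>-\<^sup>1\<close> at \<open>1\<close> and trivial elsewhere, and let \<open>e \<in> P\<close> lie outside \<open>F\<close>.  Conjugation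
  by \<open>e\<close> moves the nontrivial coordinate away from \<open>1\<close>, so the commutator of \<open>e\<close> and \<open>s\<close>, which is
  an element of \<open>N\<close>, has coordinate \<open>c\<close> at \<open>1\<close>.

  Iwasawa's criterion (\<open>isomorphic_if_embedding_problems_solvable\<close>) is a back and forth argument:
  isomorphisms between ever larger finite quotients of two groups are refined by solving embedding
  problems alternately for the one and the other group.

  For (b), let \<open>K\<^sub>1/K\<close> be abelian.  Two applications of the embedding theorem
  \<open>separable_extension_embeds\<close> embed \<open>K\<^sub>1\<close> into the separable closure of \<open>K\<close>, and then identify this
  closure with the given separable closure of \<open>K\<^sub>1\<close>.  Thus the absolute Galois group of \<open>K\<^sub>1\<close> is
  isomorphic to a closed subgroup of that of \<open>K\<close>.  It contains the commutators, because they
  restrict to commutators in the abelian group \<open>Gal(K\<^sub>1/K)\<close>, and (a) applies.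
\<close>

section \<open>Open subgroups and finite quotients\<close>

definition discrete_group :: "'b monoid \<Rightarrow> 'b topgroup" where
  "discrete_group W = \<lparr>carrier = carrier W, monoid.mult = monoid.mult W, one = \<one>\<^bsub>W\<^esub>,
     topo = discrete_topology (carrier W)\<rparr>"

text \<open>
  Finite groups carry no topology here.  A homomorphism to a group \<open>W\<close> is continuous for the discrete
  topology of \<open>W\<close> exactly if its kernel is open (\<open>open_kernel_hom_iff_continuous\<close>), and the kernel is
  the more convenient object in what follows.
\<close>

definition open_kernel_hom :: "'a topgroup \<Rightarrow> 'b monoid \<Rightarrow> ('a \<Rightarrow> 'b) \<Rightarrow> bool" where
  "open_kernel_hom P W \<psi> \<longleftrightarrow> \<psi> \<in> hom P W \<and> openin (topo P) (kernel P W \<psi>)"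

lemma discrete_group_simps [simp]:
  "carrier (discrete_group W) = carrier W" "x \<otimes>\<^bsub>discrete_group W\<^esub> y = x \<otimes>\<^bsub>W\<^esub> y"
  "\<one>\<^bsub>discrete_group W\<^esub> = \<one>\<^bsub>W\<^esub>" "topo (discrete_group W) = discrete_topology (carrier W)"
  "inv\<^bsub>discrete_group W\<^esub> x = inv\<^bsub>W\<^esub> x" "hom P (discrete_group W) = hom P W"
  by (auto simp: discrete_group_def m_inv_def hom_def)

lemma profinite_discrete_group:
  assumes "group W" "finite (carrier W)"
  shows "profinite (discrete_group W)"
proof -
  interpret group W by fact
  have "group (discrete_group W)"
    by (rule groupI) (auto simp: m_assoc)
  moreover have "prod_topology (discrete_topology (carrier W)) (discrete_topology (carrier W)) 
      = discrete_topology (carrier W \<times> carrier W)"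
  proof -
    have "openin (prod_topology (discrete_topology (carrier W)) (discrete_topology (carrier W))) {p}"
      if "p \<in> carrier W \<times> carrier W" for p
      using that openin_prod_Times_iff[of "discrete_topology (carrier W)" "discrete_topology (carrier W)" "{fst p}" "{snd p}"] 
      by auto
    then show ?thesis by (metis discrete_topology_unique topspace_discrete_topology topspace_prod_topology)
  qed
  ultimately show ?thesis
    using assms by (auto simp: profinite_def topological_group_def compact_space_discrete_topology 
        totally_disconnected_space_def connected_component_of_discrete_topology)
qed

context
  fixes P :: "'a topgroup" (structure)
  assumes P: "topological_group P"
begin

interpretation group P using topological_groupD(1)[OF P] .

lemma open_translation:
  assumes U: "openin (topo P) U" and g: "g \<in> carrier P"
  shows "openin (topo P) {x \<in> carrier P. g \<otimes> x \<in> U}" "openin (topo P) {x \<in> carrier P. x \<otimes> g \<in> U}"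
proof -
  note ts = topological_groupD(2)[OF P]
  have c: "continuous_map (topo P) (topo P) (\<lambda>x. g)" "continuous_map (topo P) (topo P) (\<lambda>x. x)"
    using g ts by auto
  show "openin (topo P) {x \<in> carrier P. g \<otimes> x \<in> U}"
    using openin_continuous_map_preimage[OF continuous_map_tg_mult[OF P c] U] ts by simp
  show "openin (topo P) {x \<in> carrier P. x \<otimes> g \<in> U}"
    using openin_continuous_map_preimage[OF continuous_map_tg_mult[OF P c(2,1)] U] ts by simp
qed

text \<open>
  \<open>H\<close> is the union of the translates \<open>h U\<close> for \<open>h \<in> H\<close>.
\<close>

lemma subgroup_open_if_contains_open:
  assumes H: "subgroup H P" and U: "openin (topo P) U" "\<one> \<in> U" "U \<subseteq> H"
  shows "openin (topo P) H"
proof (subst openin_subopen, intro ballI)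
  fix h assume h: "h \<in> H"
  then have hc: "h \<in> carrier P" using subgroup.subset[OF H] by blast
  show "\<exists>T. openin (topo P) T \<and> h \<in> T \<and> T \<subseteq> H"
  proof (intro exI conjI)
    show "openin (topo P) {x \<in> carrier P. inv h \<otimes> x \<in> U}" using U hc by (intro open_translation) auto
    show "h \<in> {x \<in> carrier P. inv h \<otimes> x \<in> U}" using hc U by simp
    show "{x \<in> carrier P. inv h \<otimes> x \<in> U} \<subseteq> H"
    proof clarify
      fix x assume x: "x \<in> carrier P" "inv h \<otimes> x \<in> U"
      then have "h \<otimes> (inv h \<otimes> x) \<in> H" using U(3) h subgroup.m_closed[OF H] by blast
      then show "x \<in> H" using x hc by (simp add: m_assoc[symmetric])
    qed
  qed
qed

lemma rcoset_eq_translate: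
  assumes "subgroup H P" "g \<in> carrier P"
  shows "H #> g = {x \<in> carrier P. x \<otimes> inv g \<in> H}"
  using subgroup.rcos_module[OF assms(1) is_group assms(2)] r_coset_subset_G[OF subgroup.subset[OF assms(1)] assms(2)]
  by auto

lemma open_rcoset:
  assumes "subgroup H P" "openin (topo P) H" "g \<in> carrier P"
  shows "openin (topo P) (H #> g)"
  unfolding rcoset_eq_translate[OF assms(1,3)] using assms by (intro open_translation) auto

text \<open>
  The complement of a coset is the union of the other cosets, which are open.
\<close>

lemma closed_rcoset:
  assumes H: "subgroup H P" "openin (topo P) H" and g: "g \<in> carrier P"
  shows "closedin (topo P) (H #> g)"
proof -
  note ts = topological_groupD(2)[OF P]
  have "carrier P - (H #> g) = \<Union>(rcosets H - {H #> g})"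
    using rcosets_part_G[OF H(1)] rcos_disjoint[OF H(1)] rcosetsI[OF subgroup.subset[OF H(1)] g]
    by (fastforce simp: pairwise_def disjnt_def)
  moreover have "openin (topo P) C" if "C \<in> rcosets H" for C
    using that open_rcoset[OF H] by (auto simp: RCOSETS_def)
  ultimately have "openin (topo P) (carrier P - (H #> g))" by (metis openin_Union DiffD1)
  then show ?thesis using r_coset_subset_G[OF subgroup.subset[OF H(1)] g] by (simp add: closedin_def ts)
qed

text \<open>
  The cosets form an open cover without proper subcovers.
\<close>

lemma finite_rcosets_open:
  assumes comp: "compact_space (topo P)" and H: "subgroup H P" "openin (topo P) H"
  shows "finite (rcosets H)"
proof -
  note ts = topological_groupD(2)[OF P]
  have "\<forall>C\<in>rcosets H. openin (topo P) C"
    using open_rcoset[OF H] by (auto simp: RCOSETS_def)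
  moreover have "topspace (topo P) \<subseteq> \<Union>(rcosets H)" using rcosets_part_G[OF H(1)] ts by simp
  ultimately obtain \<F> where F: "finite \<F>" "\<F> \<subseteq> rcosets H" "topspace (topo P) \<subseteq> \<Union>\<F>"
    using comp unfolding compact_space_alt by meson
  have "C \<in> \<F>" if C: "C \<in> rcosets H" for C
  proof -
    obtain g where g: "g \<in> carrier P" "C = H #> g" using C by (auto simp: RCOSETS_def)
    then have gC: "g \<in> C" using rcos_self[OF _ H(1)] by simp
    then obtain C' where "C' \<in> \<F>" "g \<in> C'" using F(3) g(1) ts by blast
    then have "C = C'" using rcos_disjoint[OF H(1)] C F(2) gC by (auto simp: pairwise_def disjnt_def)
    then show ?thesis using \<open>C' \<in> \<F>\<close> by simp
  qed
  then have "rcosets H \<subseteq> \<F>" by (rule subsetI)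
  then show ?thesis using F(1) by (rule finite_subset)
qed

lemma open_kernel_hom_iff_continuous:
  assumes W: "group W"
  shows "open_kernel_hom P W \<psi> \<longleftrightarrow> continuous_hom P (discrete_group W) \<psi>"
proof
  note ts = topological_groupD(2)[OF P]
  assume o: "open_kernel_hom P W \<psi>"
  then interpret h: group_hom P W \<psi> 
    using W is_group by (simp add: group_hom_def group_hom_axioms_def open_kernel_hom_def)
  have "openin (topo P) {x \<in> carrier P. \<psi> x \<in> U}" for U
  proof (subst openin_subopen, intro ballI)
    fix x assume x: "x \<in> {x \<in> carrier P. \<psi> x \<in> U}"
    show "\<exists>T. openin (topo P) T \<and> x \<in> T \<and> T \<subseteq> {x \<in> carrier P. \<psi> x \<in> U}"
    proof (intro exI conjI)
      show "openin (topo P) {y \<in> carrier P. inv x \<otimes> y \<in> kernel P W \<psi>}" 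
        using o x by (intro open_translation) (auto simp: open_kernel_hom_def)
      show "x \<in> {y \<in> carrier P. inv x \<otimes> y \<in> kernel P W \<psi>}" using x by (simp add: kernel_def)
      show "{y \<in> carrier P. inv x \<otimes> y \<in> kernel P W \<psi>} \<subseteq> {x \<in> carrier P. \<psi> x \<in> U}"
      proof clarify
        fix y assume y: "y \<in> carrier P" "inv x \<otimes> y \<in> kernel P W \<psi>"
        then have "inv\<^bsub>W\<^esub> \<psi> x \<otimes>\<^bsub>W\<^esub> \<psi> y = \<one>\<^bsub>W\<^esub>" using x by (simp add: kernel_def)
        moreover have "\<psi> x \<in> carrier W" "\<psi> y \<in> carrier W" using x y by auto
        then have "\<psi> y = \<psi> x \<otimes>\<^bsub>W\<^esub> (inv\<^bsub>W\<^esub> \<psi> x \<otimes>\<^bsub>W\<^esub> \<psi> y)" by (simp add: h.H.m_assoc[symmetric])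
        ultimately have "\<psi> y = \<psi> x" using x by simp
        then show "\<psi> y \<in> U" using x by simp
      qed
    qed
  qed
  then show "continuous_hom P (discrete_group W) \<psi>"
    using o ts by (auto simp: continuous_hom_def open_kernel_hom_def continuous_map_def)
next
  note ts = topological_groupD(2)[OF P]
  interpret W: group W by fact
  assume c: "continuous_hom P (discrete_group W) \<psi>"
  then have "openin (topo P) {x \<in> topspace (topo P). \<psi> x \<in> {\<one>\<^bsub>W\<^esub>}}"
    by (intro openin_continuous_map_preimage[where Y = "topo (discrete_group W)"]) (auto simp: continuous_hom_def)
  then show "open_kernel_hom P W \<psi>" using c ts by (simp add: open_kernel_hom_def continuous_hom_def kernel_def)
qed

lemma open_kernel_hom_comp:
  assumes \<psi>: "open_kernel_hom P B \<psi>" and \<alpha>: "\<alpha> \<in> hom B A" and B: "group B" and A: "group A"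
  shows "open_kernel_hom P A (\<alpha> \<circ> \<psi>)"
proof -
  have h: "\<alpha> \<circ> \<psi> \<in> hom P A" using \<psi> \<alpha> Group.hom_compose[of \<psi> P B \<alpha> A] by (simp add: open_kernel_hom_def)
  interpret b: group_hom P B \<psi> 
    using B \<psi> is_group by (simp add: group_hom_def group_hom_axioms_def open_kernel_hom_def)
  interpret a: group_hom B A \<alpha> using A B \<alpha> by (simp add: group_hom_def group_hom_axioms_def)
  interpret c: group_hom P A "\<alpha> \<circ> \<psi>" 
    using A h is_group by (simp add: group_hom_def group_hom_axioms_def)
  have "openin (topo P) (kernel P A (\<alpha> \<circ> \<psi>))"
    by (rule subgroup_open_if_contains_open[OF c.subgroup_kernel, of "kernel P B \<psi>"])
      (use \<psi> in \<open>auto simp: open_kernel_hom_def kernel_def\<close>)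
  then show ?thesis using h by (simp add: open_kernel_hom_def)
qed

lemma kernel_open_normal:
  assumes "open_kernel_hom P W \<psi>" "group W"
  shows "open_normal P (kernel P W \<psi>)"
proof -
  interpret h: group_hom P W \<psi> 
    using assms is_group by (simp add: group_hom_def group_hom_axioms_def open_kernel_hom_def)
  show ?thesis using assms h.normal_kernel by (auto simp: open_kernel_hom_def open_normal_def)
qed

end

section \<open>Lifting homomorphisms of free profinite groups\<close>

lemma open_kernel_hom_unique:
  assumes P: "topological_group P" "top_generates P S" and W: "group W" "finite (carrier W)"
    and f: "open_kernel_hom P W f" and g: "open_kernel_hom P W g" and fg: "\<And>s. s \<in> S \<Longrightarrow> f s = g s"
    and x: "x \<in> carrier P"
  shows "f x = g x"
  by (rule extension_unique[OF P profinite_discrete_group[OF W] _ _ fg x])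
    (use f g open_kernel_hom_iff_continuous[OF P(1) W(1)] in auto)

lemma free_hom_to_finite:
  fixes W :: "'b monoid"
  assumes P: "free_profinite_on P S" and W: "group W" "finite (carrier W)"
    and \<phi>: "\<phi> \<in> S \<rightarrow> carrier W" "finite {s\<in>S. \<phi> s \<noteq> \<one>\<^bsub>W\<^esub>}"
  shows "\<exists>\<psi>. open_kernel_hom P W \<psi> \<and> (\<forall>s\<in>S. \<psi> s = \<phi> s)"
proof -
  have tg: "topological_group P" using P by (simp add: free_profinite_on_def profiniteD(1))
  have "map_converges_to_1 S (discrete_group W) \<phi>"
    unfolding map_converges_to_1_def
  proof (intro allI impI)
    fix N assume "open_normal (discrete_group W) N"
    then have "\<one>\<^bsub>W\<^esub> \<in> N" using subgroup.one_closed[of N "discrete_group W"] 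
      by (auto simp: open_normal_def normal_def)
    then have "{s \<in> S. \<phi> s \<in> carrier (discrete_group W) - N} \<subseteq> {s\<in>S. \<phi> s \<noteq> \<one>\<^bsub>W\<^esub>}" by auto
    then show "finite {s \<in> S. \<phi> s \<in> carrier (discrete_group W) - N}" using \<phi>(2) finite_subset by blast
  qed
  moreover have "universal_for TYPE('b) P S" by (rule free_profinite_on_universal_for_any_type[OF P])
  ultimately obtain \<psi> where "continuous_hom P (discrete_group W) \<psi>" "\<forall>s\<in>S. \<psi> s = \<phi> s"
    using profinite_discrete_group[OF W] \<phi>(1) unfolding universal_for_def 
    by (metis discrete_group_simps(1))
  then show ?thesis using open_kernel_hom_iff_continuous[OF tg W(1)] by blast
qed

text \<open>
  Since the basis converges to \<open>1\<close>, all but finitely many of its elements lie in the kernel of \<open>\<phi>\<close>.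
  A lift may be prescribed on the basis as long as almost all values are \<open>1\<close>.  So the finitely many
  basis elements outside the kernel get arbitrary preimages, and infinitely many remain, of which
  some can be sent bijectively onto the finite kernel of \<open>\<alpha>\<close>.  When \<open>\<phi>\<close> is surjective, so is the
  lift; it is also used for homomorphisms \<open>\<phi>\<close> to wreath products, which need not be surjective.
\<close>

lemma free_profinite_lifts:
  fixes A :: "'c monoid" and B :: "'b monoid"
  assumes P: "free_profinite_on P S" "infinite S" and A: "group A" and B: "group B" "finite (carrier B)"
    and \<alpha>: "\<alpha> \<in> hom B A" "\<alpha> ` carrier B = carrier A" and \<phi>: "open_kernel_hom P A \<phi>"
  shows "\<exists>\<psi>. open_kernel_hom P B \<psi> \<and> (\<forall>p\<in>carrier P. \<alpha> (\<psi> p) = \<phi> p) \<and> kernel B A \<alpha> \<subseteq> \<psi> ` carrier P"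
proof -
  have pf: "profinite P" and gen: "top_generates P S" and conv: "set_converges_to_1 P S" 
    using P(1) by (auto simp: free_profinite_on_def)
  note tg = profiniteD(1)[OF pf]
  interpret P: group P using topological_groupD(1)[OF tg] .
  interpret B: group B by fact
  interpret A: group A by fact
  interpret \<alpha>: group_hom B A \<alpha> using \<alpha> by unfold_locales
  interpret \<phi>: group_hom P A \<phi> using \<phi> by unfold_locales (simp add: open_kernel_hom_def)
  have SP: "S \<subseteq> carrier P" using gen by (simp add: top_generates_def)
  let ?K = "kernel B A \<alpha>"
  define U where "U = {s\<in>S. \<phi> s = \<one>\<^bsub>A\<^esub>}"
  have fin: "finite (S - U)"
  proof -
    have "S - U = S \<inter> (carrier P - kernel P A \<phi>)" using SP by (auto simp: U_def kernel_def)
    then show ?thesis using conv kernel_open_normal[OF tg \<phi> A] by (simp add: set_converges_to_1_def)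
  qed
  then have "infinite U" using P(2) by (metis Diff_infinite_finite double_diff finite_Diff2 U_def)
  then obtain T where T: "finite T" "card T = card ?K" "T \<subseteq> U" using infinite_arbitrarily_large by blast
  have fK: "finite ?K" using B(2) by (auto simp: kernel_def)
  obtain g where g: "bij_betw g T ?K" using finite_same_card_bij[OF T(1) fK T(2)] by blast
  \<comment> \<open>\<open>T\<close> consists of basis elements in the kernel of \<open>\<phi>\<close> that are reserved for the kernel of \<open>\<alpha>\<close>;
    the other basis elements in the kernel of \<open>\<phi>\<close> go to \<open>1\<close>, which makes \<open>\<mu>\<close> converge to \<open>1\<close>.\<close>
  define \<mu> where "\<mu> s = (if s \<in> T then g s else if s \<in> U then \<one>\<^bsub>B\<^esub> else SOME b. b \<in> carrier B \<and> \<alpha> b = \<phi> s)" for s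
  have \<mu>: "\<mu> s \<in> carrier B \<and> \<alpha> (\<mu> s) = \<phi> s" if s: "s \<in> S" for s
  proof -
    have "\<phi> s \<in> \<alpha> ` carrier B" using s SP \<alpha>(2) by auto
    then have "\<exists>b. b \<in> carrier B \<and> \<alpha> b = \<phi> s" by auto
    from someI_ex[OF this] have "s \<notin> U \<Longrightarrow> ?thesis" using T(3) by (auto simp: \<mu>_def)
    moreover have "s \<in> T \<Longrightarrow> g s \<in> ?K" using bij_betwE[OF g] by blast
    then have "s \<in> U \<Longrightarrow> ?thesis" by (auto simp: \<mu>_def kernel_def U_def)
    ultimately show ?thesis by blast
  qed
  have "{s\<in>S. \<mu> s \<noteq> \<one>\<^bsub>B\<^esub>} \<subseteq> T \<union> (S - U)" by (auto simp: \<mu>_def)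
  then have "finite {s\<in>S. \<mu> s \<noteq> \<one>\<^bsub>B\<^esub>}" using T(1) fin finite_subset by blast
  with \<mu> obtain \<psi> where \<psi>: "open_kernel_hom P B \<psi>" "\<forall>s\<in>S. \<psi> s = \<mu> s"
    using free_hom_to_finite[OF P(1) B, of \<mu>] by auto
  have "(\<alpha> \<circ> \<psi>) p = \<phi> p" if "p \<in> carrier P" for p
  proof (rule open_kernel_hom_unique[OF tg gen A _ open_kernel_hom_comp[OF tg \<psi>(1) \<alpha>(1) B(1) A] \<phi> _ that])
    show "finite (carrier A)" using B(2) \<alpha>(2) by (metis finite_imageI)
    show "(\<alpha> \<circ> \<psi>) s = \<phi> s" if "s \<in> S" for s using that \<mu> \<psi>(2) by simp
  qed
  moreover have "?K \<subseteq> \<psi> ` carrier P"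
  proof
    fix c assume "c \<in> ?K"
    then obtain s where s: "s \<in> T" "g s = c" using g by (metis bij_betw_imp_surj_on imageE)
    then have "s \<in> S" using T(3) by (auto simp: U_def)
    then have "\<psi> s = c" using s \<psi>(2) by (simp add: \<mu>_def)
    then show "c \<in> \<psi> ` carrier P" using SP \<open>s \<in> S\<close> by blast
  qed
  ultimately show ?thesis using \<psi>(1) by auto
qed

text \<open>
  The type parameter bounds the finite groups that are considered.  It will be the type of sets of
  elements of a second profinite group, which holds the finite quotients of that group.
\<close>

definition solves_finite_embedding_problems :: "'b itself \<Rightarrow> 'a topgroup \<Rightarrow> bool" where
  "solves_finite_embedding_problems _ P \<longleftrightarrow>
     (\<forall>(A :: 'b monoid) (B :: 'b monoid) \<alpha> \<phi>.
        group A \<and> group B \<and> finite (carrier B) \<and> \<alpha> \<in> hom B A \<and> \<alpha> ` carrier B = carrier A \<and>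
        open_kernel_hom P A \<phi> \<and> \<phi> ` carrier P = carrier A \<longrightarrow>
        (\<exists>\<psi>. open_kernel_hom P B \<psi> \<and> \<psi> ` carrier P = carrier B \<and> (\<forall>p\<in>carrier P. \<alpha> (\<psi> p) = \<phi> p)))"

lemma lift_surjective:
  assumes A: "group A" and B: "group B" and P: "group P" and \<alpha>: "\<alpha> \<in> hom B A" and \<psi>: "\<psi> \<in> hom P B"
    and \<phi>: "\<And>p. p \<in> carrier P \<Longrightarrow> \<alpha> (\<psi> p) = \<phi> p" "\<phi> ` carrier P = carrier A"
    and ker: "kernel B A \<alpha> \<subseteq> \<psi> ` carrier P"
  shows "\<psi> ` carrier P = carrier B"
proof -
  interpret P: group P by fact
  interpret \<psi>: group_hom P B \<psi> using assms by (simp add: group_hom_def group_hom_axioms_def)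
  interpret \<alpha>: group_hom B A \<alpha> using assms by (simp add: group_hom_def group_hom_axioms_def)
  have "b \<in> \<psi> ` carrier P" if b: "b \<in> carrier B" for b
  proof -
    have "\<alpha> b \<in> \<phi> ` carrier P" using b \<phi>(2) by simp
    then obtain p where p: "p \<in> carrier P" "\<alpha> (\<psi> p) = \<alpha> b" using \<phi>(1) by auto
    then have "b \<otimes>\<^bsub>B\<^esub> inv\<^bsub>B\<^esub> (\<psi> p) \<in> kernel B A \<alpha>" using b by (simp add: kernel_def)
    then obtain q where q: "q \<in> carrier P" "\<psi> q = b \<otimes>\<^bsub>B\<^esub> inv\<^bsub>B\<^esub> (\<psi> p)" using ker by auto
    then have "\<psi> (q \<otimes>\<^bsub>P\<^esub> p) = b" using p b by (simp add: \<psi>.H.m_assoc)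
    then show ?thesis using p q by (metis P.m_closed image_eqI)
  qed
  then show ?thesis by auto
qed

lemma free_solves_finite_embedding_problems:
  assumes P: "free_profinite_on P S" "infinite S"
  shows "solves_finite_embedding_problems TYPE('b) P"
  unfolding solves_finite_embedding_problems_def
proof (intro allI impI, elim conjE)
  have gP: "group P" using P by (simp add: free_profinite_on_def profiniteD(1) topological_groupD(1))
  fix A B :: "'b monoid" and \<alpha> \<phi>
  assume h: "group A" "group B" "finite (carrier B)" "\<alpha> \<in> hom B A" "\<alpha> ` carrier B = carrier A"
    "open_kernel_hom P A \<phi>" "\<phi> ` carrier P = carrier A"
  obtain \<psi> where \<psi>: "open_kernel_hom P B \<psi>" "\<forall>p\<in>carrier P. \<alpha> (\<psi> p) = \<phi> p" "kernel B A \<alpha> \<subseteq> \<psi> ` carrier P"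
    using free_profinite_lifts[OF P h(1-6)] by blast
  then show "\<exists>\<psi>. open_kernel_hom P B \<psi> \<and> \<psi> ` carrier P = carrier B \<and> (\<forall>p\<in>carrier P. \<alpha> (\<psi> p) = \<phi> p)"
    using lift_surjective[OF h(1,2) gP h(4) _ _ h(7)] by (auto simp: open_kernel_hom_def)
qed

section \<open>Wreath products\<close>

text \<open>
  The wreath product \<open>B \<wr> Q\<close> for the regular action of \<open>Q\<close> on itself.  In a product, the coordinates
  of the second factor are shifted by right translation with the \<open>Q\<close>-component of the first.
\<close>

definition regular_wreath :: "('b, 'm) monoid_scheme \<Rightarrow> ('q, 'n) monoid_scheme \<Rightarrow> (('q \<Rightarrow> 'b) \<times> 'q) monoid" where
  "regular_wreath B Q = \<lparr>carrier = (carrier Q \<rightarrow>\<^sub>E carrier B) \<times> carrier Q,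
     monoid.mult = (\<lambda>(b, q) (b', q'). (\<lambda>x\<in>carrier Q. b x \<otimes>\<^bsub>B\<^esub> b' (x \<otimes>\<^bsub>Q\<^esub> q), q \<otimes>\<^bsub>Q\<^esub> q')),
     one = (\<lambda>x\<in>carrier Q. \<one>\<^bsub>B\<^esub>, \<one>\<^bsub>Q\<^esub>)\<rparr>"

lemma regular_wreath_simps [simp]:
  "carrier (regular_wreath B Q) = (carrier Q \<rightarrow>\<^sub>E carrier B) \<times> carrier Q"
  "u \<otimes>\<^bsub>regular_wreath B Q\<^esub> v =
     (\<lambda>x\<in>carrier Q. fst u x \<otimes>\<^bsub>B\<^esub> fst v (x \<otimes>\<^bsub>Q\<^esub> snd u), snd u \<otimes>\<^bsub>Q\<^esub> snd v)"
  "\<one>\<^bsub>regular_wreath B Q\<^esub> = (\<lambda>x\<in>carrier Q. \<one>\<^bsub>B\<^esub>, \<one>\<^bsub>Q\<^esub>)"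
  by (auto simp: regular_wreath_def case_prod_unfold)

lemma regular_wreath_mem:
  assumes "u \<in> carrier (regular_wreath B Q)"
  shows "x \<in> carrier Q \<Longrightarrow> fst u x \<in> carrier B" "fst u \<in> extensional (carrier Q)" "snd u \<in> carrier Q"
  using assms by (simp_all add: mem_Times_iff PiE_iff)

lemma regular_wreath_memI:
  assumes "\<And>x. x \<in> carrier Q \<Longrightarrow> b x \<in> carrier B" "q \<in> carrier Q"
  shows "(restrict b (carrier Q), q) \<in> carrier (regular_wreath B Q)"
  using assms by simp

lemma group_regular_wreath:
  assumes "group B" "group Q"
  shows "group (regular_wreath B Q)"
proof -
  interpret B: group B by fact
  interpret Q: group Q by fact
  let ?W = "regular_wreath B Q"
  note mem = regular_wreath_mem[where B = B and Q = Q]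
  show ?thesis
  proof (rule groupI)
    show "\<one>\<^bsub>?W\<^esub> \<in> carrier ?W" by simp
    fix u v assume uv: "u \<in> carrier ?W" "v \<in> carrier ?W"
    show "u \<otimes>\<^bsub>?W\<^esub> v \<in> carrier ?W"
      unfolding regular_wreath_simps(2) using mem[OF uv(1)] mem[OF uv(2)] by (intro regular_wreath_memI) simp_all
    fix w assume w: "w \<in> carrier ?W"
    show "u \<otimes>\<^bsub>?W\<^esub> v \<otimes>\<^bsub>?W\<^esub> w = u \<otimes>\<^bsub>?W\<^esub> (v \<otimes>\<^bsub>?W\<^esub> w)"
      unfolding regular_wreath_simps(2) fst_conv snd_conv
      using mem[OF uv(1)] mem[OF uv(2)] mem[OF w] 
      by (intro arg_cong2[of _ _ _ _ Pair] restrict_ext) (simp_all add: B.m_assoc Q.m_assoc)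
  next
    fix u assume u: "u \<in> carrier ?W"
    let ?v = "(\<lambda>x\<in>carrier Q. inv\<^bsub>B\<^esub> fst u (x \<otimes>\<^bsub>Q\<^esub> inv\<^bsub>Q\<^esub> snd u), inv\<^bsub>Q\<^esub> snd u)"
    have "?v \<in> carrier ?W" using mem[OF u] by (intro regular_wreath_memI) simp_all
    moreover have "?v \<otimes>\<^bsub>?W\<^esub> u = \<one>\<^bsub>?W\<^esub>"
      unfolding regular_wreath_simps(2,3) fst_conv snd_conv
      using mem[OF u] by (intro arg_cong2[of _ _ _ _ Pair] restrict_ext) simp_all
    ultimately show "\<exists>v\<in>carrier ?W. v \<otimes>\<^bsub>?W\<^esub> u = \<one>\<^bsub>?W\<^esub>" by blast
    have "(\<lambda>x\<in>carrier Q. fst (\<one>\<^bsub>?W\<^esub>) x \<otimes>\<^bsub>B\<^esub> fst u (x \<otimes>\<^bsub>Q\<^esub> snd (\<one>\<^bsub>?W\<^esub>))) = fst u"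
      using mem[OF u] by (intro extensionalityI[of _ "carrier Q"]) simp_all
    then show "\<one>\<^bsub>?W\<^esub> \<otimes>\<^bsub>?W\<^esub> u = u"
      unfolding regular_wreath_simps(2) using mem[OF u] by (simp add: prod_eq_iff)
  qed
qed

lemma regular_wreath_map:
  assumes A: "group A" and B: "group B" and Q: "group Q" and \<alpha>: "\<alpha> \<in> hom B A" "\<alpha> ` carrier B = carrier A"
  defines "\<beta> \<equiv> \<lambda>u. (\<lambda>x\<in>carrier Q. \<alpha> (fst u x), snd u)"
  shows "\<beta> \<in> hom (regular_wreath B Q) (regular_wreath A Q)"
    "\<beta> ` carrier (regular_wreath B Q) = carrier (regular_wreath A Q)"
proof -
  interpret Q: group Q by fact
  show h: "\<beta> \<in> hom (regular_wreath B Q) (regular_wreath A Q)"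
    unfolding hom_def
  proof (intro CollectI conjI ballI Pi_I)
    have \<alpha>h: "x \<in> carrier B \<Longrightarrow> \<alpha> x \<in> carrier A" 
      "x \<in> carrier B \<Longrightarrow> y \<in> carrier B \<Longrightarrow> \<alpha> (x \<otimes>\<^bsub>B\<^esub> y) = \<alpha> x \<otimes>\<^bsub>A\<^esub> \<alpha> y" for x y
      using \<alpha>(1) by (auto simp: hom_def)
    fix u assume u: "u \<in> carrier (regular_wreath B Q)"
    show "\<beta> u \<in> carrier (regular_wreath A Q)"
      unfolding \<beta>_def using regular_wreath_mem[OF u] \<alpha>h by (intro regular_wreath_memI) simp_all
    fix v assume v: "v \<in> carrier (regular_wreath B Q)"
    show "\<beta> (u \<otimes>\<^bsub>regular_wreath B Q\<^esub> v) = \<beta> u \<otimes>\<^bsub>regular_wreath A Q\<^esub> \<beta> v"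
      unfolding regular_wreath_simps(2) \<beta>_def fst_conv snd_conv
      using regular_wreath_mem[OF u] regular_wreath_mem[OF v] \<alpha>h
      by (intro arg_cong2[of _ _ _ _ Pair] restrict_ext) simp_all
  qed
  have "u \<in> \<beta> ` carrier (regular_wreath B Q)" if u: "u \<in> carrier (regular_wreath A Q)" for u
  proof (rule image_eqI)
    define b where "b = (\<lambda>x\<in>carrier Q. inv_into (carrier B) \<alpha> (fst u x))"
    have f: "fst u x \<in> \<alpha> ` carrier B" if "x \<in> carrier Q" for x using regular_wreath_mem(1)[OF u that] \<alpha>(2) by simp
    show "(b, snd u) \<in> carrier (regular_wreath B Q)" 
      unfolding b_def using regular_wreath_mem(3)[OF u] inv_into_into[OF f] by (intro regular_wreath_memI)
    have "fst u = (\<lambda>x\<in>carrier Q. \<alpha> (b x))"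
      using f_inv_into_f[OF f] regular_wreath_mem(2)[OF u] 
      by (intro extensionalityI[of _ "carrier Q"]) (simp_all add: b_def)
    then show "u = \<beta> (b, snd u)" by (simp add: \<beta>_def prod_eq_iff)
  qed
  moreover have "\<beta> ` carrier (regular_wreath B Q) \<subseteq> carrier (regular_wreath A Q)" 
    using h unfolding hom_def by blast
  ultimately show "\<beta> ` carrier (regular_wreath B Q) = carrier (regular_wreath A Q)" by blast
qed

text \<open>
  \<open>E S E\<^sup>-\<^sup>1\<close> has at \<open>1\<close> a conjugate of the coordinate of \<open>S\<close> at the \<open>Q\<close>-component of \<open>E\<close>.  This
  component is different from \<open>1\<close>, so the coordinate is trivial, and only \<open>S\<^sup>-\<^sup>1\<close> contributes to
  the commutator at \<open>1\<close>.
\<close>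

lemma regular_wreath_commutator:
  assumes B: "group B" and Q: "group Q" and E: "E \<in> carrier (regular_wreath B Q)" "snd E \<noteq> \<one>\<^bsub>Q\<^esub>" 
    and d: "d \<in> carrier B" and S: "S = (\<lambda>x\<in>carrier Q. if x = \<one>\<^bsub>Q\<^esub> then d else \<one>\<^bsub>B\<^esub>, \<one>\<^bsub>Q\<^esub>)"
  defines "W \<equiv> regular_wreath B Q"
  shows "fst (E \<otimes>\<^bsub>W\<^esub> S \<otimes>\<^bsub>W\<^esub> inv\<^bsub>W\<^esub> E \<otimes>\<^bsub>W\<^esub> inv\<^bsub>W\<^esub> S) \<one>\<^bsub>Q\<^esub> = inv\<^bsub>B\<^esub> d"
proof -
  interpret B: group B by fact
  interpret Q: group Q by fact
  interpret W: group W unfolding W_def by (rule group_regular_wreath[OF B Q])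
  have EW: "E \<in> carrier W" using E(1) by (simp add: W_def)
  have SW: "S \<in> carrier W" unfolding W_def S using d by (intro regular_wreath_memI) simp_all
  define C where "C = E \<otimes>\<^bsub>W\<^esub> S \<otimes>\<^bsub>W\<^esub> inv\<^bsub>W\<^esub> E \<otimes>\<^bsub>W\<^esub> inv\<^bsub>W\<^esub> S"
  have CW: "C \<in> carrier W" unfolding C_def using EW SW by (intro W.m_closed W.inv_closed)
  \<comment> \<open>Comparing components in this equation avoids a formula for inverses in the wreath product.\<close>
  have eq: "C \<otimes>\<^bsub>W\<^esub> S \<otimes>\<^bsub>W\<^esub> E = E \<otimes>\<^bsub>W\<^esub> S"
    unfolding C_def using EW SW by (simp only: W.m_assoc W.m_closed W.inv_closed W.l_inv W.r_one)
  have mem: "fst E x \<in> carrier B" "fst C x \<in> carrier B" if "x \<in> carrier Q" for x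
    using regular_wreath_mem(1)[OF EW[unfolded W_def] that] regular_wreath_mem(1)[OF CW[unfolded W_def] that] by auto
  have sE: "snd E \<in> carrier Q" and sC: "snd C \<in> carrier Q" 
    using regular_wreath_mem(3) EW CW unfolding W_def by blast+
  have "snd C \<otimes>\<^bsub>Q\<^esub> snd E = snd E" using arg_cong[OF eq, of snd] sC sE by (simp add: W_def S)
  then have sC1: "snd C = \<one>\<^bsub>Q\<^esub>" using sC sE by (simp add: Q.r_cancel_one)
  have "fst C \<one>\<^bsub>Q\<^esub> \<otimes>\<^bsub>B\<^esub> d \<otimes>\<^bsub>B\<^esub> fst E \<one>\<^bsub>Q\<^esub> = fst E \<one>\<^bsub>Q\<^esub>"
    using arg_cong[OF arg_cong[OF eq, of fst], of "\<lambda>f. f \<one>\<^bsub>Q\<^esub>"] sE sC1 E(2) mem by (simp add: W_def S)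
  then have "fst C \<one>\<^bsub>Q\<^esub> \<otimes>\<^bsub>B\<^esub> d = \<one>\<^bsub>B\<^esub>" using mem d by (simp add: B.r_cancel_one)
  then show ?thesis unfolding C_def[symmetric] using mem d by (simp add: B.inv_equality)
qed

text \<open>
  For a transversal \<open>t\<close> of \<open>H\<close>, the elements \<open>k X f = t(X) f t(X f)\<^sup>-\<^sup>1\<close> lie in \<open>H\<close> and satisfy
  \<open>k X (f g) = k X f \<cdot> k (X f) g\<close>, which is the multiplication rule of the wreath product; so
  \<open>f \<mapsto> ((\<phi> (k X f))\<^sub>X, H f)\<close> is a homomorphism.  Choosing \<open>t(H) = 1\<close> makes its coordinate at \<open>H\<close> extend
  \<open>\<phi>\<close>.  The last assertion describes enough of its kernel to see that the kernel is open
  when \<open>\<phi>\<close> is trivial on an open normal subgroup.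
\<close>

lemma (in normal) kaloujnine_krasner:
  fixes A :: "('c, 'm) monoid_scheme"
  assumes A: "group A" and \<phi>: "\<phi> \<in> hom (G\<lparr>carrier := H\<rparr>) A"
  shows "\<exists>\<kappa>. \<kappa> \<in> hom G (regular_wreath A (G Mod H)) \<and> (\<forall>f\<in>carrier G. snd (\<kappa> f) = H #> f) \<and>
    (\<forall>f\<in>H. fst (\<kappa> f) H = \<phi> f) \<and>
    (\<forall>f\<in>carrier G. (\<forall>g\<in>carrier G. g \<otimes> f \<otimes> inv g \<in> kernel (G\<lparr>carrier := H\<rparr>) A \<phi>) \<longrightarrow>
       \<kappa> f = \<one>\<^bsub>regular_wreath A (G Mod H)\<^esub>)"
proof -
  interpret A: group A by fact
  have sH: "subgroup H G" using is_subgroup .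
  define t where "t X = (if X = H then \<one> else SOME x. x \<in> X)" for X
  have t: "t X \<in> carrier G \<and> H #> t X = X" if X: "X \<in> rcosets H" for X
  proof (cases "X = H")
    case True
    then show ?thesis by (simp add: t_def coset_mult_one subset)
  next
    case False
    obtain a where a: "a \<in> carrier G" "X = H #> a" using X by (auto simp: RCOSETS_def)
    then have "a \<in> X" using rcos_self sH by simp
    then have "t X \<in> X" using False by (auto simp: t_def intro: someI)
    then show ?thesis using a repr_independence[OF _ a(1) sH] r_coset_subset_G[OF subset a(1)] by auto
  qed
  have act: "X <#> (H #> f) = H #> (t X \<otimes> f)" if "X \<in> rcosets H" "f \<in> carrier G" for X f
    using rcos_sum[of "t X" f] t[OF that(1)] that(2) by simp
  have act_in: "X <#> (H #> f) \<in> rcosets H" if "X \<in> rcosets H" "f \<in> carrier G" for X f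
    using act[OF that] t[OF that(1)] that(2) by (auto simp: RCOSETS_def)
  define k where "k X f = t X \<otimes> f \<otimes> inv (t (X <#> (H #> f)))" for X f
  have kH: "k X f \<in> H" if Xf: "X \<in> rcosets H" "f \<in> carrier G" for X f
  proof -
    have "t X \<otimes> f \<in> H #> t (X <#> (H #> f))"
      using t[OF act_in[OF Xf]] act[OF Xf] t[OF Xf(1)] Xf(2) rcos_self[OF _ sH] by simp
    then show ?thesis unfolding k_def using t[OF act_in[OF Xf]] rcos_module_imp[OF is_group] by blast
  qed
  have kmul: "k X (f \<otimes> g) = k X f \<otimes> k (X <#> (H #> f)) g" 
    if X: "X \<in> rcosets H" and fg: "f \<in> carrier G" "g \<in> carrier G" for X f g
  proof -
    let ?Y = "X <#> (H #> f)"
    have Y: "?Y \<in> rcosets H" by (rule act_in[OF X fg(1)])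
    have XYg: "X <#> (H #> (f \<otimes> g)) = ?Y <#> (H #> g)"
    proof -
      have "?Y <#> (H #> g) = H #> (t X \<otimes> f) <#> (H #> g)" using act[OF X fg(1)] by simp
      also have "\<dots> = H #> (t X \<otimes> (f \<otimes> g))" using t[OF X] fg by (simp add: rcos_sum m_assoc)
      finally show ?thesis using act[OF X, of "f \<otimes> g"] fg by simp
    qed
    have "inv (t ?Y) \<otimes> (t ?Y \<otimes> (g \<otimes> z)) = g \<otimes> z" if "z \<in> carrier G" for z
      using t[OF Y] fg that by (simp add: m_assoc[symmetric])
    then show ?thesis unfolding k_def XYg using t[OF X] t[OF Y] t[OF act_in[OF Y fg(2)]] fg 
      by (simp add: m_assoc)
  qed
  have \<phi>c: "\<phi> x \<in> carrier A" if "x \<in> H" for x using \<phi> that by (auto simp: hom_def)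
  have \<phi>m: "\<phi> (x \<otimes> y) = \<phi> x \<otimes>\<^bsub>A\<^esub> \<phi> y" if "x \<in> H" "y \<in> H" for x y using \<phi> that by (auto simp: hom_def)
  define \<kappa> where "\<kappa> f = (\<lambda>X\<in>rcosets H. \<phi> (k X f), H #> f)" for f
  have cM: "carrier (G Mod H) = rcosets H" by (simp add: FactGroup_def)
  have HH: "H \<in> rcosets H" using subgroup_in_rcosets[OF is_group] .
  show ?thesis
  proof (intro exI[of _ \<kappa>] conjI ballI impI)
    show "\<kappa> \<in> hom G (regular_wreath A (G Mod H))"
      unfolding hom_def
    proof (intro CollectI conjI ballI Pi_I)
      fix f assume f: "f \<in> carrier G"
      show "\<kappa> f \<in> carrier (regular_wreath A (G Mod H))"
        unfolding \<kappa>_def cM[symmetric] using \<phi>c kH rcosetsI[OF subset f] f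
        by (intro regular_wreath_memI) (simp_all add: cM)
      fix g assume g: "g \<in> carrier G"
      have "\<phi> (k X (f \<otimes> g)) = \<phi> (k X f) \<otimes>\<^bsub>A\<^esub> \<phi> (k (X <#> (H #> f)) g)" if "X \<in> rcosets H" for X
        using kmul[OF that f g] \<phi>m kH that act_in[OF that f] f g by simp
      then show "\<kappa> (f \<otimes> g) = \<kappa> f \<otimes>\<^bsub>regular_wreath A (G Mod H)\<^esub> \<kappa> g"
        unfolding regular_wreath_simps \<kappa>_def fst_conv snd_conv cM mult_FactGroup
        using f g by (intro arg_cong2[of _ _ _ _ Pair] restrict_ext) (simp_all only: rcos_sum act_in restrict_apply' if_True)
    qed
    fix f
    show "snd (\<kappa> f) = H #> f" if "f \<in> carrier G" by (simp add: \<kappa>_def)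
    show "fst (\<kappa> f) H = \<phi> f" if f: "f \<in> H"
    proof -
      have fc: "f \<in> carrier G" using f subset by blast
      have "H <#> (H #> f) = H" using coset_join2[OF fc sH f] subgroup_mult_id[OF sH] by simp
      then have "k H f = f" using fc by (simp add: k_def t_def)
      then show ?thesis using HH by (simp add: \<kappa>_def)
    qed
    assume f: "f \<in> carrier G" and fg: "\<forall>g\<in>carrier G. g \<otimes> f \<otimes> inv g \<in> kernel (G\<lparr>carrier := H\<rparr>) A \<phi>"
    have fH: "f \<in> H" using bspec[OF fg one_closed] f by (simp add: kernel_def)
    have "\<phi> (k X f) = \<one>\<^bsub>A\<^esub>" if X: "X \<in> rcosets H" for X
    proof -
      have "X <#> (H #> f) = H #> t X <#> H" using coset_join2[OF f sH fH] t[OF X] by simp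
      also have "\<dots> = X" using rcos_sum[of "t X" \<one>] t[OF X] coset_mult_one[OF subset] by simp
      finally have "k X f = t X \<otimes> f \<otimes> inv (t X)" by (simp add: k_def)
      then show ?thesis using fg t[OF X] by (simp add: kernel_def)
    qed
    then show "\<kappa> f = \<one>\<^bsub>regular_wreath A (G Mod H)\<^esub>"
      unfolding \<kappa>_def regular_wreath_simps(3) cM one_FactGroup
      using coset_join2[OF f sH fH] by (intro arg_cong2[of _ _ _ _ Pair] restrict_ext) simp_all
  qed
qed

section \<open>Embedding problems for closed subgroups that contain the commutator subgroup\<close>

lemma (in group) normal_if_contains_derived:
  assumes H: "subgroup H G" and d: "derived G (carrier G) \<subseteq> H"
  shows "H \<lhd> G"
proof (rule normal_invI[OF H])
  fix g h assume g: "g \<in> carrier G" and h: "h \<in> H"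
  then have hc: "h \<in> carrier G" using subgroup.subset[OF H] by blast
  have "g \<otimes> h \<otimes> inv g \<otimes> inv h \<in> H" 
    using d generate.incl[of _ "derived_set G (carrier G)"] g hc unfolding derived_def by blast
  then have "g \<otimes> h \<otimes> inv g \<otimes> inv h \<otimes> h \<in> H" using h subgroup.m_closed[OF H] by blast
  then show "g \<otimes> h \<otimes> inv g \<in> H" using g hc by (simp add: m_assoc)
qed

text \<open>
  The kernel of \<open>\<phi>\<close> is the trace on \<open>N\<close> of an open set \<open>U\<close>.  For an open normal subgroup \<open>D \<subseteq> U\<close> the
  map \<open>d n \<mapsto> \<phi> n\<close> is well defined on \<open>D N\<close>, since \<open>\<phi>\<close> is trivial on \<open>D \<inter> N\<close>.  As \<open>N\<close> is closed and
  not all of \<open>P\<close>, a small \<open>D\<close> leaves \<open>D N \<noteq> P\<close>.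
\<close>

lemma extend_to_open_subgroup:
  fixes P :: "'a topgroup" (structure)
  assumes P: "profinite P" and N: "subgroup N P" "closedin (topo P) N" "N \<noteq> carrier P" and A: "group A"
    and \<phi>: "open_kernel_hom (subgroup_of P N) A \<phi>"
  shows "\<exists>F D \<phi>'. subgroup F P \<and> N \<subseteq> F \<and> F \<noteq> carrier P \<and> open_normal P D \<and> D \<subseteq> F \<and>
    \<phi>' \<in> hom (P\<lparr>carrier := F\<rparr>) A \<and> (\<forall>n\<in>N. \<phi>' n = \<phi> n) \<and> (\<forall>d\<in>D. \<phi>' d = \<one>\<^bsub>A\<^esub>)"
proof -
  note tg = profiniteD(1)[OF P] and ts = topological_groupD(2)[OF profiniteD(1)[OF P]]
  interpret group P using topological_groupD(1)[OF tg] .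
  interpret A: group A by fact
  have NP: "N \<subseteq> carrier P" using N(1) by (rule subgroup.subset)
  have \<phi>h: "\<phi> x \<in> carrier A" "\<phi> (x \<otimes> y) = \<phi> x \<otimes>\<^bsub>A\<^esub> \<phi> y" if "x \<in> N" "y \<in> N" for x y
    using \<phi> that by (auto simp: open_kernel_hom_def hom_def)
  note Nc = subgroup.m_closed[OF N(1)] subgroup.m_inv_closed[OF N(1)] subgroup.one_closed[OF N(1)]
  have \<phi>1: "\<phi> \<one> = \<one>\<^bsub>A\<^esub>" using \<phi>h[OF Nc(3) Nc(3)] A.r_cancel_one[of "\<phi> \<one>" "\<phi> \<one>"] by simp
  obtain U where U: "openin (topo P) U" "kernel (subgroup_of P N) A \<phi> = U \<inter> N"
    using \<phi> by (auto simp: open_kernel_hom_def openin_subtopology)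
  have ker: "x \<in> N \<Longrightarrow> x \<in> U \<longleftrightarrow> \<phi> x = \<one>\<^bsub>A\<^esub>" for x using U(2) by (auto simp: kernel_def)
  then have 1: "\<one> \<in> U" using \<phi>1 Nc(3) by blast
  obtain g where g: "g \<in> carrier P" "g \<notin> N" using N(3) NP by blast
  \<comment> \<open>\<open>D \<subseteq> V\<close> ensures that \<open>g\<close> stays outside \<open>D N\<close>: from \<open>g = d n\<close> follows \<open>d\<^sup>-\<^sup>1 g \<in> N\<close>.\<close>
  define V where "V = {x \<in> carrier P. x \<otimes> g \<in> carrier P - N}"
  have V: "openin (topo P) V" "\<one> \<in> V"
    unfolding V_def using N(2) g by (auto simp: closedin_def ts intro: open_translation(2)[OF tg _ g(1), of "carrier P - N", simplified])
  obtain D where D: "open_normal P D" "D \<subseteq> U \<inter> V"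
    using profinite_open_normal_base[OF P, of "U \<inter> V"] U(1) V 1 by blast
  have nD: "D \<lhd> P" using D(1) by (simp add: open_normal_def)
  interpret D: normal D P by fact
  have sD: "subgroup D P" by (rule D.is_subgroup)
  define F where "F = D <#> N"
  have sF: "subgroup F P" unfolding F_def by (rule mult_norm_subgroup[OF nD N(1)])
  have Fi: "d \<otimes> n \<in> F" if "d \<in> D" "n \<in> N" for d n using that by (auto simp: F_def set_mult_def)
  have Fe: "\<exists>d\<in>D. \<exists>n\<in>N. x = d \<otimes> n" if "x \<in> F" for x using that by (auto simp: F_def set_mult_def)
  define \<phi>' where "\<phi>' x = \<phi> (SOME n. n \<in> N \<and> x \<otimes> inv n \<in> D)" for x
  have \<phi>': "\<phi>' (d \<otimes> n) = \<phi> n" if dn: "d \<in> D" "n \<in> N" for d n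
  proof -
    have c: "d \<in> carrier P" "n \<in> carrier P" using dn NP by auto
    define m where "m = (SOME m. m \<in> N \<and> d \<otimes> n \<otimes> inv m \<in> D)"
    have "n \<in> N \<and> d \<otimes> n \<otimes> inv n \<in> D" using dn c by (simp add: m_assoc)
    then have m: "m \<in> N" "d \<otimes> n \<otimes> inv m \<in> D" unfolding m_def by (metis (mono_tags, lifting) someI_ex)+
    have mc: "m \<in> carrier P" using m NP by blast
    have "inv d \<otimes> (d \<otimes> n \<otimes> inv m) \<in> D" using m dn by blast
    moreover have "inv d \<otimes> (d \<otimes> n \<otimes> inv m) = n \<otimes> inv m" using c mc by (simp add: m_assoc[symmetric])
    ultimately have "n \<otimes> inv m \<in> U" "n \<otimes> inv m \<in> N" using D(2) Nc dn m by auto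
    then have "\<phi> (n \<otimes> inv m) = \<one>\<^bsub>A\<^esub>" using ker by blast
    then have "\<phi> (n \<otimes> inv m \<otimes> m) = \<phi> m" using \<phi>h m(1) Nc dn(2) by simp
    then show ?thesis unfolding \<phi>'_def m_def[symmetric] using c mc by (simp add: m_assoc)
  qed
  have "\<phi>' \<in> hom (P\<lparr>carrier := F\<rparr>) A"
    unfolding hom_def
  proof (intro CollectI conjI Pi_I ballI)
    fix x assume "x \<in> carrier (P\<lparr>carrier := F\<rparr>)"
    then have "x \<in> F" by simp
    then obtain d n where x: "d \<in> D" "n \<in> N" "x = d \<otimes> n" using Fe by blast
    then show "\<phi>' x \<in> carrier A" using \<phi>' \<phi>h by simp
    fix y assume "y \<in> carrier (P\<lparr>carrier := F\<rparr>)"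
    then have "y \<in> F" by simp
    then obtain e m where y: "e \<in> D" "m \<in> N" "y = e \<otimes> m" using Fe by blast
    have c: "d \<in> carrier P" "n \<in> carrier P" "e \<in> carrier P" "m \<in> carrier P" using x y NP by auto
    have "x \<otimes> y = (d \<otimes> (n \<otimes> e \<otimes> inv n)) \<otimes> (n \<otimes> m)" 
    proof -
      have "inv n \<otimes> (n \<otimes> m) = m" using c by (simp add: m_assoc[symmetric])
      then show ?thesis using c by (simp add: x y m_assoc)
    qed
    moreover have "d \<otimes> (n \<otimes> e \<otimes> inv n) \<in> D" using x y c D.inv_op_closed2 by blast
    ultimately show "\<phi>' (x \<otimes>\<^bsub>P\<lparr>carrier := F\<rparr>\<^esub> y) = \<phi>' x \<otimes>\<^bsub>A\<^esub> \<phi>' y" 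
      using \<phi>' x y Nc \<phi>h by simp
  qed
  moreover have "\<phi>' n = \<phi> n" if "n \<in> N" for n using \<phi>'[OF D.one_closed that] that NP by auto
  moreover have "\<phi>' d = \<one>\<^bsub>A\<^esub>" if "d \<in> D" for d using \<phi>'[OF that Nc(3)] that \<phi>1 by simp
  moreover have "N \<subseteq> F" using Fi[OF D.one_closed] NP by (metis l_one subsetD subsetI)
  moreover have "D \<subseteq> F" using Fi[OF _ Nc(3)] by auto
  moreover have "g \<notin> F"
  proof
    assume "g \<in> F"
    then obtain d n where x: "d \<in> D" "n \<in> N" "g = d \<otimes> n" using Fe by blast
    then have c: "d \<in> carrier P" "n \<in> carrier P" using NP by auto
    have "inv d \<in> V" using x D(2) by blast
    moreover have "inv d \<otimes> g = n" using x c by (simp add: m_assoc[symmetric])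
    ultimately show False using x by (simp add: V_def)
  qed
  ultimately show ?thesis using sF D(1) g(1) by blast
qed

text \<open>
  The heart of (a).  The kernel of \<open>\<alpha>\<close> is reached through commutators in \<open>P\<close>, which exist in \<open>N\<close>
  because \<open>N\<close> contains the commutator subgroup, and have a prescribed coordinate because some
  element of \<open>P\<close> lies outside the open subgroup \<open>F \<supseteq> N\<close>.
\<close>

theorem closed_subgroup_solves_finite_embedding_problems:
  fixes P :: "'a topgroup" (structure)
  assumes P: "free_profinite_on P S" "infinite S" 
    and N: "subgroup N P" "closedin (topo P) N" "derived P (carrier P) \<subseteq> N" "N \<noteq> carrier P"
  shows "solves_finite_embedding_problems TYPE('b) (subgroup_of P N)"
  unfolding solves_finite_embedding_problems_def
proof (intro allI impI, elim conjE)
  fix A B :: "'b monoid" and \<alpha> \<phi>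
  assume A: "group A" and B: "group B" "finite (carrier B)" and \<alpha>: "\<alpha> \<in> hom B A" "\<alpha> ` carrier B = carrier A"
    and \<phi>: "open_kernel_hom (subgroup_of P N) A \<phi>" "\<phi> ` carrier (subgroup_of P N) = carrier A"
  have pf: "profinite P" using P by (simp add: free_profinite_on_def)
  note tg = profiniteD(1)[OF pf]
  interpret group P using topological_groupD(1)[OF tg] .
  interpret A: group A by fact
  interpret B: group B by fact
  interpret \<alpha>: group_hom B A \<alpha> using \<alpha> by unfold_locales
  have NP: "N \<subseteq> carrier P" using N(1) by (rule subgroup.subset)
  obtain F D \<phi>' where F: "subgroup F P" "N \<subseteq> F" "F \<noteq> carrier P" and D: "open_normal P D" "D \<subseteq> F"
    and \<phi>': "\<phi>' \<in> hom (P\<lparr>carrier := F\<rparr>) A" "\<forall>n\<in>N. \<phi>' n = \<phi> n" "\<forall>d\<in>D. \<phi>' d = \<one>\<^bsub>A\<^esub>"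
    using extend_to_open_subgroup[OF pf N(1,2,4) A \<phi>(1)] by metis
  have nF: "F \<lhd> P" using normal_if_contains_derived[OF F(1)] N(3) F(2) by blast
  interpret F: normal F P by fact
  let ?Q = "P Mod F"
  have Q: "group ?Q" by (rule F.factorgroup_is_group)
  interpret Q: group ?Q by fact
  have nD: "D \<lhd> P" "openin (topo P) D" using D(1) by (auto simp: open_normal_def)
  have D1: "\<one> \<in> D" using nD(1) by (simp add: normal_def subgroup.one_closed)
  have oF: "openin (topo P) F" by (rule subgroup_open_if_contains_open[OF tg F(1) nD(2) D1 D(2)])
  have cQ: "carrier ?Q = rcosets F" by (simp add: FactGroup_def)
  have fQ: "finite (carrier ?Q)" 
    unfolding cQ by (rule finite_rcosets_open[OF tg profiniteD(2)[OF pf] F(1) oF])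
  let ?WA = "regular_wreath A ?Q" and ?WB = "regular_wreath B ?Q"
  interpret WA: group ?WA by (rule group_regular_wreath[OF A Q])
  interpret WB: group ?WB by (rule group_regular_wreath[OF B(1) Q])
  obtain \<kappa> where \<kappa>: "\<kappa> \<in> hom P ?WA" "\<forall>f\<in>carrier P. snd (\<kappa> f) = F #> f" "\<forall>f\<in>F. fst (\<kappa> f) F = \<phi>' f"
    "\<forall>f\<in>carrier P. (\<forall>g\<in>carrier P. g \<otimes> f \<otimes> inv g \<in> kernel (P\<lparr>carrier := F\<rparr>) A \<phi>') \<longrightarrow> \<kappa> f = \<one>\<^bsub>?WA\<^esub>"
    using F.kaloujnine_krasner[OF A \<phi>'(1)] by blast
  interpret \<kappa>: group_hom P ?WA \<kappa> using \<kappa>(1) by unfold_locales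
  have "D \<subseteq> kernel P ?WA \<kappa>"
  proof
    fix d assume d: "d \<in> D"
    then have dc: "d \<in> carrier P" using D(2) F.subset by blast
    have "g \<otimes> d \<otimes> inv g \<in> kernel (P\<lparr>carrier := F\<rparr>) A \<phi>'" if "g \<in> carrier P" for g
    proof -
      have "g \<otimes> d \<otimes> inv g \<in> D" using normal.inv_op_closed2[OF nD(1) that d] .
      then show ?thesis using D(2) \<phi>'(3) by (auto simp: kernel_def)
    qed
    then show "d \<in> kernel P ?WA \<kappa>" using dc \<kappa>(4) by (simp add: kernel_def)
  qed
  then have "openin (topo P) (kernel P ?WA \<kappa>)"
    by (intro subgroup_open_if_contains_open[OF tg \<kappa>.subgroup_kernel nD(2) D1])
  then have ok: "open_kernel_hom P ?WA \<kappa>" using \<kappa>(1) by (simp add: open_kernel_hom_def)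
  define \<beta> where "\<beta> u = (\<lambda>x\<in>carrier ?Q. \<alpha> (fst u x), snd u)" for u :: "('a set \<Rightarrow> 'b) \<times> 'a set"
  have \<beta>: "\<beta> \<in> hom ?WB ?WA" "\<beta> ` carrier ?WB = carrier ?WA"
    using regular_wreath_map[OF A B(1) Q \<alpha>] unfolding \<beta>_def by blast+
  have fWB: "finite (carrier ?WB)" using fQ B(2) by (simp add: finite_PiE)
  obtain \<Psi> where \<Psi>: "open_kernel_hom P ?WB \<Psi>" "\<forall>p\<in>carrier P. \<beta> (\<Psi> p) = \<kappa> p" 
    "kernel ?WB ?WA \<beta> \<subseteq> \<Psi> ` carrier P"
    using free_profinite_lifts[OF P WA.is_group WB.is_group fWB \<beta> ok] by blast
  interpret \<Psi>: group_hom P ?WB \<Psi> using \<Psi>(1) by unfold_locales (simp add: open_kernel_hom_def)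
  have one: "F \<in> carrier ?Q" using Q.one_closed by simp
  have snd\<Psi>: "snd (\<Psi> p) = F #> p" if "p \<in> carrier P" for p
    using \<Psi>(2) \<kappa>(2) that by (metis \<beta>_def snd_conv)
  have sndN: "snd (\<Psi> n) = F" if "n \<in> N" for n
    using snd\<Psi>[of n] that NP F(2) coset_join2[OF _ F(1)] by (metis subsetD)
  \<comment> \<open>\<open>F\<close> is the identity of \<open>P Mod F\<close>, so this is the coordinate at \<open>1\<close>.  It is multiplicative on \<open>N\<close>
    because elements of \<open>N\<close> have trivial \<open>Q\<close>-component and hence do not shift coordinates.\<close>
  define \<psi> where "\<psi> n = fst (\<Psi> n) F" for n
  have \<psi>c: "\<psi> n \<in> carrier B" if "n \<in> N" for n
    unfolding \<psi>_def using \<Psi>.hom_closed[of n] that NP one by (intro regular_wreath_mem(1)) auto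
  have \<psi>m: "\<psi> (n \<otimes> m) = \<psi> n \<otimes>\<^bsub>B\<^esub> \<psi> m" if "n \<in> N" "m \<in> N" for n m
  proof -
    have "\<Psi> (n \<otimes> m) = \<Psi> n \<otimes>\<^bsub>?WB\<^esub> \<Psi> m" using that NP by (intro \<Psi>.hom_mult) auto
    then show ?thesis using sndN[OF that(1)] one Q.r_one[OF one] by (simp add: \<psi>_def)
  qed
  have \<psi>h: "\<psi> \<in> hom (subgroup_of P N) B" using \<psi>c \<psi>m by (simp add: hom_def)
  have \<alpha>\<psi>: "\<alpha> (\<psi> n) = \<phi> n" if "n \<in> N" for n
  proof -
    have "\<alpha> (\<psi> n) = fst (\<beta> (\<Psi> n)) F" using one by (simp add: \<beta>_def \<psi>_def)
    also have "\<dots> = \<phi>' n" using that NP \<Psi>(2) \<kappa>(3) F(2) by (metis subsetD)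
    finally show ?thesis using \<phi>'(2) that by simp
  qed
  have pN: "profinite (subgroup_of P N)" by (rule profinite_closed_subgroup[OF pf N(1,2)])
  have gN: "group (subgroup_of P N)" using pN profiniteD(1) topological_groupD(1) by blast
  interpret \<psi>: group_hom "subgroup_of P N" B \<psi> 
    using \<psi>h gN B(1) by (simp add: group_hom_def group_hom_axioms_def)
  have "openin (topo (subgroup_of P N)) (kernel P ?WB \<Psi> \<inter> N)"
    using \<Psi>(1) by (auto simp: open_kernel_hom_def openin_subtopology)
  moreover have "\<one> \<in> kernel P ?WB \<Psi> \<inter> N" using subgroup.one_closed[OF N(1)] \<Psi>.hom_one by (simp add: kernel_def)
  moreover have "kernel P ?WB \<Psi> \<inter> N \<subseteq> kernel (subgroup_of P N) B \<psi>"
    using one by (auto simp: kernel_def \<psi>_def)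
  ultimately have "openin (topo (subgroup_of P N)) (kernel (subgroup_of P N) B \<psi>)"
    using subgroup_open_if_contains_open[OF profiniteD(1)[OF pN] \<psi>.subgroup_kernel] by simp
  then have ok\<psi>: "open_kernel_hom (subgroup_of P N) B \<psi>" using \<psi>h by (simp add: open_kernel_hom_def)
  have "kernel B A \<alpha> \<subseteq> \<psi> ` carrier (subgroup_of P N)"
  proof
    fix c assume c: "c \<in> kernel B A \<alpha>"
    then have cB: "c \<in> carrier B" and \<alpha>c: "\<alpha> c = \<one>\<^bsub>A\<^esub>" by (auto simp: kernel_def)
    obtain e where e: "e \<in> carrier P" "e \<notin> F" using F(3) F.subset by blast
    \<comment> \<open>The inverse is there because the commutator below yields the inverse of the coordinate of \<open>T\<close>.\<close>
    define T where "T = (\<lambda>x\<in>carrier ?Q. if x = \<one>\<^bsub>?Q\<^esub> then inv\<^bsub>B\<^esub> c else \<one>\<^bsub>B\<^esub>, \<one>\<^bsub>?Q\<^esub>)"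
    have "T \<in> kernel ?WB ?WA \<beta>" 
    proof -
      have "T \<in> carrier ?WB" unfolding T_def using cB one by (intro regular_wreath_memI) simp_all
      moreover have "\<beta> T = \<one>\<^bsub>?WA\<^esub>" 
        unfolding \<beta>_def T_def regular_wreath_simps(3) fst_conv snd_conv
        using cB \<alpha>c by (intro arg_cong2[of _ _ _ _ Pair] restrict_ext) simp_all
      ultimately show ?thesis by (simp add: kernel_def)
    qed
    then obtain s where s: "s \<in> carrier P" "\<Psi> s = T" using \<Psi>(3) by (metis image_iff subsetD)
    have "snd (\<Psi> e) \<noteq> \<one>\<^bsub>?Q\<^esub>" using snd\<Psi>[OF e(1)] e coset_join1[OF _ e(1) F(1)] by auto
    then have "fst (\<Psi> e \<otimes>\<^bsub>?WB\<^esub> T \<otimes>\<^bsub>?WB\<^esub> inv\<^bsub>?WB\<^esub> \<Psi> e \<otimes>\<^bsub>?WB\<^esub> inv\<^bsub>?WB\<^esub> T) \<one>\<^bsub>?Q\<^esub> = c"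
      using regular_wreath_commutator[OF B(1) Q \<Psi>.hom_closed[OF e(1)] _ B.inv_closed[OF cB] T_def] cB by simp
    moreover have "\<Psi> (e \<otimes> s \<otimes> inv e \<otimes> inv s) = \<Psi> e \<otimes>\<^bsub>?WB\<^esub> T \<otimes>\<^bsub>?WB\<^esub> inv\<^bsub>?WB\<^esub> \<Psi> e \<otimes>\<^bsub>?WB\<^esub> inv\<^bsub>?WB\<^esub> T"
      using e(1) s by (simp only: \<Psi>.hom_mult \<Psi>.hom_inv m_closed inv_closed)
    ultimately have "\<psi> (e \<otimes> s \<otimes> inv e \<otimes> inv s) = c" by (simp add: \<psi>_def)
    moreover have "e \<otimes> s \<otimes> inv e \<otimes> inv s \<in> N"
      using N(3) generate.incl[of _ "derived_set P (carrier P)"] e(1) s(1) unfolding derived_def by blast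
    ultimately show "c \<in> \<psi> ` carrier (subgroup_of P N)" by force
  qed
  then have "\<psi> ` carrier (subgroup_of P N) = carrier B"
    using lift_surjective[OF A B(1) gN \<alpha>(1) \<psi>h _ \<phi>(2)] \<alpha>\<psi> by simp
  then show "\<exists>\<psi>. open_kernel_hom (subgroup_of P N) B \<psi> \<and> \<psi> ` carrier (subgroup_of P N) = carrier B \<and>
      (\<forall>p\<in>carrier (subgroup_of P N). \<alpha> (\<psi> p) = \<phi> p)"
    using ok\<psi> \<alpha>\<psi> by auto
qed

section \<open>Countably many open normal subgroups\<close>

definition countable_base_at_one :: "'a topgroup \<Rightarrow> (nat \<Rightarrow> 'a set) \<Rightarrow> bool" where
  "countable_base_at_one P N \<longleftrightarrow>
     (\<forall>n. open_normal P (N n)) \<and> (\<forall>U. openin (topo P) U \<and> \<one>\<^bsub>P\<^esub> \<in> U \<longrightarrow> (\<exists>n. N n \<subseteq> U))"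

text \<open>
  An open subgroup is also closed, hence the closure of its trace on a dense set.
\<close>

lemma open_subgroup_eq_if_eq_on_dense:
  assumes P: "topological_group P" and M: "subgroup M P" "openin (topo P) M" and N: "subgroup N P" "openin (topo P) N"
    and D: "topo P closure_of D = carrier P" "M \<inter> D = N \<inter> D"
  shows "M = N"
proof -
  interpret group P using topological_groupD(1)[OF P] .
  note ts = topological_groupD(2)[OF P]
  have *: "K \<subseteq> L" if K: "subgroup K P" "openin (topo P) K" and L: "subgroup L P" "openin (topo P) L" 
    and eq: "K \<inter> D = L \<inter> D" for K L
  proof
    fix x assume x: "x \<in> K"
    then have xc: "x \<in> carrier P" using subgroup.subset[OF K(1)] by blast
    have cl: "L #>\<^bsub>P\<^esub> \<one>\<^bsub>P\<^esub> = L" using subgroup.subset[OF L(1)] by (rule coset_mult_one)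
    have "closedin (topo P) L" using closed_rcoset[OF P L one_closed] cl by simp
    then have "topo P closure_of (L \<inter> D) \<subseteq> L" by (intro closure_of_minimal) auto
    moreover have "x \<in> topo P closure_of (K \<inter> D)"
      unfolding in_closure_of
    proof (intro conjI allI impI)
      show "x \<in> topspace (topo P)" using xc ts by simp
      fix T assume T: "x \<in> T \<and> openin (topo P) T"
      then have "openin (topo P) (T \<inter> K)" "x \<in> T \<inter> K" using K(2) x by auto
      moreover have "x \<in> topo P closure_of D" using D(1) xc by simp
      ultimately show "\<exists>y. y \<in> K \<inter> D \<and> y \<in> T" unfolding in_closure_of by blast
    qed
    ultimately show "x \<in> L" using eq by auto
  qed
  show ?thesis using *[OF M N D(2)] *[OF N M] D(2) by blast
qed

text \<open>
  Number the cosets of an open normal subgroup \<open>N\<close>.  The multiplication table of the numbered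
  quotient, together with the numbers of the finitely many basis elements outside \<open>N\<close> and of the
  identity, is a finite object over a countable set.  It determines the number of the coset of each
  word in the basis, so it determines the trace of \<open>N\<close> on a dense subgroup and therefore \<open>N\<close>.
\<close>

lemma countable_open_normal_subgroups:
  fixes P :: "'a topgroup" (structure)
  assumes P: "free_profinite_on P S" and S: "countable S"
  shows "countable {N. open_normal P N}"
proof -
  have pf: "profinite P" and gen: "top_generates P S" and conv: "set_converges_to_1 P S" 
    using P(1) by (auto simp: free_profinite_on_def)
  note tg = profiniteD(1)[OF pf]
  interpret group P using topological_groupD(1)[OF tg] .
  have SP: "S \<subseteq> carrier P" using gen by (simp add: top_generates_def)
  let ?\<N> = "{N. open_normal P N}"
  have nrm: "N \<lhd> P" "subgroup N P" "openin (topo P) N" if "N \<in> ?\<N>" for N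
    using that by (auto simp: open_normal_def normal_def)
  have fin: "finite (rcosets N)" if "N \<in> ?\<N>" for N
    by (rule finite_rcosets_open[OF tg profiniteD(2)[OF pf] nrm(2,3)[OF that]])
  define e :: "'a set \<Rightarrow> 'a \<Rightarrow> nat" where "e N x = to_nat_on (rcosets N) (N #> x)" for N x
  have e: "e N x = e N y \<longleftrightarrow> N #> x = N #> y" if "N \<in> ?\<N>" "x \<in> carrier P" "y \<in> carrier P" for N x y
    unfolding e_def using that rcosetsI[OF subgroup.subset[OF nrm(2)[OF that(1)]]]
    by (intro to_nat_on_inj countable_finite[OF fin]) auto
  have e1: "e N x = e N \<one> \<longleftrightarrow> x \<in> N" if "N \<in> ?\<N>" "x \<in> carrier P" for N x
    using e[OF that(1,2) one_closed] coset_mult_one[OF subgroup.subset[OF nrm(2)[OF that(1)]]]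
      coset_join1[OF _ that(2) nrm(2)[OF that(1)]] coset_join2[OF that(2) nrm(2)[OF that(1)]] by metis
  have em: "e N (x \<otimes> y) = e N (x' \<otimes> y')" 
    if "N \<in> ?\<N>" "x \<in> carrier P" "y \<in> carrier P" "x' \<in> carrier P" "y' \<in> carrier P" 
      "e N x = e N x'" "e N y = e N y'" for N x y x' y'
    using that e[OF that(1)] normal.rcos_sum[OF nrm(1)[OF that(1)]] by (metis m_closed)
  define tbl where "tbl N = (\<lambda>(x, y). (e N x, e N y, e N (x \<otimes> y))) ` (carrier P \<times> carrier P)" for N
  have tblI: "(e N x, e N y, e N (x \<otimes> y)) \<in> tbl N" if "x \<in> carrier P" "y \<in> carrier P" for N x y
    unfolding tbl_def by (rule image_eqI[of _ _ "(x, y)"]) (use that in auto)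
  define code where "code N = (tbl N, (\<lambda>s. (s, e N s)) ` (S - N), e N \<one>)" for N
  have fin_e: "finite (e N ` carrier P)" if "N \<in> ?\<N>" for N
  proof -
    have "e N ` carrier P \<subseteq> to_nat_on (rcosets N) ` (rcosets N)"
      unfolding e_def using rcosetsI[OF subgroup.subset[OF nrm(2)[OF that]]] by blast
    then show ?thesis using fin[OF that] by (meson finite_imageI finite_subset)
  qed
  have "inj_on code ?\<N>"
  proof (rule inj_onI)
    fix M N assume M: "M \<in> ?\<N>" and N: "N \<in> ?\<N>" and eq: "code M = code N"
    have tbl: "tbl M = tbl N" and one: "e M \<one> = e N \<one>" 
      and gens: "(\<lambda>s. (s, e M s)) ` (S - M) = (\<lambda>s. (s, e N s)) ` (S - N)" using eq by (auto simp: code_def)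
    have mult: "e M (x \<otimes> y) = e N (x \<otimes> y)" 
      if c: "x \<in> carrier P" "y \<in> carrier P" and exy: "e M x = e N x" "e M y = e N y" for x y
    proof -
      have "(e M x, e M y, e M (x \<otimes> y)) \<in> tbl N" unfolding tbl[symmetric] by (rule tblI[OF c])
      then obtain x' y' where xy: "x' \<in> carrier P" "y' \<in> carrier P" "e M x = e N x'" "e M y = e N y'" 
        "e M (x \<otimes> y) = e N (x' \<otimes> y')" by (auto simp: tbl_def)
      then show ?thesis using em[OF N xy(1,2) c] exy by simp
    qed
    have gen_eq: "e M s = e N s" if s: "s \<in> S" for s
    proof (cases "s \<in> M")
      case True
      have "s \<in> N"
      proof (rule ccontr)
        assume "s \<notin> N"
        then have "(s, e N s) \<in> (\<lambda>s. (s, e M s)) ` (S - M)" unfolding gens using s by blast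
        then show False using True by auto
      qed
      then show ?thesis using True e1[OF M] e1[OF N] one s SP by (metis subsetD)
    next
      case False
      then have "(s, e M s) \<in> (\<lambda>s. (s, e N s)) ` (S - N)" unfolding gens[symmetric] using s by blast
      then show ?thesis by auto
    qed
    \<comment> \<open>In a group the inverse can be read off the multiplication table: it is the solution of \<open>x y = 1\<close>.\<close>
    have inv_eq: "e M (inv x) = e N (inv x)" if c: "x \<in> carrier P" and ex: "e M x = e N x" for x
    proof -
      have "(e M x, e M (inv x), e M (x \<otimes> inv x)) \<in> tbl N" unfolding tbl[symmetric] 
        by (rule tblI[OF c inv_closed[OF c]])
      then obtain x' y' where xy: "x' \<in> carrier P" "y' \<in> carrier P" "e M x = e N x'" "e M (inv x) = e N y'" 
        "e M (x \<otimes> inv x) = e N (x' \<otimes> y')" by (auto simp: tbl_def)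
      have "e N (inv x \<otimes> (x' \<otimes> y')) = e N (inv x \<otimes> \<one>)"
        by (rule em[OF N]) (use c xy one in auto)
      moreover have "e N (inv x \<otimes> (x' \<otimes> y')) = e N (inv x \<otimes> (x \<otimes> y'))"
        by (intro em[OF N]) (use c xy ex in auto)
      moreover have "inv x \<otimes> (x \<otimes> y') = y'" using c xy by (simp add: m_assoc[symmetric])
      ultimately show ?thesis using xy(4) c by simp
    qed
    have eH: "e M h = e N h" if "h \<in> generate P S" for h
      using that
    proof (induction rule: generate.induct)
      case (eng h1 h2)
      then show ?case using mult generate_in_carrier[OF SP] by blast
    qed (use one gen_eq inv_eq SP in auto)
    have "h \<in> M \<longleftrightarrow> h \<in> N" if h: "h \<in> generate P S" for h
      using eH[OF h] e1[OF M, of h] e1[OF N, of h] one generate_in_carrier[OF SP h] by simp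
    then have "M \<inter> generate P S = N \<inter> generate P S" by blast
    then show "M = N"
      using open_subgroup_eq_if_eq_on_dense[OF tg nrm(2,3)[OF M] nrm(2,3)[OF N]] gen
      unfolding top_generates_def by blast
  qed
  moreover have "code ` ?\<N> \<subseteq> {A. A \<subseteq> UNIV \<and> finite A} \<times> {A. A \<subseteq> S \<times> UNIV \<and> finite A} \<times> UNIV"
  proof
    fix c assume "c \<in> code ` ?\<N>"
    then obtain N where N: "N \<in> ?\<N>" "c = code N" by blast
    have "tbl N \<subseteq> e N ` carrier P \<times> e N ` carrier P \<times> e N ` carrier P" by (auto simp: tbl_def)
    then have "finite (tbl N)" using fin_e[OF N(1)] by (meson finite_SigmaI finite_subset)
    moreover have "S - N = S \<inter> (carrier P - N)" using SP by auto
    then have "finite (S - N)" using conv N(1) by (simp add: set_converges_to_1_def)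
    ultimately show "c \<in> {A. A \<subseteq> UNIV \<and> finite A} \<times> {A. A \<subseteq> S \<times> UNIV \<and> finite A} \<times> UNIV"
      unfolding N(2) code_def by auto
  qed
  moreover have "countable ({A :: (nat \<times> nat \<times> nat) set. A \<subseteq> UNIV \<and> finite A} \<times> 
      {A :: ('a \<times> nat) set. A \<subseteq> S \<times> UNIV \<and> finite A} \<times> (UNIV :: nat set))"
  proof (intro countable_SIGMA)
    show "countable {A :: (nat \<times> nat \<times> nat) set. A \<subseteq> UNIV \<and> finite A}" 
      using countable_Collect_finite_subset[of "UNIV :: (nat \<times> nat \<times> nat) set"] by (simp add: conj_commute)
    show "countable {A :: ('a \<times> nat) set. A \<subseteq> S \<times> UNIV \<and> finite A}"
      using countable_Collect_finite_subset[of "S \<times> (UNIV :: nat set)"] S by (simp add: conj_commute)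
  qed simp
  ultimately show ?thesis by (meson countable_image_inj_on countable_subset)
qed

lemma countable_base_free:
  assumes P: "free_profinite_on P S" and S: "countable S"
  shows "\<exists>N. countable_base_at_one P N"
proof -
  let ?\<N> = "{N. open_normal P N}"
  have pf: "profinite P" using P by (simp add: free_profinite_on_def)
  note tg = profiniteD(1)[OF pf]
  interpret group P using topological_groupD(1)[OF tg] .
  have "openin (topo P) (carrier P)" using openin_topspace topological_groupD(2)[OF tg] by metis
  from profinite_open_normal_base[OF pf this one_closed] have ne: "?\<N> \<noteq> {}" by blast
  have r: "range (from_nat_into ?\<N>) = ?\<N>" 
    by (rule range_from_nat_into[OF ne countable_open_normal_subgroups[OF P S]])
  have "open_normal P (from_nat_into ?\<N> n)" for n using from_nat_into[OF ne, of n] by simp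
  moreover have "\<exists>n. from_nat_into ?\<N> n \<subseteq> U" if U: "openin (topo P) U" "\<one>\<^bsub>P\<^esub> \<in> U" for U
  proof -
    obtain N where N: "N \<in> ?\<N>" "N \<subseteq> U" using profinite_open_normal_base[OF pf U] by blast
    then obtain n where "from_nat_into ?\<N> n = N" using r by (metis imageE)
    then show ?thesis using N by blast
  qed
  ultimately show ?thesis by (auto simp: countable_base_at_one_def)
qed

lemma countable_base_closed_subgroup:
  assumes P: "profinite P" "countable_base_at_one P N" and H: "subgroup H P"
  shows "countable_base_at_one (subgroup_of P H) (\<lambda>n. N n \<inter> H)"
proof -
  note tg = profiniteD(1)[OF P(1)]
  interpret group P using topological_groupD(1)[OF tg] .
  have HP: "H \<subseteq> carrier P" using H by (rule subgroup.subset)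
  have gH: "group (subgroup_of P H)"
    using subgroup.subgroup_is_group[OF H is_group] 
    unfolding group_def group_axioms_def monoid_def Units_def by simp
  have "open_normal (subgroup_of P H) (N n \<inter> H)" for n
  proof -
    have N: "N n \<lhd> P" "openin (topo P) (N n)" using P(2) by (auto simp: countable_base_at_one_def open_normal_def)
    interpret N: normal "N n" P by (rule N(1))
    have "N n \<inter> H \<lhd> subgroup_of P H"
    proof (rule group.normal_invI[OF gH])
      show "subgroup (N n \<inter> H) (subgroup_of P H)"
      proof (rule group.subgroupI[OF gH])
        show "N n \<inter> H \<noteq> {}" using N.one_closed subgroup.one_closed[OF H] by blast
        show "inv\<^bsub>subgroup_of P H\<^esub> a \<in> N n \<inter> H" if "a \<in> N n \<inter> H" for a
          using that subgroup_of_inv[OF is_group H] subgroup.m_inv_closed[OF H] by auto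
        show "a \<otimes>\<^bsub>subgroup_of P H\<^esub> b \<in> N n \<inter> H" if "a \<in> N n \<inter> H" "b \<in> N n \<inter> H" for a b
          using that subgroup.m_closed[OF H] by auto
      qed auto
      fix x h assume "x \<in> carrier (subgroup_of P H)" "h \<in> N n \<inter> H"
      then show "x \<otimes>\<^bsub>subgroup_of P H\<^esub> h \<otimes>\<^bsub>subgroup_of P H\<^esub> inv\<^bsub>subgroup_of P H\<^esub> x \<in> N n \<inter> H"
        using HP N.inv_op_closed2[of x h] subgroup_of_inv[OF is_group H] 
          subgroup.m_closed[OF H] subgroup.m_inv_closed[OF H] by auto
    qed
    then show ?thesis using N(2) by (auto simp: open_normal_def openin_subtopology)
  qed
  moreover have "\<exists>n. N n \<inter> H \<subseteq> U" if U: "openin (topo (subgroup_of P H)) U" "\<one>\<^bsub>subgroup_of P H\<^esub> \<in> U" for U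
  proof -
    obtain V where V: "openin (topo P) V" "U = V \<inter> H" using U(1) by (auto simp: openin_subtopology)
    then obtain n where "N n \<subseteq> V" using P(2) U(2) by (auto simp: countable_base_at_one_def)
    then show ?thesis using V(2) by blast
  qed
  ultimately show ?thesis by (simp add: countable_base_at_one_def)
qed

section \<open>Back and forth\<close>

definition topgroup_iso :: "'a topgroup \<Rightarrow> 'b topgroup \<Rightarrow> ('a \<Rightarrow> 'b) \<Rightarrow> bool" where
  "topgroup_iso P Q \<theta> \<longleftrightarrow> \<theta> \<in> iso P Q \<and> homeomorphic_map (topo P) (topo Q) \<theta>"

text \<open>
  By Goursat's lemma, an isomorphism \<open>P/D \<cong> Q/E\<close> between quotients by open normal subgroups is the
  same as a subgroup \<open>R\<close> of \<open>P \<times> Q\<close> that projects onto both factors and whose fibres \<open>D\<close> and \<open>E\<close> over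
  the identities are open: \<open>R\<close> consists of the pairs with corresponding cosets.  In this form a
  compatible isomorphism of larger quotients is a smaller subgroup, and limits are intersections.
\<close>

definition correspondence :: "'a topgroup \<Rightarrow> 'b topgroup \<Rightarrow> ('a \<times> 'b) set \<Rightarrow> bool" where
  "correspondence P Q R \<longleftrightarrow> subgroup R (P \<times>\<times> Q) \<and> Domain R = carrier P \<and> Range R = carrier Q \<and>
     openin (topo P) {p. (p, \<one>\<^bsub>Q\<^esub>) \<in> R} \<and> openin (topo Q) {q. (\<one>\<^bsub>P\<^esub>, q) \<in> R}"

lemma correspondence_converse:
  assumes P: "group P" and Q: "group Q" and R: "correspondence P Q R"
  shows "correspondence Q P (R\<inverse>)"
proof -
  interpret PQ: group "P \<times>\<times> Q" using P Q by (rule DirProd_group)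
  interpret QP: group "Q \<times>\<times> P" using Q P by (rule DirProd_group)
  have sR: "subgroup R (P \<times>\<times> Q)" using R by (simp add: correspondence_def)
  have "subgroup (R\<inverse>) (Q \<times>\<times> P)"
  proof (rule QP.subgroupI)
    show "R\<inverse> \<subseteq> carrier (Q \<times>\<times> P)" using subgroup.subset[OF sR] by auto
    show "R\<inverse> \<noteq> {}" using subgroup.one_closed[OF sR] by auto
    fix a assume a: "a \<in> R\<inverse>"
    then have c: "fst a \<in> carrier Q" "snd a \<in> carrier P" using subgroup.subset[OF sR] by auto
    show "inv\<^bsub>Q \<times>\<times> P\<^esub> a \<in> R\<inverse>"
      using subgroup.m_inv_closed[OF sR, of "(snd a, fst a)"] a c inv_DirProd[OF P Q c(2,1)] inv_DirProd[OF Q P c] 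
      by (cases a) auto
    fix b assume b: "b \<in> R\<inverse>"
    show "a \<otimes>\<^bsub>Q \<times>\<times> P\<^esub> b \<in> R\<inverse>"
      using subgroup.m_closed[OF sR, of "(snd a, fst a)" "(snd b, fst b)"] a b
      by (cases a; cases b) auto
  qed
  then show ?thesis using R by (simp add: correspondence_def)
qed

lemma correspondenceD:
  assumes P: "group P" and Q: "group Q" and R: "correspondence P Q R"
  shows "(a, b) \<in> R \<Longrightarrow> a \<in> carrier P \<and> b \<in> carrier Q"
    "(\<one>\<^bsub>P\<^esub>, \<one>\<^bsub>Q\<^esub>) \<in> R"
    "(a, b) \<in> R \<Longrightarrow> (c, d) \<in> R \<Longrightarrow> (a \<otimes>\<^bsub>P\<^esub> c, b \<otimes>\<^bsub>Q\<^esub> d) \<in> R"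
    "(a, b) \<in> R \<Longrightarrow> (inv\<^bsub>P\<^esub> a, inv\<^bsub>Q\<^esub> b) \<in> R"
    "a \<in> carrier P \<Longrightarrow> \<exists>b. (a, b) \<in> R" "b \<in> carrier Q \<Longrightarrow> \<exists>a. (a, b) \<in> R"
    "openin (topo P) {p. (p, \<one>\<^bsub>Q\<^esub>) \<in> R}" "openin (topo Q) {q. (\<one>\<^bsub>P\<^esub>, q) \<in> R}"
proof -
  have sR: "subgroup R (P \<times>\<times> Q)" using R by (simp add: correspondence_def)
  show c: "(a, b) \<in> R \<Longrightarrow> a \<in> carrier P \<and> b \<in> carrier Q" for a b using subgroup.subset[OF sR] by auto
  show "(\<one>\<^bsub>P\<^esub>, \<one>\<^bsub>Q\<^esub>) \<in> R" using subgroup.one_closed[OF sR] by simp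
  show "(a, b) \<in> R \<Longrightarrow> (c, d) \<in> R \<Longrightarrow> (a \<otimes>\<^bsub>P\<^esub> c, b \<otimes>\<^bsub>Q\<^esub> d) \<in> R"
    using subgroup.m_closed[OF sR, of "(a, b)" "(c, d)"] by simp
  show "(a, b) \<in> R \<Longrightarrow> (inv\<^bsub>P\<^esub> a, inv\<^bsub>Q\<^esub> b) \<in> R"
    using subgroup.m_inv_closed[OF sR, of "(a, b)"] c inv_DirProd[OF P Q] by metis
  show "a \<in> carrier P \<Longrightarrow> \<exists>b. (a, b) \<in> R" "b \<in> carrier Q \<Longrightarrow> \<exists>a. (a, b) \<in> R"
    "openin (topo P) {p. (p, \<one>\<^bsub>Q\<^esub>) \<in> R}" "openin (topo Q) {q. (\<one>\<^bsub>P\<^esub>, q) \<in> R}"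
    using R by (auto simp: correspondence_def)
qed

lemma correspondence_fibre:
  assumes P: "group P" and Q: "group Q" and R: "correspondence P Q R" and pq: "(p, q) \<in> R"
  shows "{y. (p, y) \<in> R} = {y. (\<one>\<^bsub>P\<^esub>, y) \<in> R} #>\<^bsub>Q\<^esub> q"
proof -
  interpret P: group P by fact
  interpret Q: group Q by fact
  note D = correspondenceD[OF P Q R]
  have c: "p \<in> carrier P" "q \<in> carrier Q" using D(1)[OF pq] by auto
  show ?thesis
  proof (intro equalityI subsetI)
    fix y assume y: "y \<in> {y. (p, y) \<in> R}"
    then have yc: "y \<in> carrier Q" using D(1) by blast
    have "(p \<otimes>\<^bsub>P\<^esub> inv\<^bsub>P\<^esub> p, y \<otimes>\<^bsub>Q\<^esub> inv\<^bsub>Q\<^esub> q) \<in> R" using y by (intro D(3) D(4)) (auto simp: pq)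
    then have "y \<otimes>\<^bsub>Q\<^esub> inv\<^bsub>Q\<^esub> q \<in> {y. (\<one>\<^bsub>P\<^esub>, y) \<in> R}" using c by simp
    moreover have "y \<otimes>\<^bsub>Q\<^esub> inv\<^bsub>Q\<^esub> q \<otimes>\<^bsub>Q\<^esub> q = y" using c yc by (simp add: Q.m_assoc)
    ultimately show "y \<in> {y. (\<one>\<^bsub>P\<^esub>, y) \<in> R} #>\<^bsub>Q\<^esub> q" unfolding r_coset_def by force
  next
    fix y assume "y \<in> {y. (\<one>\<^bsub>P\<^esub>, y) \<in> R} #>\<^bsub>Q\<^esub> q"
    then obtain e where "(\<one>\<^bsub>P\<^esub>, e) \<in> R" "y = e \<otimes>\<^bsub>Q\<^esub> q" by (auto simp: r_coset_def)
    then show "y \<in> {y. (p, y) \<in> R}" using D(3)[OF _ pq] c by fastforce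
  qed
qed

lemma correspondence_kernel_normal:
  assumes P: "group P" and Q: "group Q" and R: "correspondence P Q R"
  shows "open_normal Q {q. (\<one>\<^bsub>P\<^esub>, q) \<in> R}"
proof -
  interpret P: group P by fact
  interpret Q: group Q by fact
  note D = correspondenceD[OF P Q R]
  have "{q. (\<one>\<^bsub>P\<^esub>, q) \<in> R} \<lhd> Q"
  proof (rule Q.normal_invI)
    show "subgroup {q. (\<one>\<^bsub>P\<^esub>, q) \<in> R} Q"
    proof (rule Q.subgroupI)
      show "{q. (\<one>\<^bsub>P\<^esub>, q) \<in> R} \<subseteq> carrier Q" using D(1) by blast
      show "{q. (\<one>\<^bsub>P\<^esub>, q) \<in> R} \<noteq> {}" using D(2) by blast
      show "inv\<^bsub>Q\<^esub> a \<in> {q. (\<one>\<^bsub>P\<^esub>, q) \<in> R}" if "a \<in> {q. (\<one>\<^bsub>P\<^esub>, q) \<in> R}" for a using D(4)[of "\<one>\<^bsub>P\<^esub>" a] that by simp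
      show "a \<otimes>\<^bsub>Q\<^esub> b \<in> {q. (\<one>\<^bsub>P\<^esub>, q) \<in> R}" if "a \<in> {q. (\<one>\<^bsub>P\<^esub>, q) \<in> R}" "b \<in> {q. (\<one>\<^bsub>P\<^esub>, q) \<in> R}" for a b
        using D(3)[of "\<one>\<^bsub>P\<^esub>" a "\<one>\<^bsub>P\<^esub>" b] that by simp
    qed
    fix x h assume x: "x \<in> carrier Q" and h: "h \<in> {q. (\<one>\<^bsub>P\<^esub>, q) \<in> R}"
    obtain p where p: "(p, x) \<in> R" using D(6)[OF x] by blast
    have "(p \<otimes>\<^bsub>P\<^esub> \<one>\<^bsub>P\<^esub> \<otimes>\<^bsub>P\<^esub> inv\<^bsub>P\<^esub> p, x \<otimes>\<^bsub>Q\<^esub> h \<otimes>\<^bsub>Q\<^esub> inv\<^bsub>Q\<^esub> x) \<in> R" 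
      using p h by (intro D(3) D(4)) auto
    then show "x \<otimes>\<^bsub>Q\<^esub> h \<otimes>\<^bsub>Q\<^esub> inv\<^bsub>Q\<^esub> x \<in> {q. (\<one>\<^bsub>P\<^esub>, q) \<in> R}" using D(1)[OF p] by simp
  qed
  then show ?thesis using D(8) by (simp add: open_normal_def)
qed

text \<open>
  The isomorphism \<open>P/D \<cong> Q/E\<close> encoded by \<open>R\<close> and the projection \<open>Q/(E \<inter> N) \<rightarrow> Q/E\<close> form an embedding
  problem for \<open>P\<close>.  A solution \<open>\<psi> : P \<rightarrow> Q/(E \<inter> N)\<close> induces an isomorphism of \<open>P/ker \<psi>\<close> with
  \<open>Q/(E \<inter> N)\<close>, which is the refinement \<open>R'\<close>.
\<close>

lemma correspondence_refine:
  fixes P :: "'a topgroup" and Q :: "'b topgroup"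
  assumes P: "profinite P" and Q: "profinite Q" and emb: "solves_finite_embedding_problems TYPE('b set) P"
    and R: "correspondence P Q R" and N: "open_normal Q N"
  shows "\<exists>R'\<subseteq>R. correspondence P Q R' \<and> {q. (\<one>\<^bsub>P\<^esub>, q) \<in> R'} \<subseteq> N"
proof -
  note tP = profiniteD(1)[OF P] and tQ = profiniteD(1)[OF Q]
  have gP: "group P" and gQ: "group Q" using tP tQ by (auto dest: topological_groupD(1))
  interpret P: group P by fact
  interpret Q: group Q by fact
  note D = correspondenceD[OF gP gQ R]
  define E where "E = {q. (\<one>\<^bsub>P\<^esub>, q) \<in> R}"
  have E: "open_normal Q E" unfolding E_def by (rule correspondence_kernel_normal[OF gP gQ R])
  define M where "M = E \<inter> N"
  interpret E: normal E Q using E by (simp add: open_normal_def)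
  interpret N: normal N Q using N by (simp add: open_normal_def)
  have sM: "subgroup M Q" unfolding M_def by (rule Q.subgroups_Inter_pair[OF E.is_subgroup N.is_subgroup])
  have "M \<lhd> Q"
    by (rule Q.normal_invI[OF sM]) (auto simp: M_def E.inv_op_closed2 N.inv_op_closed2)
  then interpret M: normal M Q .
  have oM: "openin (topo Q) M" using E N by (auto simp: M_def open_normal_def)
  let ?A = "Q Mod E" and ?B = "Q Mod M"
  have fB: "finite (carrier ?B)"
    using finite_rcosets_open[OF tQ profiniteD(2)[OF Q] sM oM] by (simp add: FactGroup_def)
  have ME: "E <#>\<^bsub>Q\<^esub> (M #>\<^bsub>Q\<^esub> q) = E #>\<^bsub>Q\<^esub> q" if q: "q \<in> carrier Q" for q
  proof -
    have "E <#>\<^bsub>Q\<^esub> M = E"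
    proof
      show "E <#>\<^bsub>Q\<^esub> M \<subseteq> E" by (auto simp: set_mult_def M_def)
      show "E \<subseteq> E <#>\<^bsub>Q\<^esub> M"
      proof
        fix x assume x: "x \<in> E"
        then have "x \<otimes>\<^bsub>Q\<^esub> \<one>\<^bsub>Q\<^esub> \<in> E <#>\<^bsub>Q\<^esub> M" using subgroup.one_closed[OF sM] unfolding set_mult_def by blast
        then show "x \<in> E <#>\<^bsub>Q\<^esub> M" using x E.subset by (metis Q.r_one subsetD)
      qed
    qed
    then show ?thesis using Q.setmult_rcos_assoc[OF E.subset M.subset q] by simp
  qed
  have \<alpha>: "(\<lambda>X. E <#>\<^bsub>Q\<^esub> X) \<in> hom ?B ?A"
  proof -
    have "E <#>\<^bsub>Q\<^esub> X \<in> carrier ?A" if "X \<in> carrier ?B" for X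
      using that ME by (auto simp: carrier_FactGroup)
    moreover have "E <#>\<^bsub>Q\<^esub> (X <#>\<^bsub>Q\<^esub> Y) = (E <#>\<^bsub>Q\<^esub> X) <#>\<^bsub>Q\<^esub> (E <#>\<^bsub>Q\<^esub> Y)" 
      if "X \<in> carrier ?B" "Y \<in> carrier ?B" for X Y
      using that by (auto simp: carrier_FactGroup M.rcos_sum E.rcos_sum ME)
    ultimately show ?thesis by (auto simp: hom_def)
  qed
  have \<alpha>s: "(\<lambda>X. E <#>\<^bsub>Q\<^esub> X) ` carrier ?B = carrier ?A"
    unfolding carrier_FactGroup image_image using ME by (intro image_cong) auto
  \<comment> \<open>The fibre of \<open>R\<close> over \<open>p\<close> is a coset of \<open>E\<close>.\<close>
  define \<phi> where "\<phi> p = {q. (p, q) \<in> R}" for p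
  have \<phi>: "\<phi> p = E #>\<^bsub>Q\<^esub> q" if "(p, q) \<in> R" for p q
    unfolding \<phi>_def E_def by (rule correspondence_fibre[OF gP gQ R that])
  have \<phi>h: "\<phi> \<in> hom P ?A"
    unfolding hom_def
  proof (intro CollectI conjI Pi_I ballI)
    fix p assume "p \<in> carrier P"
    then obtain q where q: "(p, q) \<in> R" using D(5) by blast
    then show "\<phi> p \<in> carrier ?A" using \<phi> D(1) by (auto simp: carrier_FactGroup)
    fix p' assume "p' \<in> carrier P"
    then obtain q' where q': "(p', q') \<in> R" using D(5) by blast
    show "\<phi> (p \<otimes>\<^bsub>P\<^esub> p') = \<phi> p \<otimes>\<^bsub>?A\<^esub> \<phi> p'"
      using \<phi>[OF D(3)[OF q q']] \<phi>[OF q] \<phi>[OF q'] D(1)[OF q] D(1)[OF q'] by (simp add: E.rcos_sum)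
  qed
  have "kernel P ?A \<phi> = {p. (p, \<one>\<^bsub>Q\<^esub>) \<in> R}"
  proof (intro equalityI subsetI)
    fix p assume "p \<in> kernel P ?A \<phi>"
    then have "\<phi> p = E" by (simp add: kernel_def)
    then have "\<one>\<^bsub>Q\<^esub> \<in> \<phi> p" using E.one_closed by simp
    then show "p \<in> {p. (p, \<one>\<^bsub>Q\<^esub>) \<in> R}" by (simp add: \<phi>_def)
  next
    fix p assume p: "p \<in> {p. (p, \<one>\<^bsub>Q\<^esub>) \<in> R}"
    then have "\<phi> p = E" using \<phi>[of p "\<one>\<^bsub>Q\<^esub>"] E.subset by (simp add: Q.coset_mult_one)
    then show "p \<in> kernel P ?A \<phi>" using p D(1) by (auto simp: kernel_def)
  qed
  then have ok: "open_kernel_hom P ?A \<phi>" using \<phi>h D(7) by (simp add: open_kernel_hom_def)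
  have "\<phi> ` carrier P = carrier ?A"
  proof
    show "\<phi> ` carrier P \<subseteq> carrier ?A" using \<phi>h by (auto simp: hom_def)
    show "carrier ?A \<subseteq> \<phi> ` carrier P"
    proof
      fix X assume "X \<in> carrier ?A"
      then obtain q where q: "q \<in> carrier Q" "X = E #>\<^bsub>Q\<^esub> q" by (auto simp: carrier_FactGroup)
      then obtain p where "(p, q) \<in> R" using D(6) by blast
      then show "X \<in> \<phi> ` carrier P" using \<phi> D(1) q by blast
    qed
  qed
  then obtain \<psi> where \<psi>: "open_kernel_hom P ?B \<psi>" "\<psi> ` carrier P = carrier ?B" 
    "\<forall>p\<in>carrier P. E <#>\<^bsub>Q\<^esub> \<psi> p = \<phi> p"
    using emb E.factorgroup_is_group M.factorgroup_is_group fB \<alpha> \<alpha>s ok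
    unfolding solves_finite_embedding_problems_def by metis
  interpret \<psi>: group_hom P ?B \<psi>
    using \<psi>(1) gP M.factorgroup_is_group by (simp add: open_kernel_hom_def group_hom_def group_hom_axioms_def)
  define R' where "R' = {(p, q). p \<in> carrier P \<and> q \<in> carrier Q \<and> \<psi> p = M #>\<^bsub>Q\<^esub> q}"
  interpret PQ: group "P \<times>\<times> Q" using gP gQ by (rule DirProd_group)
  have sub: "subgroup R' (P \<times>\<times> Q)"
  proof (rule PQ.subgroupI)
    show "R' \<subseteq> carrier (P \<times>\<times> Q)" by (auto simp: R'_def)
    have "(\<one>\<^bsub>P\<^esub>, \<one>\<^bsub>Q\<^esub>) \<in> R'" using \<psi>.hom_one by (simp add: R'_def Q.coset_mult_one M.subset)
    then show "R' \<noteq> {}" by blast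
    fix a assume a: "a \<in> R'"
    have "\<psi> (inv\<^bsub>P\<^esub> p) = M #>\<^bsub>Q\<^esub> inv\<^bsub>Q\<^esub> q" if "p \<in> carrier P" "q \<in> carrier Q" "\<psi> p = M #>\<^bsub>Q\<^esub> q" for p q
      using that M.inv_FactGroup[of "M #>\<^bsub>Q\<^esub> q"] M.rcos_inv[of q] by (simp add: carrier_FactGroup)
    then show "inv\<^bsub>P \<times>\<times> Q\<^esub> a \<in> R'" using a by (auto simp: R'_def inv_DirProd[OF gP gQ])
    fix b assume "b \<in> R'"
    then show "a \<otimes>\<^bsub>P \<times>\<times> Q\<^esub> b \<in> R'" using a by (auto simp: R'_def M.rcos_sum)
  qed
  have one: "{q. (\<one>\<^bsub>P\<^esub>, q) \<in> R'} = M"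
  proof -
    have "M = M #>\<^bsub>Q\<^esub> q \<longleftrightarrow> q \<in> M" if "q \<in> carrier Q" for q
      using Q.coset_join1[OF _ that sM] Q.coset_join2[OF that sM] by metis
    then show ?thesis using \<psi>.hom_one M.subset by (auto simp: R'_def)
  qed
  have ker: "{p. (p, \<one>\<^bsub>Q\<^esub>) \<in> R'} = kernel P ?B \<psi>"
    by (auto simp: R'_def kernel_def Q.coset_mult_one M.subset)
  have "correspondence P Q R'"
    unfolding correspondence_def
  proof (intro conjI sub)
    show "Domain R' = carrier P"
    proof
      show "carrier P \<subseteq> Domain R'"
      proof
        fix p assume p: "p \<in> carrier P"
        then obtain q where "q \<in> carrier Q" "\<psi> p = M #>\<^bsub>Q\<^esub> q" 
          using \<psi>.hom_closed[OF p] by (auto simp: carrier_FactGroup)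
        then show "p \<in> Domain R'" using p by (auto simp: R'_def)
      qed
    qed (auto simp: R'_def)
    show "Range R' = carrier Q"
    proof
      show "carrier Q \<subseteq> Range R'"
      proof
        fix q assume q: "q \<in> carrier Q"
        then have "M #>\<^bsub>Q\<^esub> q \<in> \<psi> ` carrier P" by (auto simp: \<psi>(2) carrier_FactGroup)
        then show "q \<in> Range R'" using q by (force simp: R'_def)
      qed
    qed (auto simp: R'_def)
    show "openin (topo P) {p. (p, \<one>\<^bsub>Q\<^esub>) \<in> R'}" using \<psi>(1) by (simp add: ker open_kernel_hom_def)
    show "openin (topo Q) {q. (\<one>\<^bsub>P\<^esub>, q) \<in> R'}" using oM by (simp add: one)
  qed
  moreover have "R' \<subseteq> R"
  proof clarify
    fix p q assume "(p, q) \<in> R'"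
    then have pq: "p \<in> carrier P" "q \<in> carrier Q" "\<psi> p = M #>\<^bsub>Q\<^esub> q" by (auto simp: R'_def)
    then have "\<phi> p = E #>\<^bsub>Q\<^esub> q" using \<psi>(3) ME by metis
    then have "q \<in> \<phi> p" using Q.rcos_self[OF pq(2) E.is_subgroup] by simp
    then show "(p, q) \<in> R" by (simp add: \<phi>_def)
  qed
  ultimately show ?thesis using one by (auto simp: M_def)
qed

text \<open>
  The fibres over \<open>p\<close> are cosets of open subgroups, hence closed, and decrease; by compactness they
  have a common element.  It is unique because the fibres over \<open>1\<close> shrink to \<open>1\<close>.
\<close>

lemma correspondence_limit:
  fixes P :: "'a topgroup" and Q :: "'b topgroup" and R :: "nat \<Rightarrow> ('a \<times> 'b) set"
  assumes P: "topological_group P" and Q: "profinite Q" 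
    and R: "\<And>n. correspondence P Q (R n)" "\<And>n. R (Suc n) \<subseteq> R n" 
    and M: "countable_base_at_one Q M" "\<And>n. {q. (\<one>\<^bsub>P\<^esub>, q) \<in> R (Suc n)} \<subseteq> M n"
  shows "p \<in> carrier P \<Longrightarrow> \<exists>q. \<forall>n. (p, q) \<in> R n"
    "\<lbrakk>\<And>n. (p, q) \<in> R n; \<And>n. (p, q') \<in> R n\<rbrakk> \<Longrightarrow> q = q'"
proof -
  note tQ = profiniteD(1)[OF Q]
  have gP: "group P" and gQ: "group Q" using P tQ by (auto dest: topological_groupD(1))
  interpret P: group P by fact
  interpret Q: group Q by fact
  note D = correspondenceD[OF gP gQ R(1)]
  {
    assume p: "p \<in> carrier P"
    have "closedin (topo Q) {q. (p, q) \<in> R n}" for n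
    proof -
      obtain q where q: "(p, q) \<in> R n" using D(5)[OF p] by blast
      have "open_normal Q {q. (\<one>\<^bsub>P\<^esub>, q) \<in> R n}" by (rule correspondence_kernel_normal[OF gP gQ R(1)])
      then have "closedin (topo Q) ({q. (\<one>\<^bsub>P\<^esub>, q) \<in> R n} #>\<^bsub>Q\<^esub> q)"
        using D(1)[OF q] by (intro closed_rcoset[OF tQ]) (auto simp: open_normal_def normal_def)
      then show ?thesis using correspondence_fibre[OF gP gQ R(1) q] by simp
    qed
    moreover have "{q. (p, q) \<in> R n} \<noteq> {}" for n using D(5)[OF p] by auto
    moreover have "decseq (\<lambda>n. {q. (p, q) \<in> R n})" using R(2) by (intro decseq_SucI) auto
    ultimately have "(\<Inter>n. {q. (p, q) \<in> R n}) \<noteq> {}"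
      by (intro compact_space_imp_nest[OF profiniteD(2)[OF Q]])
    then show "\<exists>q. \<forall>n. (p, q) \<in> R n" by auto
  next
    assume q: "\<And>n. (p, q) \<in> R n" "\<And>n. (p, q') \<in> R n"
    have c: "p \<in> carrier P" "q \<in> carrier Q" "q' \<in> carrier Q" using D(1)[OF q(1)] D(1)[OF q(2)] by auto
    let ?x = "q \<otimes>\<^bsub>Q\<^esub> inv\<^bsub>Q\<^esub> q'"
    have x: "(\<one>\<^bsub>P\<^esub>, ?x) \<in> R n" for n using D(3)[OF q(1) D(4)[OF q(2)], of n] c by simp
    have "?x = \<one>\<^bsub>Q\<^esub>"
    proof (rule ccontr)
      assume "?x \<noteq> \<one>\<^bsub>Q\<^esub>"
      moreover have ts: "topspace (topo Q) = carrier Q" by (rule topological_groupD(2)[OF tQ])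
      ultimately obtain U V where "openin (topo Q) U" "\<one>\<^bsub>Q\<^esub> \<in> U" "?x \<in> V" "disjnt U V"
        using profiniteD(3)[OF Q] c unfolding Hausdorff_space_def by (metis Q.inv_closed Q.m_closed Q.one_closed)
      then obtain n where "M n \<subseteq> U" using M(1) unfolding countable_base_at_one_def by blast
      then show False using x[of "Suc n"] M(2)[of n] \<open>?x \<in> V\<close> \<open>disjnt U V\<close> by (auto simp: disjnt_def)
    qed
    then have "q \<otimes>\<^bsub>Q\<^esub> inv\<^bsub>Q\<^esub> q' \<otimes>\<^bsub>Q\<^esub> q' = q'" using c by simp
    then show "q = q'" using c by (simp add: Q.m_assoc)
  }
qed

lemma hom_continuous_if_open_preimages:
  assumes P: "topological_group P" and Q: "topological_group Q" and \<theta>: "\<theta> \<in> hom P Q"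
    and op: "\<And>U. openin (topo Q) U \<Longrightarrow> \<one>\<^bsub>Q\<^esub> \<in> U \<Longrightarrow> \<exists>V. openin (topo P) V \<and> \<one>\<^bsub>P\<^esub> \<in> V \<and> \<theta> ` V \<subseteq> U"
  shows "continuous_map (topo P) (topo Q) \<theta>"
proof -
  note tsP = topological_groupD(2)[OF P] and tsQ = topological_groupD(2)[OF Q]
  interpret P: group P using topological_groupD(1)[OF P] .
  interpret Q: group Q using topological_groupD(1)[OF Q] .
  interpret \<theta>: group_hom P Q \<theta> using \<theta> by unfold_locales
  have "openin (topo P) {x \<in> carrier P. \<theta> x \<in> U}" if U: "openin (topo Q) U" for U
  proof (subst openin_subopen, intro ballI)
    fix x assume x: "x \<in> {x \<in> carrier P. \<theta> x \<in> U}"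
    then have xc: "x \<in> carrier P" by simp
    have "openin (topo Q) {y \<in> carrier Q. \<theta> x \<otimes>\<^bsub>Q\<^esub> y \<in> U}" using U xc by (intro open_translation(1)[OF Q]) auto
    moreover have "\<one>\<^bsub>Q\<^esub> \<in> {y \<in> carrier Q. \<theta> x \<otimes>\<^bsub>Q\<^esub> y \<in> U}" using x by simp
    ultimately obtain V where V: "openin (topo P) V" "\<one>\<^bsub>P\<^esub> \<in> V" 
      "\<theta> ` V \<subseteq> {y \<in> carrier Q. \<theta> x \<otimes>\<^bsub>Q\<^esub> y \<in> U}" using op by blast
    let ?T = "{y \<in> carrier P. inv\<^bsub>P\<^esub> x \<otimes>\<^bsub>P\<^esub> y \<in> V}"
    have "openin (topo P) ?T" using V xc by (intro open_translation(1)[OF P]) auto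
    moreover have "x \<in> ?T" using V xc by simp
    moreover have "?T \<subseteq> {x \<in> carrier P. \<theta> x \<in> U}"
    proof clarify
      fix y assume y: "y \<in> carrier P" "inv\<^bsub>P\<^esub> x \<otimes>\<^bsub>P\<^esub> y \<in> V"
      then have "\<theta> x \<otimes>\<^bsub>Q\<^esub> \<theta> (inv\<^bsub>P\<^esub> x \<otimes>\<^bsub>P\<^esub> y) \<in> U" using V(3) by blast
      moreover have "\<theta> x \<otimes>\<^bsub>Q\<^esub> \<theta> (inv\<^bsub>P\<^esub> x \<otimes>\<^bsub>P\<^esub> y) = \<theta> (x \<otimes>\<^bsub>P\<^esub> (inv\<^bsub>P\<^esub> x \<otimes>\<^bsub>P\<^esub> y))" using xc y by simp
      moreover have "x \<otimes>\<^bsub>P\<^esub> (inv\<^bsub>P\<^esub> x \<otimes>\<^bsub>P\<^esub> y) = y" using xc y by (simp add: P.m_assoc[symmetric])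
      ultimately show "\<theta> y \<in> U" by metis
    qed
    ultimately show "\<exists>T. openin (topo P) T \<and> x \<in> T \<and> T \<subseteq> {x \<in> carrier P. \<theta> x \<in> U}" by blast
  qed
  then show ?thesis by (auto simp: continuous_map_def tsP tsQ)
qed

text \<open>
  Starting with the isomorphism of trivial quotients, each step solves one embedding problem for \<open>P\<close>,
  to make the fibre in \<open>Q\<close> small, and one for \<open>Q\<close>, to make the fibre in \<open>P\<close> small.  The intersection
  of the resulting correspondences is the graph of an isomorphism.
\<close>

theorem isomorphic_if_embedding_problems_solvable:
  fixes P :: "'a topgroup" and Q :: "'b topgroup"
  assumes P: "profinite P" "countable_base_at_one P N" "solves_finite_embedding_problems TYPE('b set) P" 
    and Q: "profinite Q" "countable_base_at_one Q M" "solves_finite_embedding_problems TYPE('a set) Q"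
  shows "\<exists>\<theta>. topgroup_iso P Q \<theta>"
proof -
  note tP = profiniteD(1)[OF P(1)] and tQ = profiniteD(1)[OF Q(1)]
  note tsP = topological_groupD(2)[OF tP] and tsQ = topological_groupD(2)[OF tQ]
  have gP: "group P" and gQ: "group Q" using tP tQ by (auto dest: topological_groupD(1))
  interpret P: group P by fact
  interpret Q: group Q by fact
  have step: "\<exists>R'. correspondence P Q R' \<and> R' \<subseteq> R \<and> {q. (\<one>\<^bsub>P\<^esub>, q) \<in> R'} \<subseteq> M n \<and> {p. (p, \<one>\<^bsub>Q\<^esub>) \<in> R'} \<subseteq> N n"
    if R: "correspondence P Q R" for R n
  proof -
    have "open_normal Q (M n)" "open_normal P (N n)" using P(2) Q(2) by (auto simp: countable_base_at_one_def)
    then obtain R1 where R1: "R1 \<subseteq> R" "correspondence P Q R1" "{q. (\<one>\<^bsub>P\<^esub>, q) \<in> R1} \<subseteq> M n"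
      using correspondence_refine[OF P(1) Q(1) P(3) R] by blast
    obtain R2 where R2: "R2 \<subseteq> R1\<inverse>" "correspondence Q P R2" "{p. (\<one>\<^bsub>Q\<^esub>, p) \<in> R2} \<subseteq> N n"
      using correspondence_refine[OF Q(1) P(1) Q(3) correspondence_converse[OF gP gQ R1(2)] \<open>open_normal P (N n)\<close>] by blast
    have "correspondence P Q (R2\<inverse>)" by (rule correspondence_converse[OF gQ gP R2(2)])
    then show ?thesis using R1 R2 by (intro exI[of _ "R2\<inverse>"]) auto
  qed
  have full: "correspondence P Q (carrier P \<times> carrier Q)"
  proof -
    have "subgroup (carrier P \<times> carrier Q) (P \<times>\<times> Q)"
      using group.subgroup_self[OF DirProd_group[OF gP gQ]] by simp
    moreover have "openin (topo P) (carrier P)" "openin (topo Q) (carrier Q)" using openin_topspace tsP tsQ by metis+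
    ultimately show ?thesis using P.one_closed Q.one_closed by (auto simp: correspondence_def)
  qed
  have "\<exists>R. \<forall>n. correspondence P Q (R n) \<and> (R (Suc n) \<subseteq> R n \<and> {q. (\<one>\<^bsub>P\<^esub>, q) \<in> R (Suc n)} \<subseteq> M n \<and> 
      {p. (p, \<one>\<^bsub>Q\<^esub>) \<in> R (Suc n)} \<subseteq> N n)"
    by (rule dependent_nat_choice[where P = "\<lambda>n. correspondence P Q"]) (use full step in blast)+
  then obtain R where R: "\<And>n. correspondence P Q (R n)" "\<And>n. R (Suc n) \<subseteq> R n" 
    "\<And>n. {q. (\<one>\<^bsub>P\<^esub>, q) \<in> R (Suc n)} \<subseteq> M n" "\<And>n. {p. (p, \<one>\<^bsub>Q\<^esub>) \<in> R (Suc n)} \<subseteq> N n" by blast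
  have Rc: "correspondence Q P ((R n)\<inverse>)" "(R (Suc n))\<inverse> \<subseteq> (R n)\<inverse>" "{p. (\<one>\<^bsub>Q\<^esub>, p) \<in> (R (Suc n))\<inverse>} \<subseteq> N n" for n
    using correspondence_converse[OF gP gQ R(1)] R(2,4) by auto
  note lim = correspondence_limit[OF tP Q(1) R(1,2) Q(2) R(3)]
  note lim' = correspondence_limit[OF tQ P(1) Rc(1,2) P(2) Rc(3), unfolded converse_iff]
  note D = correspondenceD[OF gP gQ R(1)]
  define \<theta> where "\<theta> p = (SOME q. \<forall>n. (p, q) \<in> R n)" for p
  have \<theta>: "(p, \<theta> p) \<in> R n" if "p \<in> carrier P" for p n
    unfolding \<theta>_def using someI_ex[OF lim(1)[OF that]] by blast
  have \<theta>c: "\<theta> p \<in> carrier Q" if "p \<in> carrier P" for p using D(1)[OF \<theta>[OF that]] by simp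
  have hom: "\<theta> \<in> hom P Q"
    unfolding hom_def
  proof (intro CollectI conjI Pi_I ballI)
    fix p q assume p: "p \<in> carrier P" and q: "q \<in> carrier P"
    show "\<theta> (p \<otimes>\<^bsub>P\<^esub> q) = \<theta> p \<otimes>\<^bsub>Q\<^esub> \<theta> q"
      by (rule lim(2)[OF \<theta> D(3)[OF \<theta> \<theta>]]) (use p q in auto)
  qed (rule \<theta>c)
  have bij: "bij_betw \<theta> (carrier P) (carrier Q)"
    unfolding bij_betw_def
  proof
    show "inj_on \<theta> (carrier P)"
    proof (rule inj_onI)
      fix p p' assume p: "p \<in> carrier P" "p' \<in> carrier P" "\<theta> p = \<theta> p'"
      show "p = p'" by (rule lim'(2)[OF \<theta>[OF p(1)] \<theta>[OF p(2), folded p(3)]])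
    qed
    have "q \<in> \<theta> ` carrier P" if q: "q \<in> carrier Q" for q
    proof -
      obtain p where p: "\<forall>n. (p, q) \<in> R n" using lim'(1)[OF q] by blast
      then have pc: "p \<in> carrier P" using D(1) by blast
      have "\<theta> p = q" by (rule lim(2)[OF \<theta>[OF pc]]) (use p in blast)
      then show ?thesis using pc by blast
    qed
    then show "\<theta> ` carrier P = carrier Q" using \<theta>c by blast
  qed
  have cont: "continuous_map (topo P) (topo Q) \<theta>"
  proof (rule hom_continuous_if_open_preimages[OF tP tQ hom])
    fix U assume U: "openin (topo Q) U" "\<one>\<^bsub>Q\<^esub> \<in> U"
    then obtain n where n: "M n \<subseteq> U" using Q(2) by (auto simp: countable_base_at_one_def)
    have "\<theta> p \<in> U" if p: "(p, \<one>\<^bsub>Q\<^esub>) \<in> R (Suc n)" for p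
    proof -
      have c: "p \<in> carrier P" using D(1)[OF p] by simp
      have "(inv\<^bsub>P\<^esub> p \<otimes>\<^bsub>P\<^esub> p, inv\<^bsub>Q\<^esub> \<one>\<^bsub>Q\<^esub> \<otimes>\<^bsub>Q\<^esub> \<theta> p) \<in> R (Suc n)" by (intro D(3) D(4) p \<theta> c)
      then have "(\<one>\<^bsub>P\<^esub>, \<theta> p) \<in> R (Suc n)" using c \<theta>c[OF c] by simp
      then show ?thesis using R(3)[of n] n by blast
    qed
    then show "\<exists>V. openin (topo P) V \<and> \<one>\<^bsub>P\<^esub> \<in> V \<and> \<theta> ` V \<subseteq> U"
      using D(7)[of "Suc n"] D(2)[of "Suc n"] by (intro exI[of _ "{p. (p, \<one>\<^bsub>Q\<^esub>) \<in> R (Suc n)}"]) auto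
  qed
  have "homeomorphic_map (topo P) (topo Q) \<theta>"
    by (rule continuous_imp_homeomorphic_map[OF cont profiniteD(2)[OF P(1)] profiniteD(3)[OF Q(1)]])
      (use bij tsP tsQ in \<open>auto simp: bij_betw_def\<close>)
  then show ?thesis using hom bij by (auto simp: topgroup_iso_def iso_def)
qed

section \<open>Invariance under isomorphism\<close>

text \<open>
  The form in which isomorphisms are used: a pair of mutually inverse continuous homomorphisms.
\<close>

lemma topgroup_iso_inverse:
  assumes P: "topological_group P" and Q: "topspace (topo Q) = carrier Q" and \<theta>: "topgroup_iso P Q \<theta>"
  obtains \<eta> where "continuous_hom P Q \<theta>" "continuous_hom Q P \<eta>" "\<And>x. x \<in> carrier P \<Longrightarrow> \<eta> (\<theta> x) = x"
    "\<And>y. y \<in> carrier Q \<Longrightarrow> \<theta> (\<eta> y) = y"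
proof -
  note tsP = topological_groupD(2)[OF P]
  interpret group P using topological_groupD(1)[OF P] .
  have hom: "\<theta> \<in> hom P Q" and "homeomorphic_map (topo P) (topo Q) \<theta>" using \<theta> by (auto simp: topgroup_iso_def iso_def)
  then obtain \<eta> where "homeomorphic_maps (topo P) (topo Q) \<theta> \<eta>" using homeomorphic_map_maps by blast
  then have \<eta>: "continuous_map (topo P) (topo Q) \<theta>" "continuous_map (topo Q) (topo P) \<eta>" 
    "\<And>x. x \<in> carrier P \<Longrightarrow> \<eta> (\<theta> x) = x" "\<And>y. y \<in> carrier Q \<Longrightarrow> \<theta> (\<eta> y) = y"
    using tsP Q by (auto simp: homeomorphic_maps_def)
  have \<eta>c: "\<eta> y \<in> carrier P" if "y \<in> carrier Q" for y 
    using \<eta>(2) that tsP Q by (auto simp: continuous_map_def)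
  have "\<eta> \<in> hom Q P"
    unfolding hom_def
  proof (intro CollectI conjI Pi_I ballI)
    fix x y assume "x \<in> carrier Q" "y \<in> carrier Q"
    then have "\<theta> (\<eta> x \<otimes>\<^bsub>P\<^esub> \<eta> y) = x \<otimes>\<^bsub>Q\<^esub> y" using hom \<eta>c \<eta>(4) by (simp add: hom_def)
    then show "\<eta> (x \<otimes>\<^bsub>Q\<^esub> y) = \<eta> x \<otimes>\<^bsub>P\<^esub> \<eta> y" 
      using \<eta>(3)[of "\<eta> x \<otimes>\<^bsub>P\<^esub> \<eta> y"] \<eta>c \<open>x \<in> carrier Q\<close> \<open>y \<in> carrier Q\<close> by simp
  qed (rule \<eta>c)
  then show ?thesis using that[of \<eta>] \<eta> hom by (simp add: continuous_hom_def)
qed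

lemma profinite_iso:
  fixes P :: "'a topgroup" and Q :: "'b topgroup"
  assumes P: "profinite P" and Q: "group Q" "topspace (topo Q) = carrier Q" and \<theta>: "topgroup_iso P Q \<theta>"
  shows "profinite Q"
proof -
  note tP = profiniteD(1)[OF P]
  note tsP = topological_groupD(2)[OF tP]
  interpret P: group P using topological_groupD(1)[OF tP] .
  interpret Q: group Q by fact
  obtain \<eta> where h: "continuous_hom P Q \<theta>" "continuous_hom Q P \<eta>" "\<And>x. x \<in> carrier P \<Longrightarrow> \<eta> (\<theta> x) = x"
    "\<And>y. y \<in> carrier Q \<Longrightarrow> \<theta> (\<eta> y) = y" using topgroup_iso_inverse[OF tP Q(2) \<theta>] by metis
  interpret \<theta>: group_hom P Q \<theta> using h(1) by unfold_locales (simp add: continuous_hom_def)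
  interpret \<eta>: group_hom Q P \<eta> using h(2) by unfold_locales (simp add: continuous_hom_def)
  have c\<theta>: "continuous_map (topo P) (topo Q) \<theta>" and c\<eta>: "continuous_map (topo Q) (topo P) \<eta>"
    using h by (auto simp: continuous_hom_def)
  have "homeomorphic_map (topo P) (topo Q) \<theta>" using \<theta> by (simp add: topgroup_iso_def)
  then have hs: "topo P homeomorphic_space topo Q" by (rule homeomorphic_map_imp_homeomorphic_space)
  have "continuous_map (prod_topology (topo Q) (topo Q)) (topo P) (\<lambda>p. \<eta> (fst p) \<otimes>\<^bsub>P\<^esub> \<eta> (snd p))"
    using continuous_map_compose[OF continuous_map_fst c\<eta>] continuous_map_compose[OF continuous_map_snd c\<eta>]
    by (intro continuous_map_tg_mult[OF tP]) (auto simp: o_def)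
  from continuous_map_compose[OF this c\<theta>]
  have "continuous_map (prod_topology (topo Q) (topo Q)) (topo Q) (\<lambda>(x, y). x \<otimes>\<^bsub>Q\<^esub> y)"
    by (rule continuous_map_eq) (auto simp: Q(2) h(4))
  moreover have "continuous_map (topo Q) (topo Q) (\<lambda>x. inv\<^bsub>Q\<^esub> x)"
    by (rule continuous_map_eq[OF continuous_map_compose[OF continuous_map_compose[OF c\<eta> topological_groupD(4)[OF tP]] c\<theta>]])
      (auto simp: Q(2) h(4))
  ultimately have "topological_group Q" using Q by (simp add: topological_group_def)
  moreover have "totally_disconnected_space (topo Q)"
    unfolding totally_disconnected_space_def
  proof (intro ballI equalityI subsetI)
    fix y z assume y: "y \<in> topspace (topo Q)" and "z \<in> connected_component_of_set (topo Q) y"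
    then have "connected_component_of (topo P) (\<eta> y) (\<eta> z)" 
      using connected_component_of_continuous_image[OF c\<eta>] by simp
    moreover have "connected_component_of_set (topo P) (\<eta> y) = {\<eta> y}"
      using profiniteD(4)[OF P] y Q(2) tsP by (simp add: totally_disconnected_space_def)
    ultimately have "\<eta> z = \<eta> y" by blast
    moreover have "z \<in> carrier Q" 
      using \<open>z \<in> connected_component_of_set (topo Q) y\<close> connected_component_in_topspace Q(2) by fastforce
    ultimately show "z \<in> {y}" using h(4) y Q(2) by (metis singleton_iff)
  qed (auto simp: connected_component_of_refl)
  ultimately show ?thesis
    unfolding profinite_def using profiniteD[OF P] homeomorphic_compact_space[OF hs] 
      homeomorphic_Hausdorff_space[OF hs] by simp
qed

lemma open_normal_preimage:
  assumes P: "topological_group P" and Q: "group Q" and \<theta>: "continuous_hom P Q \<theta>" and N: "open_normal Q N"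
  shows "open_normal P {x \<in> carrier P. \<theta> x \<in> N}"
proof -
  interpret P: group P using topological_groupD(1)[OF P] .
  interpret Q: group Q by fact
  interpret \<theta>: group_hom P Q \<theta> using \<theta> by unfold_locales (simp add: continuous_hom_def)
  interpret N: normal N Q using N by (simp add: open_normal_def)
  have "{x \<in> carrier P. \<theta> x \<in> N} \<lhd> P"
  proof (rule P.normal_invI)
    show "subgroup {x \<in> carrier P. \<theta> x \<in> N} P" by (rule P.subgroupI) (auto intro: exI[of _ "\<one>\<^bsub>P\<^esub>"])
  qed (auto simp: N.inv_op_closed2)
  moreover have "openin (topo P) {x \<in> carrier P. \<theta> x \<in> N}"
    using openin_continuous_map_preimage[of "topo P" "topo Q" \<theta> N] \<theta> N topological_groupD(2)[OF P]
    by (auto simp: continuous_hom_def open_normal_def)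
  ultimately show ?thesis by (simp add: open_normal_def)
qed

lemma continuous_hom_comp:
  "continuous_hom P Q f \<Longrightarrow> continuous_hom Q R g \<Longrightarrow> continuous_hom P R (g \<circ> f)"
  by (auto simp: continuous_hom_def intro: Group.hom_compose continuous_map_compose)

lemma continuous_hom_cong:
  assumes P: "topological_group P" and f: "continuous_hom P Q f" and eq: "\<And>x. x \<in> carrier P \<Longrightarrow> g x = f x"
  shows "continuous_hom P Q g"
proof -
  interpret group P using topological_groupD(1)[OF P] .
  show ?thesis using f topological_groupD(2)[OF P]
    by (auto simp: continuous_hom_def hom_def Pi_iff eq intro: continuous_map_eq[of "topo P" "topo Q" f])
qed

text \<open>
  A map on \<open>\<theta> ` S\<close> is pulled back to \<open>S\<close>, extended to \<open>P\<close>, and the extension is transferred to \<open>Q\<close>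
  by the inverse of \<open>\<theta>\<close>.
\<close>

lemma free_profinite_on_iso:
  fixes P :: "'a topgroup" and Q :: "'b topgroup"
  assumes P: "free_profinite_on P S" and Q: "profinite Q" and \<theta>: "topgroup_iso P Q \<theta>"
  shows "free_profinite_on Q (\<theta> ` S)"
proof -
  have pf: "profinite P" and gen: "top_generates P S" and conv: "set_converges_to_1 P S" 
    using P(1) by (auto simp: free_profinite_on_def)
  have univ: "universal_for TYPE('b test_carrier) P S" by (rule free_profinite_on_universal_for_any_type[OF P])
  note tP = profiniteD(1)[OF pf] and tQ = profiniteD(1)[OF Q]
  note tsP = topological_groupD(2)[OF tP] and tsQ = topological_groupD(2)[OF tQ]
  interpret P: group P using topological_groupD(1)[OF tP] .
  interpret Q: group Q using topological_groupD(1)[OF tQ] .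
  obtain \<eta> where h: "continuous_hom P Q \<theta>" "continuous_hom Q P \<eta>" "\<And>x. x \<in> carrier P \<Longrightarrow> \<eta> (\<theta> x) = x"
    "\<And>y. y \<in> carrier Q \<Longrightarrow> \<theta> (\<eta> y) = y" using topgroup_iso_inverse[OF tP tsQ \<theta>] by metis
  interpret \<theta>: group_hom P Q \<theta> using h(1) by unfold_locales (simp add: continuous_hom_def)
  interpret \<eta>: group_hom Q P \<eta> using h(2) by unfold_locales (simp add: continuous_hom_def)
  have SP: "S \<subseteq> carrier P" and cl: "topo P closure_of generate P S = carrier P" 
    using gen by (auto simp: top_generates_def)
  have hm: "homeomorphic_map (topo P) (topo Q) \<theta>" using \<theta> by (simp add: topgroup_iso_def)
  have genQ: "top_generates Q (\<theta> ` S)"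
  proof -
    have "\<theta> ` carrier P = carrier Q" using homeomorphic_imp_surjective_map[OF hm] tsP tsQ by simp
    moreover have "generate Q (\<theta> ` S) = \<theta> ` generate P S" using \<theta>.generate_img[OF SP] by simp
    moreover have "generate P S \<subseteq> topspace (topo P)" using P.generate_incl[OF SP] tsP by simp
    ultimately show ?thesis 
      using homeomorphic_map_closure_of[OF hm, of "generate P S"] cl SP by (auto simp: top_generates_def)
  qed
  moreover have "set_converges_to_1 Q (\<theta> ` S)"
    unfolding set_converges_to_1_def
  proof (intro allI impI)
    fix N assume "open_normal Q N"
    then have "finite (S \<inter> (carrier P - {x \<in> carrier P. \<theta> x \<in> N}))"
      using conv open_normal_preimage[OF tP Q.is_group h(1)] by (simp add: set_converges_to_1_def)
    moreover have "\<theta> ` S \<inter> (carrier Q - N) \<subseteq> \<theta> ` (S \<inter> (carrier P - {x \<in> carrier P. \<theta> x \<in> N}))" using SP by auto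
    ultimately show "finite (\<theta> ` S \<inter> (carrier Q - N))" by (meson finite_imageI finite_subset)
  qed
  moreover have "universal_for TYPE('b test_carrier) Q (\<theta> ` S)"
    unfolding universal_for_def
  proof (intro allI impI, elim conjE)
    fix G :: "'b test_carrier topgroup" and \<phi>
    assume G: "profinite G" and \<phi>: "\<phi> \<in> \<theta> ` S \<rightarrow> carrier G" "map_converges_to_1 (\<theta> ` S) G \<phi>"
    have "map_converges_to_1 S G (\<phi> \<circ> \<theta>)"
      unfolding map_converges_to_1_def
    proof (intro allI impI)
      fix N assume "open_normal G N"
      then have f: "finite {t \<in> \<theta> ` S. \<phi> t \<in> carrier G - N}" using \<phi>(2) by (simp add: map_converges_to_1_def)
      have "{s \<in> S. (\<phi> \<circ> \<theta>) s \<in> carrier G - N} \<subseteq> \<eta> ` {t \<in> \<theta> ` S. \<phi> t \<in> carrier G - N}"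
      proof
        fix s assume s: "s \<in> {s \<in> S. (\<phi> \<circ> \<theta>) s \<in> carrier G - N}"
        then have "s = \<eta> (\<theta> s)" using h(3) SP by auto
        then show "s \<in> \<eta> ` {t \<in> \<theta> ` S. \<phi> t \<in> carrier G - N}" using s by auto
      qed
      then show "finite {s \<in> S. (\<phi> \<circ> \<theta>) s \<in> carrier G - N}" using f by (meson finite_imageI finite_subset)
    qed
    moreover have "\<phi> \<circ> \<theta> \<in> S \<rightarrow> carrier G" using \<phi>(1) by auto
    ultimately obtain \<psi> where \<psi>: "continuous_hom P G \<psi>" "\<forall>s\<in>S. \<psi> s = (\<phi> \<circ> \<theta>) s"
      using univ G unfolding universal_for_def by blast
    define \<xi> where "\<xi> = restrict (\<psi> \<circ> \<eta>) (carrier Q)"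
    have \<xi>: "continuous_hom Q G \<xi>"
      by (rule continuous_hom_cong[OF tQ continuous_hom_comp[OF h(2) \<psi>(1)]]) (simp add: \<xi>_def)
    have \<xi>S: "\<xi> t = \<phi> t" if "t \<in> \<theta> ` S" for t
      using that \<psi>(2) SP h(3) by (auto simp: \<xi>_def)
    show "\<exists>!\<psi>. \<psi> \<in> extensional (carrier Q) \<and> continuous_hom Q G \<psi> \<and> (\<forall>s\<in>\<theta> ` S. \<psi> s = \<phi> s)"
    proof (rule ex1I[of _ \<xi>])
      show "\<xi> \<in> extensional (carrier Q) \<and> continuous_hom Q G \<xi> \<and> (\<forall>s\<in>\<theta> ` S. \<xi> s = \<phi> s)"
        using \<xi> \<xi>S by (simp add: \<xi>_def)
      fix f assume f: "f \<in> extensional (carrier Q) \<and> continuous_hom Q G f \<and> (\<forall>s\<in>\<theta> ` S. f s = \<phi> s)"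
      show "f = \<xi>"
      proof (rule extensionalityI[of _ "carrier Q"])
        show "\<xi> \<in> extensional (carrier Q)" by (simp add: \<xi>_def)
        show "f x = \<xi> x" if "x \<in> carrier Q" for x
          using f \<xi>S by (intro extension_unique[OF tQ genQ G _ \<xi> _ that]) auto
      qed (use f in auto)
    qed
  qed
  ultimately show ?thesis using Q by (simp add: free_profinite_on_def)
qed

lemma free_profinite_countably_infinite_rank_iso:
  fixes P :: "'a topgroup" and Q :: "'b topgroup"
  assumes P: "free_profinite_countably_infinite_rank P" and Q: "profinite Q" and \<theta>: "topgroup_iso P Q \<theta>"
  shows "free_profinite_countably_infinite_rank Q"
proof -
  obtain S where S: "free_profinite_on P S" "countable S" "infinite S"
    using P by (auto simp: free_profinite_countably_infinite_rank_def)
  have "S \<subseteq> carrier P" using S(1) by (simp add: free_profinite_on_def top_generates_def)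
  moreover have "inj_on \<theta> (carrier P)" using \<theta> by (simp add: topgroup_iso_def iso_def bij_betw_def)
  ultimately have "inj_on \<theta> S" by (meson inj_on_subset)
  then have "infinite (\<theta> ` S)" using S(3) finite_imageD by blast
  moreover have "countable (\<theta> ` S)" using S(2) by simp
  ultimately show ?thesis
    using free_profinite_on_iso[OF S(1) Q \<theta>] by (auto simp: free_profinite_countably_infinite_rank_def)
qed

section \<open>Homomorphisms of fields and polynomials\<close>

text \<open>
  The embedding theorem extends homomorphisms step by step from subrings of a field.  A partial
  homomorphism is a total function that is required to respect the operations on a subset only.
\<close>

definition ring_hom_on :: "'l::field set \<Rightarrow> ('l \<Rightarrow> 'm::field) \<Rightarrow> bool" where
  "ring_hom_on R f \<longleftrightarrow> f 1 = 1 \<and> (\<forall>x\<in>R. \<forall>y\<in>R. f (x + y) = f x + f y \<and> f (x * y) = f x * f y)"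

definition subring_set :: "'l::field set \<Rightarrow> bool" where
  "subring_set R \<longleftrightarrow> 1 \<in> R \<and> (\<forall>x\<in>R. \<forall>y\<in>R. x - y \<in> R \<and> x * y \<in> R)"

definition polys_over :: "'l::field set \<Rightarrow> 'l poly set" where
  "polys_over R = {p. \<forall>n. coeff p n \<in> R}"

lemma field_hom_iff: "field_hom f \<longleftrightarrow> ring_hom_on UNIV f"
  by (auto simp: field_hom_def ring_hom_on_def)

lemma subring_setD:
  assumes "subring_set R"
  shows "0 \<in> R" "1 \<in> R" "x \<in> R \<Longrightarrow> y \<in> R \<Longrightarrow> x - y \<in> R"
    "x \<in> R \<Longrightarrow> y \<in> R \<Longrightarrow> x + y \<in> R" "x \<in> R \<Longrightarrow> y \<in> R \<Longrightarrow> x * y \<in> R" "x \<in> R \<Longrightarrow> - x \<in> R"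
proof -
  have 1: "1 \<in> R" and d: "\<And>x y. x \<in> R \<Longrightarrow> y \<in> R \<Longrightarrow> x - y \<in> R" 
    and m: "\<And>x y. x \<in> R \<Longrightarrow> y \<in> R \<Longrightarrow> x * y \<in> R"
    using assms by (auto simp: subring_set_def)
  show 0: "0 \<in> R" using d[OF 1 1] by simp
  show "x \<in> R \<Longrightarrow> - x \<in> R" using d[OF 0, of x] by simp
  show "x \<in> R \<Longrightarrow> y \<in> R \<Longrightarrow> x + y \<in> R" using d[of x "- y"] d[OF 0, of y] by simp
qed (use assms in \<open>auto simp: subring_set_def\<close>)

lemma subring_set_sum:
  assumes "subring_set R" "\<And>i. i \<in> I \<Longrightarrow> g i \<in> R"
  shows "sum g I \<in> R"
  using assms(2) by (induction I rule: infinite_finite_induct) (auto simp: subring_setD[OF assms(1)])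

lemma subring_set_power:
  assumes "subring_set R" "x \<in> R" shows "x ^ n \<in> R"
  by (induction n) (auto simp: subring_setD[OF assms(1)] assms(2))

lemma polys_over_closed:
  assumes "subring_set R"
  shows "0 \<in> polys_over R" "1 \<in> polys_over R" "p \<in> polys_over R \<Longrightarrow> q \<in> polys_over R \<Longrightarrow> p + q \<in> polys_over R"
    "p \<in> polys_over R \<Longrightarrow> q \<in> polys_over R \<Longrightarrow> p - q \<in> polys_over R"
    "p \<in> polys_over R \<Longrightarrow> q \<in> polys_over R \<Longrightarrow> p * q \<in> polys_over R"
    "c \<in> R \<Longrightarrow> monom c n \<in> polys_over R"
    "c \<in> R \<Longrightarrow> p \<in> polys_over R \<Longrightarrow> smult c p \<in> polys_over R"
    "p \<in> polys_over R \<Longrightarrow> x \<in> R \<Longrightarrow> poly p x \<in> R"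
  using subring_setD[OF assms] subring_set_power[OF assms]
  by (auto simp: polys_over_def coeff_mult poly_altdef coeff_1
      intro!: subring_set_sum[OF assms])

lemma ring_hom_onD:
  assumes "ring_hom_on R f" "subring_set R"
  shows "f 0 = 0" "f 1 = 1" "x \<in> R \<Longrightarrow> y \<in> R \<Longrightarrow> f (x + y) = f x + f y" 
    "x \<in> R \<Longrightarrow> y \<in> R \<Longrightarrow> f (x * y) = f x * f y" "x \<in> R \<Longrightarrow> f (- x) = - f x"
    "x \<in> R \<Longrightarrow> y \<in> R \<Longrightarrow> f (x - y) = f x - f y"
proof -
  note R = subring_setD[OF assms(2)]
  have add: "\<And>x y. x \<in> R \<Longrightarrow> y \<in> R \<Longrightarrow> f (x + y) = f x + f y" using assms(1) by (auto simp: ring_hom_on_def)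
  have "f 0 + 0 = f 0 + f 0" using add[of 0 0] R(1) by simp
  then show 0: "f 0 = 0" by (simp only: add_left_cancel)
  have neg: "f (- x) = - f x" if "x \<in> R" for x
    using add[of x "- x"] R(6) that 0 by (simp add: eq_neg_iff_add_eq_0 add.commute)
  then show "x \<in> R \<Longrightarrow> f (- x) = - f x" .
  show "x \<in> R \<Longrightarrow> y \<in> R \<Longrightarrow> f (x - y) = f x - f y" using add[of x "- y"] neg[of y] R(6) by simp
qed (use assms(1) in \<open>auto simp: ring_hom_on_def\<close>)

lemma ring_hom_on_sum:
  assumes "ring_hom_on R f" "subring_set R" "\<And>i. i \<in> I \<Longrightarrow> g i \<in> R"
  shows "f (sum g I) = (\<Sum>i\<in>I. f (g i))"
  using assms(3)
  by (induction I rule: infinite_finite_induct) 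
    (auto simp: ring_hom_onD[OF assms(1,2)] subring_set_sum[OF assms(2)])

lemma map_poly_ring_hom_on:
  assumes f: "ring_hom_on R f" and R: "subring_set R"
  shows "map_poly f 1 = 1" "p \<in> polys_over R \<Longrightarrow> q \<in> polys_over R \<Longrightarrow> map_poly f (p + q) = map_poly f p + map_poly f q"
    "p \<in> polys_over R \<Longrightarrow> q \<in> polys_over R \<Longrightarrow> map_poly f (p * q) = map_poly f p * map_poly f q"
    "p \<in> polys_over R \<Longrightarrow> q \<in> polys_over R \<Longrightarrow> map_poly f (p - q) = map_poly f p - map_poly f q"
proof -
  note F = ring_hom_onD[OF f R] and S = subring_setD[OF R]
  show "map_poly f 1 = 1" using F by (simp add: map_poly_1')
  assume pq: "p \<in> polys_over R" "q \<in> polys_over R"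
  then show "map_poly f (p + q) = map_poly f p + map_poly f q"
    by (intro poly_eqI) (auto simp: coeff_map_poly F polys_over_def)
  show "map_poly f (p - q) = map_poly f p - map_poly f q"
    using pq by (intro poly_eqI) (auto simp: coeff_map_poly F polys_over_def)
  show "map_poly f (p * q) = map_poly f p * map_poly f q"
    using pq by (intro poly_eqI)
      (auto simp: coeff_map_poly F polys_over_def coeff_mult S ring_hom_on_sum[OF f R])
qed

lemma poly_map_poly_ring_hom_on:
  assumes f: "ring_hom_on R f" and R: "subring_set R" and p: "p \<in> polys_over R" and x: "x \<in> R"
  shows "poly (map_poly f p) (f x) = f (poly p x)"
proof -
  note F = ring_hom_onD[OF f R] and S = subring_setD[OF R]
  have pw: "f (x ^ n) = f x ^ n" for n 
    by (induction n) (auto simp: F x subring_set_power[OF R x])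
  have c: "coeff p n \<in> R" for n using p by (simp add: polys_over_def)
  have "f (poly p x) = (\<Sum>i\<le>degree p. f (coeff p i) * f x ^ i)"
    by (subst poly_altdef, subst ring_hom_on_sum[OF f R]) (auto simp: F S c pw subring_set_power[OF R x])
  also have "\<dots> = poly (map_poly f p) (f x)"
  proof -
    have "degree (map_poly f p) \<le> degree p" by (rule degree_le) (auto simp: coeff_map_poly F coeff_eq_0)
    then have "poly (map_poly f p) (f x) = (\<Sum>i\<le>degree p. coeff (map_poly f p) i * f x ^ i)"
      unfolding poly_altdef by (intro sum.mono_neutral_left) (auto simp: coeff_eq_0)
    then show ?thesis by (simp add: coeff_map_poly F)
  qed
  finally show ?thesis ..
qed

text \<open>
  Long division does not leave the subring, since the leading coefficient of the divisor is \<open>1\<close>.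
\<close>

lemma polys_over_division:
  assumes R: "subring_set R" and q: "q \<in> polys_over R" "lead_coeff q = 1" and g: "g \<in> polys_over R"
  shows "\<exists>a\<in>polys_over R. \<exists>r\<in>polys_over R. g = a * q + r \<and> (r = 0 \<or> degree r < degree q)"
  using g
proof (induction "degree g" arbitrary: g rule: less_induct)
  case less
  note P = polys_over_closed[OF R]
  show ?case
  proof (cases "g = 0 \<or> degree g < degree q")
    case True
    then show ?thesis using less.prems P(1) by (intro bexI[of _ 0] bexI[of _ g]) auto
  next
    case False
    define m where "m = monom (lead_coeff g) (degree g - degree q)"
    have m: "m \<in> polys_over R" using less.prems by (auto simp: m_def polys_over_def intro!: subring_setD[OF R])
    define g' where "g' = g - m * q"
    have g': "g' \<in> polys_over R" using less.prems m q P by (simp add: g'_def)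
    have "m \<noteq> 0" "q \<noteq> 0" using False q(2) by (auto simp: m_def)
    then have deg: "degree (m * q) = degree g" 
      using False by (simp add: degree_mult_eq m_def degree_monom_eq)
    have lc: "coeff (m * q) (degree g) = lead_coeff g" 
      using q(2) deg False by (metis lead_coeff_mult m_def lead_coeff_monom mult.right_neutral)
    show ?thesis
    proof (cases "degree g = 0")
      case True
      then have "degree q = 0" using False by simp
      then obtain c where "q = [:c:]" by (rule degree_eq_zeroE)
      then have "q = 1" using q(2) by simp
      then show ?thesis using less.prems P(1) by (intro bexI[of _ g] bexI[of _ 0]) auto
    next
      case dg: False
      have "degree g' \<le> degree g" unfolding g'_def using deg by (metis degree_diff_le order_refl)
      moreover have "coeff g' (degree g) = 0" using lc by (simp add: g'_def)
      ultimately have "degree g' < degree g" using dg 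
        by (metis degree_0 gr0I leading_coeff_0_iff le_neq_implies_less)
      from less.hyps[OF this g'] obtain a r where ar: "a \<in> polys_over R" "r \<in> polys_over R" 
        "g' = a * q + r" "r = 0 \<or> degree r < degree q" by blast
      have "g = (m + a) * q + r" using ar(3) by (simp add: g'_def algebra_simps)
      then show ?thesis using ar m P(3) by blast
    qed
  qed
qed

lemma field_homD:
  assumes "field_hom f"
  shows "f 0 = 0" "f 1 = 1" "f (x + y) = f x + f y" "f (x * y) = f x * f y" "f (- x) = - f x"
    "f (x - y) = f x - f y" "f x = 0 \<longleftrightarrow> x = 0" "inj f" "f x = f y \<longleftrightarrow> x = y"
proof -
  have U: "subring_set (UNIV :: 'a set)" by (simp add: subring_set_def)
  note F = ring_hom_onD[OF assms[unfolded field_hom_iff] U]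
  show "f 0 = 0" "f 1 = 1" "f (x + y) = f x + f y" "f (x * y) = f x * f y" "f (- x) = - f x" 
    and d: "f (x - y) = f x - f y" for x y
    using F by auto
  show z: "f x = 0 \<longleftrightarrow> x = 0" for x
  proof
    assume "f x = 0"
    then have "x \<noteq> 0 \<Longrightarrow> f (x * inverse x) = 0" by (subst F(4)) simp_all
    then show "x = 0" using F(2) by (metis right_inverse zero_neq_one)
  qed (simp add: F)
  show e: "f x = f y \<longleftrightarrow> x = y" for x y using z[of "x - y"] d by simp
  show "inj f" using e by (simp add: inj_def)
qed

lemma field_hom_map_poly:
  assumes f: "field_hom f"
  shows "map_poly f (p + q) = map_poly f p + map_poly f q" "map_poly f (p * q) = map_poly f p * map_poly f q"
    "map_poly f 1 = 1" "poly (map_poly f p) (f x) = f (poly p x)" "map_poly f p = 0 \<longleftrightarrow> p = 0"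
    "degree (map_poly f p) = degree p" "map_poly f (pderiv p) = pderiv (map_poly f p)"
    "map_poly f (smult c p) = smult (f c) (map_poly f p)"
proof -
  have U: "subring_set (UNIV :: 'a set)" by (simp add: subring_set_def)
  note F = field_homD[OF f]
  have P: "p \<in> polys_over UNIV" for p :: "'a poly" by (simp add: polys_over_def)
  note M = map_poly_ring_hom_on[OF f[unfolded field_hom_iff] U]
  show "map_poly f (p + q) = map_poly f p + map_poly f q" "map_poly f (p * q) = map_poly f p * map_poly f q"
    "map_poly f 1 = 1" using M P by auto
  show "poly (map_poly f p) (f x) = f (poly p x)" 
    using poly_map_poly_ring_hom_on[OF f[unfolded field_hom_iff] U P] by simp
  show "map_poly f p = 0 \<longleftrightarrow> p = 0" by (simp add: poly_eq_iff coeff_map_poly F)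
  show "degree (map_poly f p) = degree p" by (rule degree_map_poly) (simp add: F)
  have n: "f (of_nat n) = of_nat n" for n by (induction n) (auto simp: F)
  show "map_poly f (pderiv p) = pderiv (map_poly f p)" 
    by (intro poly_eqI) (simp add: coeff_map_poly F coeff_pderiv n del: of_nat_Suc)
  show "map_poly f (smult c p) = smult (f c) (map_poly f p)"
    by (intro poly_eqI) (simp add: coeff_map_poly F)
qed

lemma field_hom_comp: "field_hom f \<Longrightarrow> field_hom g \<Longrightarrow> field_hom (g \<circ> f)"
  by (simp add: field_hom_def)

lemma map_poly_comp_hom: "field_hom f \<Longrightarrow> field_hom g \<Longrightarrow> map_poly g (map_poly f p) = map_poly (g \<circ> f) p"
  by (simp add: map_poly_map_poly field_homD o_def)

text \<open>
  A nonzero combination \<open>d\<close> of minimal degree divides every combination, because remainders modulo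
  \<open>d\<close> are combinations of smaller degree; so \<open>d\<close> is a common divisor, that is, a unit.
\<close>

lemma coprime_poly_bezout:
  fixes p q :: "'k::field poly"
  assumes "coprime p q"
  shows "\<exists>u v. u * p + v * q = 1"
proof -
  have "p \<noteq> 0 \<or> q \<noteq> 0" using assms by auto
  define I where "I = {u * p + v * q | u v. u * p + v * q \<noteq> 0}"
  have mem: "u * p + v * q \<in> I" if "u * p + v * q \<noteq> 0" for u v using that unfolding I_def by blast
  have "I \<noteq> {}"
  proof -
    from mem[of 1 0] mem[of 0 1] have "p \<in> I \<or> q \<in> I" using \<open>p \<noteq> 0 \<or> q \<noteq> 0\<close> by auto
    then show ?thesis by blast
  qed
  then obtain d where d: "d \<in> I" "\<And>e. e \<in> I \<Longrightarrow> degree d \<le> degree e"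
    using ex_has_least_nat[of "\<lambda>d. d \<in> I" _ degree] by blast
  then obtain u v where uv: "d = u * p + v * q" "d \<noteq> 0" by (auto simp: I_def)
  have dvd: "d dvd u' * p + v' * q" for u' v'
  proof (rule ccontr)
    let ?g = "u' * p + v' * q"
    assume "\<not> d dvd ?g"
    then have nz: "?g mod d \<noteq> 0" by (simp add: mod_eq_0_iff_dvd)
    have "?g mod d = ?g - (?g div d) * d" by (simp add: minus_div_mult_eq_mod)
    also have "\<dots> = (u' - (?g div d) * u) * p + (v' - (?g div d) * v) * q" 
      by (simp add: uv(1) algebra_simps)
    finally have "?g mod d \<in> I" using nz mem by metis
    then show False using d(2) degree_mod_less'[OF uv(2) nz] by fastforce
  qed
  have "d dvd p" "d dvd q" using dvd[of 1 0] dvd[of 0 1] by simp_all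
  then have "is_unit d" using assms by (meson coprime_common_divisor)
  then obtain e where "1 = d * e" by (auto simp: dvd_def)
  then have "(e * u) * p + (e * v) * q = 1" using uv(1) by (simp add: algebra_simps)
  then show ?thesis by blast
qed

text \<open>
  Coprimality survives an extension of fields because a Bezout identity does.
\<close>

lemma separable_poly_map:
  assumes f: "field_hom f" and p: "separable_poly p"
  shows "separable_poly (map_poly f p)"
proof -
  obtain u v where "u * p + v * pderiv p = 1" 
    using coprime_poly_bezout p unfolding separable_poly_def by blast
  then have "map_poly f (u * p + v * pderiv p) = 1" using field_hom_map_poly(3)[OF f] by simp
  then have "map_poly f u * map_poly f p + map_poly f v * pderiv (map_poly f p) = 1"
    using field_hom_map_poly[OF f] by simp
  then show ?thesis unfolding separable_poly_def
    by (metis coprimeI dvd_add dvd_mult)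
qed

lemma separable_poly_dvd:
  assumes "separable_poly p" "q dvd p"
  shows "separable_poly (q :: 'k::field poly)"
  unfolding separable_poly_def
proof (rule coprimeI)
  fix c assume c: "c dvd q" "c dvd pderiv q"
  obtain a where a: "p = q * a" using assms(2) by blast
  have "c dvd p" using c a by simp
  moreover have "c dvd pderiv p" using c a by (simp add: pderiv_mult)
  ultimately show "is_unit c" using assms(1) by (auto simp: separable_poly_def coprime_def)
qed


section \<open>Embeddings into a separably closed field\<close>

text \<open>
  Let \<open>p = a + X q\<close> be irreducible over \<open>K\<close> with root \<open>z \<noteq> 0\<close>.  Then \<open>a \<noteq> 0\<close>, and \<open>z q(z) = - a\<close> exhibits
  the inverse of \<open>z\<close> as an element of \<open>K[z]\<close>.  So every ring between \<open>K\<close> and \<open>L\<close> is a field, which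
  allows partial homomorphisms to be defined on subrings rather than subfields.
\<close>

lemma subring_set_inverse:
  fixes i :: "'k::field \<Rightarrow> 'l::field"
  assumes i: "separable_extension i" and R: "subring_set R" "range i \<subseteq> R" and z: "z \<in> R" "z \<noteq> 0"
  shows "inverse z \<in> R"
proof -
  have hi: "field_hom i" using i by (simp add: separable_extension_def)
  note I = field_homD[OF hi]
  obtain p where p: "irreducible p" "poly (map_poly i p) z = 0"
    using i unfolding separable_extension_def separable_over_def by blast
  obtain a q where pq: "p = pCons a q" by (cases p)
  have mp: "map_poly i p = pCons (i a) (map_poly i q)"
    unfolding pq by (rule poly_eqI) (simp add: coeff_map_poly I coeff_pCons split: nat.split)
  have eq: "i a + z * poly (map_poly i q) z = 0" using p(2) mp by simp
  have "a \<noteq> 0"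
  proof
    assume a: "a = 0"
    then have "p = [:0, 1:] * q" using pq by simp
    moreover have "\<not> is_unit [:0, 1 :: 'k:]" by (simp add: is_unit_iff_degree)
    ultimately have "is_unit q" using irreducibleD[OF p(1)] by blast
    then obtain c where "q = [:c:]" "c dvd 1" by (auto simp: is_unit_poly_iff)
    then have "c \<noteq> 0" by auto
    have "i c * z = 0" using eq a I \<open>q = [:c:]\<close> by (simp add: map_poly_pCons mult.commute)
    then show False using z I \<open>c \<noteq> 0\<close> by simp
  qed
  then have ia: "i a * i (inverse a) = 1" using I(2) I(4)[of a "inverse a"] by simp
  have "map_poly i q \<in> polys_over R" using R(2) I by (auto simp: polys_over_def coeff_map_poly)
  then have "- i (inverse a) * poly (map_poly i q) z \<in> R" 
    using R z by (intro subring_setD(5)[OF R(1)] subring_setD(6)[OF R(1)] polys_over_closed(8)[OF R(1)]) auto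
  moreover have "z * (- i (inverse a) * poly (map_poly i q) z) = 1"
  proof -
    have "z * poly (map_poly i q) z = - i a" using eq by (simp add: eq_neg_iff_add_eq_0 add.commute)
    then have "z * (- i (inverse a) * poly (map_poly i q) z) = - i (inverse a) * (- i a)" 
      by (metis mult.left_commute)
    then show ?thesis using ia by (simp add: mult.commute)
  qed
  then have "inverse z = - i (inverse a) * poly (map_poly i q) z" by (rule inverse_unique)
  ultimately show ?thesis by simp
qed

text \<open>
  Let \<open>q\<close> be the minimal polynomial of \<open>x\<close> over \<open>R\<close>.  It divides a separable polynomial over \<open>K\<close>, so
  its image under \<open>f\<close> divides the image under \<open>m\<close> of that polynomial and is separable as well.  Its
  root \<open>y\<close> is the place to which \<open>f\<close> can send \<open>x\<close>.
\<close>

lemma root_in_separably_closed: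
  fixes i :: "'k::field \<Rightarrow> 'l::field" and m :: "'k \<Rightarrow> 'm::field"
  assumes i: "separable_extension i" and m: "field_hom m" and cl: "separably_closed TYPE('m)"
    and R: "subring_set R" "range i \<subseteq> R" and f: "ring_hom_on R f" "\<And>a. f (i a) = m a"
  shows "\<exists>y. \<forall>p\<in>polys_over R. poly p x = 0 \<longrightarrow> poly (map_poly f p) y = 0"
proof -
  have hi: "field_hom i" using i by (simp add: separable_extension_def)
  note I = field_homD[OF hi]
  note F = ring_hom_onD[OF f(1) R(1)] and C = polys_over_closed[OF R(1)]
  obtain p where p: "irreducible p" "poly (map_poly i p) x = 0" "separable_poly p"
    using i unfolding separable_extension_def separable_over_def by blast
  have ip: "map_poly i p \<in> polys_over R" "map_poly i p \<noteq> 0"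
    using R(2) I p(1) field_hom_map_poly(5)[OF hi] by (auto simp: polys_over_def coeff_map_poly)
  define Q where "Q g \<longleftrightarrow> g \<in> polys_over R \<and> g \<noteq> 0 \<and> poly g x = 0" for g
  have "Q (map_poly i p)" using ip p(2) by (simp add: Q_def)
  then obtain q0 where q0: "Q q0" "\<And>g. Q g \<Longrightarrow> degree q0 \<le> degree g"
    using ex_has_least_nat[of Q _ degree] by blast
  define q where "q = smult (inverse (lead_coeff q0)) q0"
  have lc: "lead_coeff q0 \<in> R" "lead_coeff q0 \<noteq> 0" using q0(1) by (auto simp: Q_def polys_over_def)
  have q: "q \<in> polys_over R" "lead_coeff q = 1" "poly q x = 0" "degree q = degree q0"
    using q0(1) lc subring_set_inverse[OF i R lc] C(7) by (auto simp: q_def Q_def)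
  have dvd: "\<exists>a\<in>polys_over R. g = a * q" if g: "g \<in> polys_over R" "poly g x = 0" for g
  proof -
    obtain a r where ar: "a \<in> polys_over R" "r \<in> polys_over R" "g = a * q + r" "r = 0 \<or> degree r < degree q"
      using polys_over_division[OF R(1) q(1,2) g(1)] by blast
    have "poly r x = 0" using g(2) q(3) ar(3) by simp
    then have "r = 0" using q0(2)[of r] ar(2,4) q(4) unfolding Q_def by (metis leD)
    then show ?thesis using ar by auto
  qed
  obtain a where a: "a \<in> polys_over R" "map_poly i p = a * q" using dvd[OF ip(1) p(2)] by blast
  have "map_poly f (map_poly i p) = map_poly m p"
    by (rule poly_eqI) (simp add: coeff_map_poly F I f(2) field_homD(1)[OF m])
  then have "map_poly f q dvd map_poly m p" 
    using a map_poly_ring_hom_on(3)[OF f(1) R(1) a(1) q(1)] by (metis dvd_triv_right)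
  then have "separable_poly (map_poly f q)" 
    using separable_poly_dvd separable_poly_map[OF m p(3)] by blast
  moreover have "degree (map_poly f q) > 0"
  proof -
    have "degree q > 0"
    proof (rule ccontr)
      assume "\<not> degree q > 0"
      then obtain c where "q = [:c:]" by (meson degree_eq_zeroE gr0I)
      then show False using q(2,3) by simp
    qed
    moreover have "coeff (map_poly f q) (degree q) = 1" using q(2) F by (simp add: coeff_map_poly)
    then have "degree q \<le> degree (map_poly f q)" by (intro le_degree) simp
    ultimately show ?thesis by simp
  qed
  ultimately obtain y where y: "poly (map_poly f q) y = 0" using cl by (auto simp: separably_closed_def)
  show ?thesis
  proof (intro exI[of _ y] ballI impI)
    fix g assume g: "g \<in> polys_over R" "poly g x = 0"
    obtain b where b: "b \<in> polys_over R" "g = b * q" using dvd[OF g] by blast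
    show "poly (map_poly f g) y = 0" 
      unfolding b(2) map_poly_ring_hom_on(3)[OF f(1) R(1) b(1) q(1)] using y by simp
  qed
qed

text \<open>
  Zorn's lemma is applied to graphs of partial homomorphisms that extend \<open>m\<close>.  If the domain \<open>R\<close> of a
  maximal one missed \<open>x\<close>, then \<open>p(x) \<mapsto> (f p)(y)\<close>, for polynomials \<open>p\<close> over \<open>R\<close> and \<open>y\<close> from the previous
  lemma, would be a proper extension.
\<close>

theorem separable_extension_embeds:
  fixes i :: "'k::field \<Rightarrow> 'l::field" and m :: "'k \<Rightarrow> 'm::field"
  assumes i: "separable_extension i" and m: "field_hom m" and cl: "separably_closed TYPE('m)"
  shows "\<exists>j. field_hom j \<and> j \<circ> i = m"
proof -
  have hi: "field_hom i" using i by (simp add: separable_extension_def)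
  note I = field_homD[OF hi] and M = field_homD[OF m]
  define \<G> :: "('l \<times> 'm) set set" where "\<G> = {G. range (\<lambda>a. (i a, m a)) \<subseteq> G \<and> single_valued G \<and>
    (\<forall>a b c d. (a, b) \<in> G \<and> (c, d) \<in> G \<longrightarrow> (a - c, b - d) \<in> G \<and> (a * c, b * d) \<in> G)}"
  have "\<exists>G\<in>\<G>. \<forall>X\<in>\<G>. G \<subseteq> X \<longrightarrow> X = G"
  proof (rule subset_Zorn_nonempty)
    have "range (\<lambda>a. (i a, m a)) \<in> \<G>" unfolding \<G>_def
    proof (intro CollectI conjI allI impI)
      show "single_valued (range (\<lambda>a. (i a, m a)))" using I(9) by (auto simp: single_valued_def)
      fix a b c d assume "(a, b) \<in> range (\<lambda>a. (i a, m a)) \<and> (c, d) \<in> range (\<lambda>a. (i a, m a))"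
      then obtain u v where "a = i u" "b = m u" "c = i v" "d = m v" by blast
      then have "(a - c, b - d) = (i (u - v), m (u - v))" "(a * c, b * d) = (i (u * v), m (u * v))"
        by (simp_all only: I M)
      then show "(a - c, b - d) \<in> range (\<lambda>a. (i a, m a))" "(a * c, b * d) \<in> range (\<lambda>a. (i a, m a))" by blast+
    qed simp
    then show "\<G> \<noteq> {}" by blast
    fix \<C> assume ne: "\<C> \<noteq> {}" and ch: "subset.chain \<G> \<C>"
    have two: "\<exists>G\<in>\<C>. s \<in> G \<and> t \<in> G" if st: "s \<in> \<Union>\<C>" "t \<in> \<Union>\<C>" for s t
    proof -
      obtain G H where GH: "G \<in> \<C>" "H \<in> \<C>" "s \<in> G" "t \<in> H" using st by blast
      then have "G \<subseteq> H \<or> H \<subseteq> G" using ch by (auto simp: subset_chain_def)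
      then show ?thesis using GH by blast
    qed
    have sub: "\<C> \<subseteq> \<G>" using ch by (simp add: subset_chain_def)
    show "\<Union>\<C> \<in> \<G>" unfolding \<G>_def
    proof (intro CollectI conjI allI impI)
      show "range (\<lambda>a. (i a, m a)) \<subseteq> \<Union>\<C>" 
      proof -
        obtain G where "G \<in> \<C>" using ne by blast
        moreover from this have "range (\<lambda>a. (i a, m a)) \<subseteq> G" using sub unfolding \<G>_def by blast
        ultimately show ?thesis by blast
      qed
      show "single_valued (\<Union>\<C>)" unfolding single_valued_def
      proof (intro allI impI)
        fix x y z assume "(x, y) \<in> \<Union>\<C>" "(x, z) \<in> \<Union>\<C>"
        then obtain G where "G \<in> \<C>" "(x, y) \<in> G" "(x, z) \<in> G" using two by blast
        moreover from this have "single_valued G" using sub by (auto simp: \<G>_def)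
        ultimately show "y = z" by (meson single_valuedD)
      qed
      fix a b c d assume "(a, b) \<in> \<Union>\<C> \<and> (c, d) \<in> \<Union>\<C>"
      then obtain G where "G \<in> \<C>" "(a, b) \<in> G" "(c, d) \<in> G" using two by blast
      then show "(a - c, b - d) \<in> \<Union>\<C>" "(a * c, b * d) \<in> \<Union>\<C>" 
        using sub unfolding \<G>_def by blast+
    qed
  qed
  then obtain G where G: "G \<in> \<G>" and max: "\<And>X. X \<in> \<G> \<Longrightarrow> G \<subseteq> X \<Longrightarrow> X = G" by blast
  have base: "(i a, m a) \<in> G" for a using G by (auto simp: \<G>_def)
  have sv: "single_valued G" using G by (simp add: \<G>_def)
  have cls: "(a - c, b - d) \<in> G" "(a * c, b * d) \<in> G" if "(a, b) \<in> G" "(c, d) \<in> G" for a b c d 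
    using G that by (auto simp: \<G>_def)
  define R where "R = Domain G"
  define f where "f a = (THE b. (a, b) \<in> G)" for a
  have f: "f a = b" if "(a, b) \<in> G" for a b 
    unfolding f_def using that sv by (auto dest: single_valuedD)
  have fG: "(a, f a) \<in> G" if "a \<in> R" for a using that f by (auto simp: R_def)
  have fi: "f (i a) = m a" for a using base f by blast
  have R: "subring_set R" "range i \<subseteq> R" 
  proof -
    show "range i \<subseteq> R" using base by (auto simp: R_def)
    then have "1 \<in> R" using I(2) by (metis rangeI subsetD)
    then show "subring_set R" using cls unfolding subring_set_def R_def 
      by (meson Domain.cases Domain.DomainI)
  qed
  have zero: "(0, 0) \<in> G" "(1, 1) \<in> G" using base[of 0] base[of 1] I M by auto
  have "(a + c, b + d) \<in> G" if "(a, b) \<in> G" "(c, d) \<in> G" for a b c d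
    using cls(1)[OF that(1) cls(1)[OF zero(1) that(2)]] by simp
  then have hf: "ring_hom_on R f" unfolding ring_hom_on_def
    using f[OF zero(2)] fG cls(2) by (auto intro!: f)
  have "x \<in> R" for x
  proof -
    obtain y where y: "\<And>p. p \<in> polys_over R \<Longrightarrow> poly p x = 0 \<Longrightarrow> poly (map_poly f p) y = 0"
      using root_in_separably_closed[OF i m cl R hf fi, of x] by blast
    define X where "X = {(poly p x, poly (map_poly f p) y) | p. p \<in> polys_over R}"
    note C = polys_over_closed[OF R(1)] and MP = map_poly_ring_hom_on[OF hf R(1)]
    have XI: "(poly p x, poly (map_poly f p) y) \<in> X" if "p \<in> polys_over R" for p using that by (auto simp: X_def)
    have "G \<subseteq> X"
    proof clarify
      fix a b assume ab: "(a, b) \<in> G"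
      then have a: "a \<in> R" "f a = b" using f by (auto simp: R_def)
      then have "[:a:] \<in> polys_over R" using C(6)[of a 0] by (simp add: monom_0)
      from XI[OF this] show "(a, b) \<in> X" using a ring_hom_onD(1)[OF hf R(1)] by (simp add: map_poly_pCons)
    qed
    moreover have "X \<in> \<G>" unfolding \<G>_def
    proof (intro CollectI conjI allI impI)
      show "range (\<lambda>a. (i a, m a)) \<subseteq> X" using base \<open>G \<subseteq> X\<close> by blast
      have "poly (map_poly f p) y = poly (map_poly f q) y" 
        if "p \<in> polys_over R" "q \<in> polys_over R" "poly p x = poly q x" for p q
        using y[of "p - q"] that C(4) MP(4) by simp
      then show "single_valued X" by (auto simp: X_def single_valued_def)
      fix a b c d assume "(a, b) \<in> X \<and> (c, d) \<in> X"
      then obtain p q where pq: "p \<in> polys_over R" "q \<in> polys_over R" "a = poly p x" "b = poly (map_poly f p) y"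
        "c = poly q x" "d = poly (map_poly f q) y" by (auto simp: X_def)
      show "(a - c, b - d) \<in> X" using XI[OF C(4)[OF pq(1,2)]] pq MP(4)[OF pq(1,2)] by simp
      show "(a * c, b * d) \<in> X" using XI[OF C(5)[OF pq(1,2)]] pq MP(3)[OF pq(1,2)] by simp
    qed
    ultimately have "X = G" using max by blast
    moreover have "x \<in> Domain X"
      using XI[OF C(6)[of 1 1]] R by (force simp: subring_setD poly_monom)
    ultimately show ?thesis by (simp add: R_def)
  qed
  then have "R = UNIV" by blast
  then show ?thesis using hf fi by (auto simp: field_hom_iff fun_eq_iff)
qed

section \<open>The absolute Galois group of an abelian extension\<close>

text \<open>
  The minimal polynomial of \<open>x\<close> over the intermediate field divides the separable irreducible
  polynomial over the ground field that vanishes at \<open>x\<close>.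
\<close>

lemma separable_extension_upper:
  fixes h :: "'k::field \<Rightarrow> 'k1::field" and j :: "'k1 \<Rightarrow> 'l::field"
  assumes h: "field_hom h" and j: "field_hom j" and sep: "separable_extension (j \<circ> h)"
  shows "separable_extension j"
proof -
  have "separable_over j x" for x
  proof -
    obtain p where p: "irreducible p" "poly (map_poly (j \<circ> h) p) x = 0" "separable_poly p"
      using sep unfolding separable_extension_def separable_over_def by blast
    define Q where "Q g \<longleftrightarrow> g \<noteq> 0 \<and> poly (map_poly j g) x = 0" for g
    have "Q (map_poly h p)" 
      using p map_poly_comp_hom[OF h j] field_hom_map_poly(5)[OF h] by (auto simp: Q_def)
    then obtain q where q: "Q q" "\<And>g. Q g \<Longrightarrow> degree q \<le> degree g"
      using ex_has_least_nat[of Q _ degree] by blast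
    have dvd: "q dvd g" if g: "poly (map_poly j g) x = 0" for g
    proof (rule ccontr)
      assume "\<not> q dvd g"
      then have nz: "g mod q \<noteq> 0" by (simp add: mod_eq_0_iff_dvd)
      have "map_poly j g = map_poly j (g div q * q + g mod q)" by simp
      then have "poly (map_poly j (g mod q)) x = 0"
        using g q(1) unfolding field_hom_map_poly(1,2)[OF j] by (simp add: Q_def)
      then have "degree q \<le> degree (g mod q)" using q(2) nz by (simp add: Q_def)
      then show False using degree_mod_less'[OF _ nz] q(1) by (simp add: Q_def)
    qed
    have "\<not> is_unit q"
    proof
      assume "is_unit q"
      then obtain c where "q = [:c:]" "c dvd 1" by (auto simp: is_unit_poly_iff)
      then show False using q(1) field_homD[OF j] by (auto simp: Q_def map_poly_pCons)
    qed
    moreover have "is_unit a \<or> is_unit b" if ab: "q = a * b" for a b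
    proof -
      have "poly (map_poly j a) x = 0 \<or> poly (map_poly j b) x = 0"
        using q(1) ab field_hom_map_poly(2)[OF j] by (simp add: Q_def)
      then have "q dvd a \<or> q dvd b" using dvd by blast
      moreover have "a \<noteq> 0" "b \<noteq> 0" using q(1) ab by (auto simp: Q_def)
      ultimately show ?thesis unfolding ab
        by (metis dvd_mult_cancel_left dvd_mult_cancel_right mult_1 mult_1_right)
    qed
    ultimately have "irreducible q" using q(1) by (auto simp: irreducible_def Q_def)
    moreover have "q dvd map_poly h p" using dvd p(2) map_poly_comp_hom[OF h j] by metis
    then have "separable_poly q" using separable_poly_dvd separable_poly_map[OF h p(3)] by blast
    ultimately show ?thesis using q(1) unfolding separable_over_def Q_def by blast
  qed
  then show ?thesis using j by (simp add: separable_extension_def)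
qed

text \<open>
  The irreducible polynomial of an element \<open>y\<close> has a root in the separably closed field, so it is
  linear and \<open>y\<close> is the image of that root.
\<close>

lemma separably_closed_no_proper_separable_extension:
  fixes j :: "'k::field \<Rightarrow> 'l::field" and u :: "'l \<Rightarrow> 'm::field"
  assumes j: "field_hom j" and u: "field_hom u" and sep: "separable_extension (u \<circ> j)"
    and cl: "separably_closed TYPE('l)"
  shows "surj u"
proof -
  have "y \<in> range u" for y
  proof -
    have "separable_extension u" by (rule separable_extension_upper[OF j u sep])
    then obtain q where q: "irreducible q" "poly (map_poly u q) y = 0" "separable_poly q"
      unfolding separable_extension_def separable_over_def by blast
    have "degree q > 0" using q(1) by (metis irreducible_def is_unit_iff_degree gr0I)
    then obtain a where "poly q a = 0" using cl q(3) by (auto simp: separably_closed_def)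
    then obtain r where r: "q = [:- a, 1:] * r" by (auto simp: poly_eq_0_iff_dvd)
    have "\<not> is_unit [:- a, 1:]" by (simp add: is_unit_iff_degree)
    then have "is_unit r" using irreducibleD[OF q(1) r] by blast
    then obtain c where c: "r = [:c:]" "c dvd 1" by (auto simp: is_unit_poly_iff)
    have "map_poly u q = map_poly u [:- a, 1:] * map_poly u [:c:]"
      unfolding r c(1) by (rule field_hom_map_poly(2)[OF u])
    then have "map_poly u q = [:- u a, 1:] * [:u c:]" 
      using field_homD[OF u] by (simp add: map_poly_pCons)
    moreover have "u c \<noteq> 0" using c(2) field_homD[OF u] by auto
    ultimately have "y = u a" using q(2) by simp
    then show ?thesis by blast
  qed
  then show ?thesis by auto
qed

text \<open>
  An irreducible polynomial over \<open>K\<close> that vanishes at \<open>x\<close> splits in \<open>K\<^sub>1\<close>.  Therefore all its roots in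
  \<open>L\<close> come from \<open>K\<^sub>1\<close>, and \<open>\<sigma>\<close> permutes these roots.
\<close>

lemma galois_stable:
  fixes h :: "'k::field \<Rightarrow> 'k1::field" and j :: "'k1 \<Rightarrow> 'l::field"
  assumes h: "galois_extension h" and j: "field_hom j" and \<sigma>: "\<sigma> \<in> Gal_carrier (j \<circ> h)"
  shows "\<sigma> (j x) \<in> range j"
proof -
  have hh: "field_hom h" and hs: "field_hom \<sigma>" "\<sigma> \<circ> (j \<circ> h) = j \<circ> h" 
    using h \<sigma> by (auto simp: galois_extension_def separable_extension_def Gal_carrier_def)
  obtain p where p: "irreducible p" "poly (map_poly h p) x = 0"
    using h unfolding galois_extension_def separable_extension_def separable_over_def by blast
  then obtain c as where s: "map_poly h p = smult c (\<Prod>a\<leftarrow>as. [:- a, 1:])" 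
    using h unfolding galois_extension_def splits_def by blast
  have c: "c \<noteq> 0" using s p(1) field_hom_map_poly(5)[OF hh, of p] by auto
  have lin: "map_poly j (\<Prod>a\<leftarrow>as. [:- a, 1:]) = (\<Prod>a\<leftarrow>as. [:- j a, 1:])"
    by (induction as) 
      (simp_all only: list.map prod_list.Cons prod_list.Nil field_hom_map_poly(2,3)[OF j],
        simp add: map_poly_pCons field_homD[OF j])
  have "map_poly j (map_poly h p) = smult (j c) (\<Prod>a\<leftarrow>as. [:- j a, 1:])"
    unfolding s by (simp add: field_hom_map_poly(8)[OF j] lin)
  moreover have "poly (map_poly j (map_poly h p)) (\<sigma> (j x)) = 0"
  proof -
    have "map_poly j (map_poly h p) = map_poly \<sigma> (map_poly j (map_poly h p))"
      using hs(2) field_hom_comp[OF hh j]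
      by (simp add: map_poly_comp_hom hh j hs(1))
    then have "poly (map_poly j (map_poly h p)) (\<sigma> (j x)) = \<sigma> (j (poly (map_poly h p) x))"
      using field_hom_map_poly(4)[OF hs(1)] field_hom_map_poly(4)[OF j] by metis
    then show ?thesis using p(2) field_homD(1)[OF hs(1)] field_homD(1)[OF j] by simp
  qed
  moreover have "poly (\<Prod>a\<leftarrow>as. [:- j a, 1:]) z = (\<Prod>a\<leftarrow>as. z - j a)" for z
    by (induction as) (auto simp: algebra_simps)
  ultimately have "(\<Prod>a\<leftarrow>as. \<sigma> (j x) - j a) = 0"
    using c field_homD(7)[OF j] by simp
  then show ?thesis by (auto simp: prod_list_zero_iff)
qed

lemma Gal_simps [simp]:
  "carrier (Gal i) = Gal_carrier i" "\<one>\<^bsub>Gal i\<^esub> = id" "\<sigma> \<otimes>\<^bsub>Gal i\<^esub> \<tau> = \<sigma> \<circ> \<tau>"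
  "topo (Gal i) = subtopology (product_topology (\<lambda>_. discrete_topology UNIV) UNIV) (Gal_carrier i)"
  by (auto simp: Gal_def)

lemma Gal_carrier_inv:
  assumes "\<sigma> \<in> Gal_carrier i"
  shows "inv_into UNIV \<sigma> \<in> Gal_carrier i" "inv_into UNIV \<sigma> \<circ> \<sigma> = id" "\<sigma> \<circ> inv_into UNIV \<sigma> = id"
proof -
  have b: "bij \<sigma>" and f: "field_hom \<sigma>" and i: "\<sigma> (i x) = i x" for x 
    using assms by (auto simp: Gal_carrier_def fun_eq_iff)
  let ?\<tau> = "inv_into UNIV \<sigma>"
  have st: "\<sigma> (?\<tau> x) = x" "?\<tau> (\<sigma> x) = x" for x using b by (simp_all add: bij_is_surj surj_f_inv_f bij_is_inj)
  then show "?\<tau> \<circ> \<sigma> = id" "\<sigma> \<circ> ?\<tau> = id" by auto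
  note F = field_homD[OF f]
  have eq: "x = y" if "\<sigma> x = \<sigma> y" for x y using F(9) that by blast
  have "field_hom ?\<tau>" unfolding field_hom_def
  proof (intro conjI allI)
    show "?\<tau> 1 = 1" by (rule eq) (simp add: st F)
    show "?\<tau> (x + y) = ?\<tau> x + ?\<tau> y" for x y by (rule eq) (simp add: st F)
    show "?\<tau> (x * y) = ?\<tau> x * ?\<tau> y" for x y by (rule eq) (simp add: st F)
  qed
  moreover have "bij ?\<tau>" using b by (rule bij_imp_bij_inv)
  moreover have "?\<tau> \<circ> i = i" using st(2) i by (metis comp_apply ext)
  ultimately show "?\<tau> \<in> Gal_carrier i" by (simp add: Gal_carrier_def)
qed

lemma group_Gal: "group (Gal i)"
proof (rule groupI)
  fix \<sigma> assume "\<sigma> \<in> carrier (Gal i)"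
  then show "\<exists>\<tau>\<in>carrier (Gal i). \<tau> \<otimes>\<^bsub>Gal i\<^esub> \<sigma> = \<one>\<^bsub>Gal i\<^esub>"
    using Gal_carrier_inv by (intro bexI[of _ "inv_into UNIV \<sigma>"]) auto
qed (auto simp: Gal_carrier_def field_hom_def bij_comp fun_eq_iff)

lemma inv_Gal: "\<sigma> \<in> Gal_carrier i \<Longrightarrow> inv\<^bsub>Gal i\<^esub> \<sigma> = inv_into UNIV \<sigma>"
  using group.inv_equality[OF group_Gal] Gal_carrier_inv by (metis Gal_simps(1-3))

lemma Gal_comp_eq: "Gal_carrier j = {\<sigma> \<in> Gal_carrier (j \<circ> h). \<sigma> \<circ> j = j}"
  by (auto simp: Gal_carrier_def fun_eq_iff)

lemma Gal_comp_subgroup: "subgroup (Gal_carrier j) (Gal (j \<circ> h))"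
proof -
  interpret group "Gal (j \<circ> h)" by (rule group_Gal)
  show ?thesis
  proof (rule subgroupI)
    show "Gal_carrier j \<subseteq> carrier (Gal (j \<circ> h))" using Gal_comp_eq by auto
    have "id \<in> Gal_carrier j" by (simp add: Gal_carrier_def field_hom_def)
    then show "Gal_carrier j \<noteq> {}" by blast
    fix \<sigma> assume s: "\<sigma> \<in> Gal_carrier j"
    then have "\<sigma> \<in> Gal_carrier (j \<circ> h)" using Gal_comp_eq by blast
    then show "inv\<^bsub>Gal (j \<circ> h)\<^esub> \<sigma> \<in> Gal_carrier j" using Gal_carrier_inv[OF s] inv_Gal by metis
    fix \<tau> assume "\<tau> \<in> Gal_carrier j"
    then show "\<sigma> \<otimes>\<^bsub>Gal (j \<circ> h)\<^esub> \<tau> \<in> Gal_carrier j" 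
      using s by (auto simp: Gal_carrier_def field_hom_def bij_comp fun_eq_iff)
  qed
qed

lemma Gal_comp_subgroup_of: "Gal j = subgroup_of (Gal (j \<circ> h)) (Gal_carrier j)"
proof -
  have "Gal_carrier (j \<circ> h) \<inter> Gal_carrier j = Gal_carrier j" using Gal_comp_eq by blast
  then show ?thesis by (simp add: subgroup_of_def Gal_def subtopology_subtopology)
qed

lemma Gal_eval_continuous: "continuous_map (topo (Gal i)) (discrete_topology UNIV) (\<lambda>\<sigma>. \<sigma> x)"
  using continuous_map_from_subtopology[OF continuous_map_product_projection[of x UNIV "\<lambda>_. discrete_topology UNIV"]] 
  by simp

lemma Gal_comp_closed: "closedin (topo (Gal (j \<circ> h))) (Gal_carrier j)"
proof -
  let ?T = "topo (Gal (j \<circ> h))"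
  have ts: "topspace ?T = Gal_carrier (j \<circ> h)" by simp
  have "closedin ?T {\<sigma> \<in> topspace ?T. \<sigma> (j x) \<in> {j x}}" for x
    by (rule closedin_continuous_map_preimage[OF Gal_eval_continuous]) simp
  then have "closedin ?T (\<Inter>x. {\<sigma> \<in> topspace ?T. \<sigma> (j x) \<in> {j x}})"
    by (intro closedin_Inter) auto
  also have "(\<Inter>x. {\<sigma> \<in> topspace ?T. \<sigma> (j x) \<in> {j x}}) = Gal_carrier j"
    unfolding ts Gal_comp_eq[of j h] by (auto simp: fun_eq_iff)
  finally show ?thesis .
qed

text \<open>
  Every \<open>\<sigma> \<in> Gal(L/K)\<close> maps \<open>j(K\<^sub>1)\<close> to itself and so induces \<open>\<rho> \<sigma> \<in> Gal(K\<^sub>1/K)\<close>.  This group is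
  commutative, hence commutators are the identity on \<open>j(K\<^sub>1)\<close>.
\<close>

lemma derived_Gal_subset:
  fixes h :: "'k::field \<Rightarrow> 'k1::field" and j :: "'k1 \<Rightarrow> 'l::field"
  assumes h: "abelian_extension h" and j: "field_hom j"
  shows "derived (Gal (j \<circ> h)) (carrier (Gal (j \<circ> h))) \<subseteq> Gal_carrier j"
proof -
  interpret group "Gal (j \<circ> h)" by (rule group_Gal)
  have gal: "galois_extension h" and comm: "comm_group (Gal h)" using h by (auto simp: abelian_extension_def)
  have hh: "field_hom h" using gal by (simp add: galois_extension_def separable_extension_def)
  note J = field_homD[OF j]
  define \<rho> where "\<rho> \<sigma> x = inv_into UNIV j (\<sigma> (j x))" for \<sigma> x
  have j\<rho>: "j (\<rho> \<sigma> x) = \<sigma> (j x)" if "\<sigma> \<in> Gal_carrier (j \<circ> h)" for \<sigma> x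
    unfolding \<rho>_def using galois_stable[OF gal j that] by (rule f_inv_into_f)
  have \<rho>: "\<rho> \<sigma> \<in> Gal_carrier h" if s: "\<sigma> \<in> Gal_carrier (j \<circ> h)" for \<sigma>
  proof -
    have fs: "field_hom \<sigma>" and fx: "\<sigma> (j (h x)) = j (h x)" for x 
      using s by (auto simp: Gal_carrier_def fun_eq_iff)
    note S = field_homD[OF fs]
    have eq: "x = y" if "j x = j y" for x y using J(9) that by blast
    have "field_hom (\<rho> \<sigma>)" unfolding field_hom_def
    proof (intro conjI allI)
      show "\<rho> \<sigma> 1 = 1" by (rule eq) (simp add: j\<rho> s S J)
      show "\<rho> \<sigma> (x + y) = \<rho> \<sigma> x + \<rho> \<sigma> y" for x y by (rule eq) (simp add: j\<rho> s S J)
      show "\<rho> \<sigma> (x * y) = \<rho> \<sigma> x * \<rho> \<sigma> y" for x y by (rule eq) (simp add: j\<rho> s S J)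
    qed
    moreover have "bij (\<rho> \<sigma>)"
    proof -
      let ?\<tau> = "inv_into UNIV \<sigma>"
      note t = Gal_carrier_inv[OF s]
      have "\<rho> \<sigma> (\<rho> ?\<tau> x) = x" "\<rho> ?\<tau> (\<rho> \<sigma> x) = x" for x
        by (rule eq, simp add: j\<rho> s t(1) pointfree_idE[OF t(2)] pointfree_idE[OF t(3)])+
      then show ?thesis by (intro o_bij[of "\<rho> ?\<tau>"]) auto
    qed
    moreover have "\<rho> \<sigma> \<circ> h = h" by (rule ext, rule eq) (simp add: j\<rho> s fx)
    ultimately show ?thesis by (simp add: Gal_carrier_def)
  qed
  have jc: "\<sigma> (\<tau> (j x)) = \<tau> (\<sigma> (j x))" 
    if st: "\<sigma> \<in> Gal_carrier (j \<circ> h)" "\<tau> \<in> Gal_carrier (j \<circ> h)" for \<sigma> \<tau> x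
  proof -
    have "\<rho> \<sigma> \<circ> \<rho> \<tau> = \<rho> \<tau> \<circ> \<rho> \<sigma>" 
      using comm_groupE(4)[OF comm] \<rho>[OF st(1)] \<rho>[OF st(2)] by simp
    then have "j (\<rho> \<sigma> (\<rho> \<tau> x)) = j (\<rho> \<tau> (\<rho> \<sigma> x))" by (metis comp_apply)
    then show ?thesis using j\<rho> st by simp
  qed
  show ?thesis unfolding derived_def
  proof (rule generate_subgroup_incl[OF _ Gal_comp_subgroup], clarify)
    fix \<sigma> \<tau> assume st: "\<sigma> \<in> carrier (Gal (j \<circ> h))" "\<tau> \<in> carrier (Gal (j \<circ> h))"
    let ?s = "inv_into UNIV \<sigma>" and ?t = "inv_into UNIV \<tau>"
    have s: "?s \<in> Gal_carrier (j \<circ> h)" "?t \<in> Gal_carrier (j \<circ> h)" using st Gal_carrier_inv by auto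
    have "\<sigma> (\<tau> (?s (?t (j x)))) = j x" for x
    proof -
      have "\<sigma> (?s z) = z" "\<tau> (?t z) = z" for z 
        using st Gal_carrier_inv(3) by (auto simp: fun_eq_iff)
      then show ?thesis using jc[OF s, of x] by simp
    qed
    moreover have "\<sigma> \<otimes>\<^bsub>Gal (j \<circ> h)\<^esub> \<tau> \<otimes>\<^bsub>Gal (j \<circ> h)\<^esub> inv\<^bsub>Gal (j \<circ> h)\<^esub> \<sigma> \<otimes>\<^bsub>Gal (j \<circ> h)\<^esub> inv\<^bsub>Gal (j \<circ> h)\<^esub> \<tau> 
      \<in> carrier (Gal (j \<circ> h))" using st by (intro m_closed inv_closed)
    ultimately show "\<sigma> \<otimes>\<^bsub>Gal (j \<circ> h)\<^esub> \<tau> \<otimes>\<^bsub>Gal (j \<circ> h)\<^esub> inv\<^bsub>Gal (j \<circ> h)\<^esub> \<sigma> \<otimes>\<^bsub>Gal (j \<circ> h)\<^esub> inv\<^bsub>Gal (j \<circ> h)\<^esub> \<tau> \<in> Gal_carrier j"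
      using st by (auto simp: Gal_comp_eq[of j h] inv_Gal)
  qed
qed

lemma Gal_conj_iso:
  fixes j :: "'k::field \<Rightarrow> 'l::field" and u :: "'l \<Rightarrow> 'm::field"
  assumes u: "field_hom u" "surj u"
  shows "topgroup_iso (Gal j) (Gal (u \<circ> j)) (\<lambda>\<sigma>. u \<circ> \<sigma> \<circ> inv_into UNIV u)"
proof -
  note U = field_homD[OF u(1)]
  let ?v = "inv_into UNIV u"
  have uv: "u (?v y) = y" "?v (u x) = x" for x y using U(8) u(2) by (simp_all add: surj_f_inv_f)
  have bu: "bij u" using U(8) u(2) by (simp add: bij_def)
  have eq: "x = y" if "u x = u y" for x y using U(9) that by blast
  have v: "field_hom ?v" unfolding field_hom_def
  proof (intro conjI allI)
    show "?v 1 = 1" by (rule eq) (simp add: uv U)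
    show "?v (x + y) = ?v x + ?v y" for x y by (rule eq) (simp add: uv U)
    show "?v (x * y) = ?v x * ?v y" for x y by (rule eq) (simp add: uv U)
  qed
  let ?f = "\<lambda>\<sigma>. u \<circ> \<sigma> \<circ> ?v" and ?g = "\<lambda>\<tau>. ?v \<circ> \<tau> \<circ> u"
  have f: "?f \<sigma> \<in> Gal_carrier (u \<circ> j)" if "\<sigma> \<in> Gal_carrier j" for \<sigma>
    using that v u(1) bu by (auto simp: Gal_carrier_def field_hom_comp uv fun_eq_iff bij_comp bij_imp_bij_inv)
  have g: "?g \<tau> \<in> Gal_carrier j" if "\<tau> \<in> Gal_carrier (u \<circ> j)" for \<tau>
    using that v u(1) bu by (auto simp: Gal_carrier_def field_hom_comp uv fun_eq_iff bij_comp bij_imp_bij_inv)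
  have fg: "?f (?g \<tau>) = \<tau>" "?g (?f \<sigma>) = \<sigma>" for \<sigma> \<tau> by (auto simp: fun_eq_iff uv)
  have "?f \<in> iso (Gal j) (Gal (u \<circ> j))"
    unfolding iso_def
  proof (intro CollectI conjI)
    show "?f \<in> hom (Gal j) (Gal (u \<circ> j))" using f by (auto simp: hom_def fun_eq_iff uv)
    show "bij_betw ?f (carrier (Gal j)) (carrier (Gal (u \<circ> j)))"
      by (rule bij_betw_byWitness[where f' = ?g]) (use f g fg in auto)
  qed
  moreover have "homeomorphic_maps (topo (Gal j)) (topo (Gal (u \<circ> j))) ?f ?g"
    unfolding homeomorphic_maps_def
  proof (intro conjI)
    have disc: "continuous_map (topo (Gal i)) (discrete_topology UNIV) (\<lambda>\<sigma>. w (\<sigma> x))" 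
      for i :: "'c::field \<Rightarrow> 'd::field" and w :: "'d \<Rightarrow> 'e" and x
      using continuous_map_compose[OF Gal_eval_continuous[of i x], of "discrete_topology UNIV" w] 
      by (simp add: o_def)
    show "continuous_map (topo (Gal j)) (topo (Gal (u \<circ> j))) ?f"
      using f disc[of j u] unfolding Gal_simps(4)[of "u \<circ> j"] continuous_map_in_subtopology 
      by (auto simp: continuous_map_componentwise_UNIV)
    show "continuous_map (topo (Gal (u \<circ> j))) (topo (Gal j)) ?g"
      using g disc[of "u \<circ> j" ?v] unfolding Gal_simps(4)[of j] continuous_map_in_subtopology 
      by (auto simp: continuous_map_componentwise_UNIV)
  qed (use fg in auto)
  then have "homeomorphic_map (topo (Gal j)) (topo (Gal (u \<circ> j))) ?f" by (rule homeomorphic_maps_imp_map)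
  ultimately show ?thesis by (simp add: topgroup_iso_def)
qed

text \<open>
  The separable closure \<open>K\<^sub>s\<close> of \<open>K\<close> contains a copy \<open>j(K\<^sub>1)\<close> of \<open>K\<^sub>1\<close> and is separable over it, so it
  embeds over \<open>K\<^sub>1\<close> into the separable closure of \<open>K\<^sub>1\<close>, by \<open>u\<close> say.  As \<open>K\<^sub>s\<close> is separably closed,
  \<open>u\<close> is surjective, and conjugation by \<open>u\<close> identifies the two groups over \<open>K\<^sub>1\<close>.
\<close>

theorem Gal_abelian_extension:
  fixes h :: "'k::field \<Rightarrow> 'k1::field" and i :: "'k \<Rightarrow> 'ks::field" and i1 :: "'k1 \<Rightarrow> 'k1s::field"
  assumes h: "abelian_extension h" and i: "separable_closure i" and i1: "separable_closure i1"
  shows "\<exists>H \<theta>. subgroup H (Gal i) \<and> closedin (topo (Gal i)) H \<and> derived (Gal i) (carrier (Gal i)) \<subseteq> H \<and>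
    topgroup_iso (subgroup_of (Gal i) H) (Gal i1) \<theta>"
proof -
  have sh: "separable_extension h" using h by (simp add: abelian_extension_def galois_extension_def)
  then have hh: "field_hom h" by (simp add: separable_extension_def)
  have si: "separable_extension i" "separably_closed TYPE('ks)" 
    and si1: "separable_extension i1" "separably_closed TYPE('k1s)"
    using i i1 by (auto simp: separable_closure_def)
  have hi: "field_hom i" and hi1: "field_hom i1" using si si1 by (auto simp: separable_extension_def)
  obtain j where j: "field_hom j" "j \<circ> h = i" using separable_extension_embeds[OF sh hi si(2)] by blast
  have sj: "separable_extension j" using separable_extension_upper[OF hh j(1)] j(2) si(1) by simp
  obtain u where u: "field_hom u" "u \<circ> j = i1" using separable_extension_embeds[OF sj hi1 si1(2)] by blast
  have "surj u" using separably_closed_no_proper_separable_extension[OF j(1) u(1) _ si(2)] u(2) si1(1) by simp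
  from Gal_conj_iso[OF u(1) this, of j] 
  have "topgroup_iso (subgroup_of (Gal i) (Gal_carrier j)) (Gal i1) (\<lambda>\<sigma>. u \<circ> \<sigma> \<circ> inv_into UNIV u)"
    unfolding u(2) Gal_comp_subgroup_of[of j h] j(2) .
  then show ?thesis
    using Gal_comp_subgroup[of j h] Gal_comp_closed[of j h] derived_Gal_subset[OF h j(1)]
    unfolding j(2) by blast
qed

section \<open>Subgroups and extensions of countably infinite rank\<close>

theorem free_closed_subgroup_containing_derived:
  fixes P :: "'a topgroup"
  assumes P: "free_profinite_countably_infinite_rank P"
    and N: "subgroup N P" "closedin (topo P) N" "derived P (carrier P) \<subseteq> N"
  shows "free_profinite_countably_infinite_rank (subgroup_of P N)"
proof (cases "N = carrier P")
  case True
  have "profinite P" using P by (auto simp: free_profinite_countably_infinite_rank_def free_profinite_on_def)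
  then have "topspace (topo P) = carrier P" by (intro topological_groupD(2) profiniteD(1))
  then have "subgroup_of P N = P" by (simp add: True subgroup_of_def subtopology_topspace flip: \<open>topspace (topo P) = carrier P\<close>)
  then show ?thesis using P by simp
next
  case False
  obtain S where S: "free_profinite_on P S" "countable S" "infinite S"
    using P by (auto simp: free_profinite_countably_infinite_rank_def)
  have pf: "profinite P" using S by (simp add: free_profinite_on_def)
  have pN: "profinite (subgroup_of P N)" by (rule profinite_closed_subgroup[OF pf N(1,2)])
  obtain B where B: "countable_base_at_one P B" using countable_base_free[OF S(1,2)] by blast
  obtain \<theta> where "topgroup_iso P (subgroup_of P N) \<theta>"
    using isomorphic_if_embedding_problems_solvable[OF pf B free_solves_finite_embedding_problems[OF S(1,3)]
        pN countable_base_closed_subgroup[OF pf B N(1)]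
        closed_subgroup_solves_finite_embedding_problems[OF S(1,3) N False]] by blast
  then show ?thesis by (rule free_profinite_countably_infinite_rank_iso[OF P pN])
qed

theorem free_absolute_Galois_group_abelian_extension:
  fixes h :: "'k::field \<Rightarrow> 'k1::field" and i :: "'k \<Rightarrow> 'ks::field" and i1 :: "'k1 \<Rightarrow> 'k1s::field"
  assumes h: "abelian_extension h" and i: "separable_closure i" and i1: "separable_closure i1"
    and free: "free_profinite_countably_infinite_rank (Gal i)"
  shows "free_profinite_countably_infinite_rank (Gal i1)"
proof -
  obtain H \<theta> where H: "subgroup H (Gal i)" "closedin (topo (Gal i)) H" 
    "derived (Gal i) (carrier (Gal i)) \<subseteq> H" and \<theta>: "topgroup_iso (subgroup_of (Gal i) H) (Gal i1) \<theta>"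
    using Gal_abelian_extension[OF h i i1] by blast
  have fH: "free_profinite_countably_infinite_rank (subgroup_of (Gal i) H)"
    by (rule free_closed_subgroup_containing_derived[OF free H])
  have "profinite (subgroup_of (Gal i) H)" 
    using fH by (auto simp: free_profinite_countably_infinite_rank_def free_profinite_on_def)
  then have "profinite (Gal i1)" by (rule profinite_iso[OF _ group_Gal _ \<theta>]) simp
  then show ?thesis by (rule free_profinite_countably_infinite_rank_iso[OF fH _ \<theta>])
qed

theorem proposition3p2:
  fixes P :: "'a topgroup" and P1 :: "'a set"
    and h :: "'k::field \<Rightarrow> 'k1::field"
    and i :: "'k \<Rightarrow> 'ks::field" and i1 :: "'k1 \<Rightarrow> 'k1s::field"
  shows
    "(profinite P \<and> subgroup P1 P \<and> closedin (topo P) P1 \<and> derived P (carrier P) \<subseteq> P1 \<and>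
      free_profinite_countably_infinite_rank P \<longrightarrow>
      free_profinite_countably_infinite_rank (subgroup_of P P1))
     \<and>
     (abelian_extension h \<and> separable_closure i \<and> separable_closure i1 \<and>
      free_profinite_countably_infinite_rank (Gal i) \<longrightarrow>
      free_profinite_countably_infinite_rank (Gal i1))"
  using free_closed_subgroup_containing_derived[of P P1]
    free_absolute_Galois_group_abelian_extension[of h i i1]
  by blast

end
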